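(* Let $\Phi=D_l$ with $l>4$ and let $K$ be a field with $\operatorname{char}K\ne2$. Put $$\lambda=\alpha_{l-1},\qquad \rho=\alpha_1+\alpha_2+2\alpha_3+\dots+2\alpha_{l-2}+\alpha_{l-1},$$ $$\sigma=\alpha_{l-2}+\alpha_{l-1}+\alpha_l,\qquad \tau=\alpha_1+\alpha_2+2\alpha_3+\dots+2\alpha_{l-3}+\alpha_{l-2}+\alpha_{l-1}+\alpha_l$$ (in $\rho$ the coefficient of $\alpha_i$ is $2$ for $3\le i\le l-2$; in $\tau$ it is $2$ for $3\le i\le l-3$). For $k\in K^*$ let $\sim_k$ be the equivalence relation on $K^*$ given by $$a\sim_k b\iff \exists\,x,y\in K:\ x^2-ky^2=ab,$$ and let $K_k=K^*/{\sim_k}$ be the set of its classes. Then the orbits of $G_0$ on $V_1$ (with $G_0$, $V_1$ as in the context) are exactly the following (when a parameter is said to lie in a set of classes, it runs over a fixed set of representatives of these classes; different types and different values of parameters give different orbits): I. The zero orbit, $x=0$. II. One orbit of singular vectors; its elements can be brought to the form $x=e_\lambda$. III. One series of orbits and one separate orbit of brilliant vectors; their elements can be brought to one of the following forms: (a) $x=e_\lambda+x^\rho e_\rho$, $x^\rho\in K^*/(K^* )^2$; (b) $x=e_\lambda+e_\sigma$. IV. One series of orbits of luminous vectors; their elements can be brought to the form $x=e_\lambda+x^\rho e_\rho+e_\sigma$, $x^\rho\in K^*/(K^* )^2$. V. One series of orbits of dark vectors; their elements can be brought to the form $x=e_\lambda+x^\rho e_\rho+e_\sigma+x^\tau e_\tau$,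 where $k\in K^*$, $x^\rho\in K_k$, $x^\tau=\dfrac{k}{x^\rho}$.
   Context: Numbering: the simple roots of $D_l$ are $\Pi=\{\alpha_1,\dots,\alpha_l\}$, where $\alpha_1$ and $\alpha_2$ are the two end nodes of the fork, both adjacent to $\alpha_3$, and $\alpha_3,\alpha_4,\dots,\alpha_l$ form a chain in this order. The maximal root is $\delta=\alpha_1+\alpha_2+2\alpha_3+\dots+2\alpha_{l-1}+\alpha_l$. Lie algebra and group: $V=V(\Phi)$ is the Lie algebra of type $\Phi$ over $K$ (the $\mathbb Z$-span of a Chevalley basis tensored with $K$) with Chevalley basis $\{e_\alpha,\alpha\in\Phi;\ h_\alpha,\alpha\in\Pi\}$: $[e_\alpha,e_{-\alpha}]=h_\alpha$, $[h_\alpha,e_\beta]=\frac{2(\alpha,\beta)}{(\alpha,\alpha)}e_\beta$, $[e_\alpha,e_\beta]=N_{\alpha\beta}e_{\alpha+\beta}$ with $N_{\alpha\beta}=\pm1$ if $\alpha+\beta\in\Phi$, and $[e_\alpha,e_\beta]=0$ if $\alpha+\beta\notin\Phi$, $\beta\ne-\alpha$. The Chevalley basis is assumed positive: $N_{\alpha_i\beta}=1$ whenever $\alpha_i\in\Pi$, $\beta,\alpha_i+\beta\in\Phi^+$, and $\alpha_i$ is the simple root with smallest index such that subtracting it from $\alpha_i+\beta$ gives a root. For $x\in V$ write $x=\sum_{\alpha\in\Phi}x^\alpha e_\alpha+x^h$ with $x^h$ in the Cartan subalgebra. $G=G_{\rm sc}(\Phi,K)$ is the simply connected Chevalley group generated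 by the elementary root elements $x_\alpha(a)$, $\alpha\in\Phi$, $a\in K$, acting on $V$ by the adjoint action ($x_\alpha(a)=\exp(a\,\mathrm{ad}\,e_\alpha)$; in particular $x_\alpha(a)e_\beta=e_\beta+N_{\alpha\beta}a e_{\alpha+\beta}$ if $\angle(\alpha,\beta)=2\pi/3$, and $x_\alpha(a)e_{-\alpha}=e_{-\alpha}+ah_\alpha-a^2e_\alpha$). $G_0$ and $V_1$: $\Phi_0=\{\alpha\in\Phi:\alpha\perp\delta\}$, $\Phi_1=\{\alpha\in\Phi:\angle(\alpha,\delta)=\pi/3\}$; $G_0=G_{\rm sc}(\Phi_0,K)$ is the subgroup of $G$ generated by the $x_\alpha(a)$, $\alpha\in\Phi_0$, $a\in K$; $V_1$ is the $K$-span of $e_\alpha$, $\alpha\in\Phi_1$. The group $G_0$ acts on $V_1$ by restriction. Types of vectors: a root element of $V$ is an element of the form $g e_\alpha$ with $g\in G$, $\alpha\in\Phi$. Two root elements $y,z$ have angle $\varphi$ between them if for some $g\in G$ one has $gy\in K^*e_\alpha$, $gz\in K^*e_\beta$ with $\alpha,\beta\in\Phi$, $\angle(\alpha,\beta)=\varphi$. It is known (for $\Phi\ne A_l$, $\operatorname{char}K\neq2$) that for every $x=\sum_{\alpha\in\Phi_1}x^\alpha e_\alpha\in V_1$ there is a unique root element $y=\sum_{\alpha\in\Phi}y^\alpha e_\alpha+y^h$ with $y^\alpha=x^\alpha$ for $\alpha\in\Phi_1$, $y^\delta=1$ and $y^h\in\langle h_\alpha;\alpha\in\Phi_0\cap\Pi\rangle$.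 The vector $x$ is called dark if the angle between $y$ and $e_\delta$ is $\pi$ (equivalently, $y^{-\delta}\neq0$), luminous if this angle is $2\pi/3$, brilliant if it is $\pi/2$, and singular if it is $\pi/3$ (equivalently, $x$ is itself a root element). *)

theory Defs
  imports Complex_Main "HOL-Library.Function_Algebras" "HOL-Computational_Algebra.Computational_Algebra"
begin

section \<open>The root system of type D\<close>

text \<open>
  Roots of $D_l$ are the integer vectors $\pm\varepsilon_i\pm\varepsilon_j$ with
  $1 \le i < j \le l$, encoded as functions on indices that vanish outside $1,\dots,l$.
\<close>

type_synonym root = "nat \<Rightarrow> int"

definition eps :: "nat \<Rightarrow> root" where
  "eps i = (\<lambda>j. if j = i then 1 else 0)"

definition roots :: "nat \<Rightarrow> root set" where
  "roots l = {\<lambda>k. s * eps i k + t * eps j k | i j s t.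
      1 \<le> i \<and> i < j \<and> j \<le> l \<and> s \<in> {1, -1} \<and> t \<in> {1, -1}}"

definition inner_prod :: "nat \<Rightarrow> root \<Rightarrow> root \<Rightarrow> int" where
  "inner_prod l \<alpha> \<beta> = (\<Sum>i=1..l. \<alpha> i * \<beta> i)"

definition root_angle :: "nat \<Rightarrow> root \<Rightarrow> root \<Rightarrow> real" where
  "root_angle l \<alpha> \<beta> = arccos (real_of_int (inner_prod l \<alpha> \<beta>) /
     (sqrt (real_of_int (inner_prod l \<alpha> \<alpha>)) * sqrt (real_of_int (inner_prod l \<beta> \<beta>))))"

definition cartan_int :: "nat \<Rightarrow> root \<Rightarrow> root \<Rightarrow> int" where
  "cartan_int l \<alpha> \<beta> = 2 * inner_prod l \<alpha> \<beta> div inner_prod l \<alpha> \<alpha>"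

text \<open>
  Numbering of the simple roots: 1 and 2 are the two end nodes of the fork, both adjacent
  to 3, and $3, 4, \dots, l$ form a chain in this order. This is the reverse of the
  Bourbaki numbering.
\<close>

definition simple_root :: "nat \<Rightarrow> nat \<Rightarrow> root" where
  "simple_root l i = (if i = 1 then eps (l - 1) + eps l
                      else eps (l + 1 - i) - eps (l + 2 - i))"

definition root_comb :: "nat \<Rightarrow> (nat \<Rightarrow> int) \<Rightarrow> root" where
  "root_comb l m = (\<lambda>j. \<Sum>i=1..l. m i * simple_root l i j)"

definition root_coeffs :: "nat \<Rightarrow> root \<Rightarrow> nat \<Rightarrow> int" where
  "root_coeffs l \<alpha> = (THE m. (\<forall>i. i \<notin> {1..l} \<longrightarrow> m i = 0) \<and> root_comb l m = \<alpha>)"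

definition pos_roots :: "nat \<Rightarrow> root set" where
  "pos_roots l = {\<alpha> \<in> roots l. \<forall>i\<in>{1..l}. root_coeffs l \<alpha> i \<ge> 0}"

definition root_delta :: "nat \<Rightarrow> root" where
  "root_delta l = root_comb l (\<lambda>i. if i \<in> {1, 2, l} then 1 else 2)"

definition root_lambda :: "nat \<Rightarrow> root" where
  "root_lambda l = simple_root l (l - 1)"

definition root_rho :: "nat \<Rightarrow> root" where
  "root_rho l = root_comb l (\<lambda>i. if i = l then 0 else if i \<in> {1, 2, l - 1} then 1 else 2)"

definition root_sigma :: "nat \<Rightarrow> root" where
  "root_sigma l = simple_root l (l - 2) + simple_root l (l - 1) + simple_root l l"

definition root_tau :: "nat \<Rightarrow> root" where
  "root_tau l = root_comb l (\<lambda>i. if i \<in> {1, 2, l - 2, l - 1, l} then 1 else 2)"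

definition roots0 :: "nat \<Rightarrow> root set" where
  "roots0 l = {\<alpha> \<in> roots l. inner_prod l \<alpha> (root_delta l) = 0}"

definition roots1 :: "nat \<Rightarrow> root set" where
  "roots1 l = {\<alpha> \<in> roots l. root_angle l \<alpha> (root_delta l) = pi / 3}"


section \<open>The Lie algebra and its positive Chevalley basis\<close>

text \<open>
  Elements of the Lie algebra are given by their coordinates in the Chevalley basis:
  \<open>Root \<alpha>\<close> indexes $e_\alpha$, and \<open>Cartan i\<close> indexes $h_{\alpha_i}$.
\<close>

datatype basis_index = Root root | Cartan nat

type_synonym 'k vec = "basis_index \<Rightarrow> 'k"

definition basis_indices :: "nat \<Rightarrow> basis_index set" where
  "basis_indices l = Root ` roots l \<union> Cartan ` {1..l}"

definition lie_space :: "nat \<Rightarrow> ('k::comm_ring_1) vec set" where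
  "lie_space l = {v. \<forall>b. b \<notin> basis_indices l \<longrightarrow> v b = 0}"

definition smult_vec :: "'k::comm_ring_1 \<Rightarrow> 'k vec \<Rightarrow> 'k vec" (infixr "*\<^sub>v" 75) where
  "c *\<^sub>v v = (\<lambda>b. c * v b)"

definition basis_vec :: "basis_index \<Rightarrow> ('k::comm_ring_1) vec" where
  "basis_vec b = (\<lambda>c. if c = b then 1 else 0)"

abbreviation root_vec :: "root \<Rightarrow> ('k::comm_ring_1) vec" where
  "root_vec \<alpha> \<equiv> basis_vec (Root \<alpha>)"

text \<open>
  The element $h_\alpha$ for an arbitrary root: all roots have the same length, so the
  coroot of $\sum m_i\alpha_i$ is $\sum m_i\alpha_i^\vee$.
\<close>

definition h_vec :: "nat \<Rightarrow> root \<Rightarrow> ('k::comm_ring_1) vec" where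
  "h_vec l \<alpha> = (\<Sum>i=1..l. of_int (root_coeffs l \<alpha> i) *\<^sub>v basis_vec (Cartan i))"

fun basis_bracket ::
  "nat \<Rightarrow> (root \<Rightarrow> root \<Rightarrow> int) \<Rightarrow> basis_index \<Rightarrow> basis_index \<Rightarrow> ('k::comm_ring_1) vec" where
  "basis_bracket l N (Root \<alpha>) (Root \<beta>) =
     (if \<beta> = - \<alpha> then h_vec l \<alpha>
      else if \<alpha> + \<beta> \<in> roots l then of_int (N \<alpha> \<beta>) *\<^sub>v root_vec (\<alpha> + \<beta>)
      else 0)"
| "basis_bracket l N (Cartan i) (Root \<beta>) =
     of_int (cartan_int l (simple_root l i) \<beta>) *\<^sub>v root_vec \<beta>"
| "basis_bracket l N (Root \<alpha>) (Cartan j) =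
     of_int (- cartan_int l (simple_root l j) \<alpha>) *\<^sub>v root_vec \<alpha>"
| "basis_bracket l N (Cartan i) (Cartan j) = 0"

definition bracket ::
  "nat \<Rightarrow> (root \<Rightarrow> root \<Rightarrow> int) \<Rightarrow> ('k::comm_ring_1) vec \<Rightarrow> 'k vec \<Rightarrow> 'k vec" where
  "bracket l N x y =
     (\<Sum>b\<in>basis_indices l. \<Sum>c\<in>basis_indices l. (x b * y c) *\<^sub>v basis_bracket l N b c)"

text \<open>
  \<open>N\<close> is a family of structure constants of a Chevalley basis: they are $\pm 1$ and
  the bracket they define on the integral span of the basis is a Lie bracket.
\<close>

definition chevalley_constants :: "nat \<Rightarrow> (root \<Rightarrow> root \<Rightarrow> int) \<Rightarrow> bool" where
  "chevalley_constants l N \<longleftrightarrow>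
     (\<forall>\<alpha>\<in>roots l. \<forall>\<beta>\<in>roots l. \<alpha> + \<beta> \<in> roots l \<longrightarrow> N \<alpha> \<beta> \<in> {1, -1}) \<and>
     (\<forall>x\<in>lie_space l. bracket l N x x = (0 :: int vec)) \<and>
     (\<forall>x\<in>lie_space l. \<forall>y\<in>lie_space l. \<forall>z\<in>lie_space l.
        bracket l N x (bracket l N y z) + bracket l N y (bracket l N z x)
          + bracket l N z (bracket l N x y) = (0 :: int vec))"

definition positive_constants :: "nat \<Rightarrow> (root \<Rightarrow> root \<Rightarrow> int) \<Rightarrow> bool" where
  "positive_constants l N \<longleftrightarrow>
     (\<forall>i\<in>{1..l}. \<forall>\<beta>\<in>pos_roots l.
        simple_root l i + \<beta> \<in> pos_roots l \<longrightarrow>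
        (\<forall>j\<in>{1..<i}. simple_root l i + \<beta> - simple_root l j \<notin> roots l) \<longrightarrow>
        N (simple_root l i) \<beta> = 1)"


section \<open>The Chevalley group\<close>

text \<open>
  The exponential series of $a\,\mathrm{ad}\,e_\alpha$ stops after the quadratic term, because
  $(\mathrm{ad}\,e_\alpha)^3 = 0$. The division by 2 makes this the right operator only in
  characteristic different from 2.
\<close>

definition elem_root ::
  "nat \<Rightarrow> (root \<Rightarrow> root \<Rightarrow> int) \<Rightarrow> root \<Rightarrow> 'k::field \<Rightarrow> 'k vec \<Rightarrow> 'k vec" where
  "elem_root l N \<alpha> a v =
     (\<Sum>n\<le>2. (a ^ n / of_nat (fact n)) *\<^sub>v (bracket l N (root_vec \<alpha>) ^^ n) v)"

text \<open>
  The group generated by the $x_\alpha(a)$ with $\alpha$ in a given set of roots, as a group of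
  operators on the Lie algebra. Closure under inverses need not be required, since
  $x_\alpha(a)^{-1} = x_\alpha(-a)$.
\<close>

inductive_set elem_group ::
  "nat \<Rightarrow> (root \<Rightarrow> root \<Rightarrow> int) \<Rightarrow> root set \<Rightarrow> (('k::field) vec \<Rightarrow> 'k vec) set"
  for l N \<Psi> where
  one: "(\<lambda>v. v) \<in> elem_group l N \<Psi>"
| mult: "g \<in> elem_group l N \<Psi> \<Longrightarrow> \<alpha> \<in> \<Psi> \<Longrightarrow> (\<lambda>v. elem_root l N \<alpha> a (g v)) \<in> elem_group l N \<Psi>"

abbreviation group_G :: "nat \<Rightarrow> (root \<Rightarrow> root \<Rightarrow> int) \<Rightarrow> (('k::field) vec \<Rightarrow> 'k vec) set" where
  "group_G l N \<equiv> elem_group l N (roots l)"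

abbreviation group_G0 :: "nat \<Rightarrow> (root \<Rightarrow> root \<Rightarrow> int) \<Rightarrow> (('k::field) vec \<Rightarrow> 'k vec) set" where
  "group_G0 l N \<equiv> elem_group l N (roots0 l)"

definition space_V1 :: "nat \<Rightarrow> ('k::field) vec set" where
  "space_V1 l = {(\<Sum>\<alpha>\<in>roots1 l. c \<alpha> *\<^sub>v root_vec \<alpha>) | c. True}"

definition orbit0 :: "nat \<Rightarrow> (root \<Rightarrow> root \<Rightarrow> int) \<Rightarrow> ('k::field) vec \<Rightarrow> 'k vec set" where
  "orbit0 l N v = {g v | g. g \<in> group_G0 l N}"


section \<open>Root elements and types of vectors\<close>

definition root_element :: "nat \<Rightarrow> (root \<Rightarrow> root \<Rightarrow> int) \<Rightarrow> ('k::field) vec \<Rightarrow> bool" where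
  "root_element l N y \<longleftrightarrow> (\<exists>g\<in>group_G l N. \<exists>\<alpha>\<in>roots l. y = g (root_vec \<alpha>))"

definition has_angle ::
  "nat \<Rightarrow> (root \<Rightarrow> root \<Rightarrow> int) \<Rightarrow> ('k::field) vec \<Rightarrow> 'k vec \<Rightarrow> real \<Rightarrow> bool" where
  "has_angle l N y z \<phi> \<longleftrightarrow>
     (\<exists>g\<in>group_G l N. \<exists>\<alpha>\<in>roots l. \<exists>\<beta>\<in>roots l. \<exists>c d. c \<noteq> 0 \<and> d \<noteq> 0 \<and>
        g y = c *\<^sub>v root_vec \<alpha> \<and> g z = d *\<^sub>v root_vec \<beta> \<and> root_angle l \<alpha> \<beta> = \<phi>)"

definition root_lift :: "nat \<Rightarrow> (root \<Rightarrow> root \<Rightarrow> int) \<Rightarrow> ('k::field) vec \<Rightarrow> 'k vec" where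
  "root_lift l N x = (THE y. root_element l N y \<and>
     (\<forall>\<alpha>\<in>roots1 l. y (Root \<alpha>) = x (Root \<alpha>)) \<and>
     y (Root (root_delta l)) = 1 \<and>
     (\<forall>i\<in>{1..l}. simple_root l i \<notin> roots0 l \<longrightarrow> y (Cartan i) = 0))"

definition dark :: "nat \<Rightarrow> (root \<Rightarrow> root \<Rightarrow> int) \<Rightarrow> ('k::field) vec \<Rightarrow> bool" where
  "dark l N x \<longleftrightarrow> has_angle l N (root_lift l N x) (root_vec (root_delta l)) pi"

definition luminous :: "nat \<Rightarrow> (root \<Rightarrow> root \<Rightarrow> int) \<Rightarrow> ('k::field) vec \<Rightarrow> bool" where
  "luminous l N x \<longleftrightarrow> has_angle l N (root_lift l N x) (root_vec (root_delta l)) (2 * pi / 3)"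

definition brilliant :: "nat \<Rightarrow> (root \<Rightarrow> root \<Rightarrow> int) \<Rightarrow> ('k::field) vec \<Rightarrow> bool" where
  "brilliant l N x \<longleftrightarrow> has_angle l N (root_lift l N x) (root_vec (root_delta l)) (pi / 2)"

definition singular :: "nat \<Rightarrow> (root \<Rightarrow> root \<Rightarrow> int) \<Rightarrow> ('k::field) vec \<Rightarrow> bool" where
  "singular l N x \<longleftrightarrow> has_angle l N (root_lift l N x) (root_vec (root_delta l)) (pi / 3)"


section \<open>Parameters of the orbits\<close>

definition units_of_field :: "('k::field) set" where
  "units_of_field = {a. a \<noteq> 0}"

definition square_rel :: "(('k::field) \<times> 'k) set" where
  "square_rel = {(a, b). a \<in> units_of_field \<and> b \<in> units_of_field \<and>
     (\<exists>c\<in>units_of_field. a = b * c^2)}"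

definition norm_rel :: "'k::field \<Rightarrow> ('k \<times> 'k) set" where
  "norm_rel k = {(a, b). a \<in> units_of_field \<and> b \<in> units_of_field \<and>
     (\<exists>x y. x^2 - k * y^2 = a * b)}"

lemma equiv_square_rel: "equiv (units_of_field :: 'k::field set) square_rel"
proof (rule equivI)
  show "square_rel \<subseteq> (units_of_field :: 'k set) \<times> units_of_field"
    by (auto simp: square_rel_def)
  show "refl_on units_of_field (square_rel :: ('k \<times> 'k) set)"
    by (auto simp: refl_on_def square_rel_def units_of_field_def intro!: exI[of _ 1])
  show "sym (square_rel :: ('k \<times> 'k) set)"
  proof (rule symI)
    fix a b :: 'k assume "(a, b) \<in> square_rel"
    then obtain c where nz: "a \<noteq> 0" "b \<noteq> 0" "c \<noteq> 0" and a: "a = b * c^2"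
      unfolding square_rel_def units_of_field_def by blast
    from nz have "b = a * (inverse c)^2"
      unfolding a by (simp add: power_inverse mult.assoc)
    moreover from nz have "inverse c \<noteq> 0" by simp
    ultimately show "(b, a) \<in> square_rel"
      using nz unfolding square_rel_def units_of_field_def by blast
  qed
  show "trans (square_rel :: ('k \<times> 'k) set)"
  proof (rule transI)
    fix a b c :: 'k assume "(a, b) \<in> square_rel" "(b, c) \<in> square_rel"
    then obtain s t where nz: "a \<noteq> 0" "c \<noteq> 0" "s \<noteq> 0" "t \<noteq> 0"
      and ab: "a = b * s^2" and bc: "b = c * t^2"
      unfolding square_rel_def units_of_field_def by blast
    have "a = c * (t * s)^2"
      unfolding ab bc by (simp only: power_mult_distrib mult.assoc)
    moreover from nz have "t * s \<noteq> 0" by simp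
    ultimately show "(a, c) \<in> square_rel"
      using nz unfolding square_rel_def units_of_field_def by blast
  qed
qed

lemma equiv_norm_rel: "equiv (units_of_field :: 'k::field set) (norm_rel k)"
proof (rule equivI)
  show "norm_rel k \<subseteq> (units_of_field :: 'k set) \<times> units_of_field"
    by (auto simp: norm_rel_def)
  have "\<exists>x y. x^2 - k * y^2 = a * a" for a :: 'k
    by (rule exI[of _ a], rule exI[of _ 0]) (simp add: power2_eq_square)
  then show "refl_on units_of_field (norm_rel k)"
    by (auto simp: refl_on_def norm_rel_def)
  show "sym (norm_rel k)"
    by (auto simp: norm_rel_def sym_def mult.commute)
  show "trans (norm_rel k)"
  proof (rule transI)
    fix a b c :: 'k assume "(a, b) \<in> norm_rel k" "(b, c) \<in> norm_rel k"
    then obtain x y u v where nz: "a \<noteq> 0" "b \<noteq> 0" "c \<noteq> 0"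
      and xy: "x^2 - k * y^2 = a * b" and uv: "u^2 - k * v^2 = b * c"
      unfolding norm_rel_def units_of_field_def by blast
    have "(x * u + k * y * v)^2 - k * (x * v + y * u)^2 = (x^2 - k * y^2) * (u^2 - k * v^2)"
      by (simp add: power2_eq_square algebra_simps)
    also have "\<dots> = a * c * b^2"
      unfolding xy uv by (simp only: power2_eq_square ac_simps)
    finally have "((x * u + k * y * v) / b)^2 - k * ((x * v + y * u) / b)^2 = a * c"
      using nz by (simp add: power_divide diff_divide_distrib[symmetric])
    with nz show "(a, c) \<in> norm_rel k"
      unfolding norm_rel_def units_of_field_def by blast
  qed
qed

definition representatives :: "'a set \<Rightarrow> ('a \<times> 'a) set \<Rightarrow> 'a set \<Rightarrow> bool" where
  "representatives A r R \<longleftrightarrow> R \<subseteq> A \<and> (\<forall>C\<in>A // r. \<exists>!a. a \<in> R \<inter> C)"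

datatype 'k orbit_type =
    Zero
  | Singular
  | Brilliant_a 'k
  | Brilliant_b
  | Luminous 'k
  | Dark 'k 'k

fun normal_form :: "nat \<Rightarrow> ('k::field) orbit_type \<Rightarrow> 'k vec" where
  "normal_form l Zero = 0"
| "normal_form l Singular = root_vec (root_lambda l)"
| "normal_form l (Brilliant_a a) =
     root_vec (root_lambda l) + a *\<^sub>v root_vec (root_rho l)"
| "normal_form l Brilliant_b =
     root_vec (root_lambda l) + root_vec (root_sigma l)"
| "normal_form l (Luminous a) =
     root_vec (root_lambda l) + a *\<^sub>v root_vec (root_rho l) + root_vec (root_sigma l)"
| "normal_form l (Dark k a) =
     root_vec (root_lambda l) + a *\<^sub>v root_vec (root_rho l) + root_vec (root_sigma l)
       + (k / a) *\<^sub>v root_vec (root_tau l)"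

definition orbit_types :: "('k::field) set \<Rightarrow> ('k \<Rightarrow> 'k set) \<Rightarrow> 'k orbit_type set" where
  "orbit_types S R = {Zero, Singular, Brilliant_b} \<union> Brilliant_a ` S \<union> Luminous ` S
     \<union> {Dark k a | k a. k \<in> units_of_field \<and> a \<in> R k}"

end

(* The Lie algebra of type D_l is the space of bivectors of the natural module V of dimension 2l, and
   V_1 consists of the bivectors f_1 ^ u + f_2 ^ w with u, w in the quadratic space W of
   dimension 2(l - 2) orthogonal to f_1, f_2 and their duals. G_0 acts on the pair (u, w) by SL_2 on
   the span and by elementary isometries of W. A Witt type reduction shows that the orbit of (u, w)
   is determined by the linear dependence of u and w and by the SL_2-class of their Gram matrix;
   over a field of characteristic not 2 the matrix can be made diagonal, and two diagonal forms of
   the same determinant are equivalent if and only if they represent a common value. The root element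
   attached to (u, w) is a ^ b with a = f_1 - w + ..., b = f_2 + u + ..., and its angle with
   f_1 ^ f_2 is read off from the relative position of the two isotropic planes. *)

theory Submission
  imports Defs
begin

section \<open>The root system\<close>

text \<open>Three points are not automatic. The constants \<open>N\<close> are known only through
  the Jacobi identity and the normalisation of a few of them, so the bivector model is available
  only after every sign has been computed; the signs matter, because the sign at e_tau decides
  between the norm forms x^2 - k y^2 and x^2 + k y^2. Witt's theorem cannot be quoted as such,
  because \<open>G_0\<close> supplies only products of elementary isometries; each reduction uses
  explicit operators, and after the plane of the weights 3, -3 is split off, at least two hyperbolic
  planes must remain in W, which is where \<open>l > 4\<close> enters. Finally, the lift is a
  definite description and the angle an existence statement, so each needs its own uniqueness proof.
  The norm form arises as follows. Let u, w be orthogonal with half norms eta, rho, and put k = -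
  eta rho. The vector y u + (x / rho) w has half norm (x^2 - k y^2) / rho, which equals a exactly
  when x^2 - k y^2 = rho a. If eta = 0, the half norm of the second vector changes only by
  squares.\<close>

text \<open>The weight \<open>\<plusminus>\<epsilon>\<^sub>i\<close> of the natural module is encoded as the integer \<open>\<plusminus>i\<close>, so that
  every root is a sum \<open>rt p q\<close> of two weights.\<close>

definition idx :: "nat \<Rightarrow> nat \<Rightarrow> int set" where
  "idx m l = {p. int m \<le> \<bar>p\<bar> \<and> \<bar>p\<bar> \<le> int l}"

text \<open>For nonzero indices this is the inner product of two weights: the weights of the natural
  module are an orthonormal basis and its negatives.\<close>

definition kd :: "int \<Rightarrow> int \<Rightarrow> int" where
  "kd p q = (if p = q then 1 else if p = - q then -1 else 0)"

definition wt :: "int \<Rightarrow> root" where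
  "wt p = (\<lambda>k. kd (int k) p)"

definition rt :: "int \<Rightarrow> int \<Rightarrow> root" where
  "rt p q = wt p + wt q"

definition valid :: "nat \<Rightarrow> int \<Rightarrow> int \<Rightarrow> bool" where
  "valid l p q \<longleftrightarrow> p \<in> idx 1 l \<and> q \<in> idx 1 l \<and> \<bar>p\<bar> \<noteq> \<bar>q\<bar>"

text \<open>The odd extension of a coordinate vector to signed indices; its value at the index
  \<open>p\<close> of a weight is the pairing with \<open>wt p\<close>.\<close>

definition ev :: "(nat \<Rightarrow> 'a::ab_group_add) \<Rightarrow> int \<Rightarrow> 'a" where
  "ev \<alpha> p = (if p > 0 then \<alpha> (nat p) else - \<alpha> (nat (- p)))"

lemma valid_sym: "valid l p q \<longleftrightarrow> valid l q p"
  by (auto simp: valid_def)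

lemma valid_neg [simp]: "valid l (- p) q \<longleftrightarrow> valid l p q" "valid l p (- q) \<longleftrightarrow> valid l p q"
  by (auto simp: valid_def idx_def)

lemma valid_nz: "valid l p q \<Longrightarrow> p \<noteq> 0 \<and> q \<noteq> 0"
  by (auto simp: valid_def idx_def)

lemma valid_ne: "valid l p q \<Longrightarrow> p \<noteq> 0 \<and> q \<noteq> 0 \<and> p \<noteq> q \<and> p \<noteq> - q \<and> - p \<noteq> q \<and> q \<noteq> p \<and> q \<noteq> - p"
  by (auto simp: valid_def idx_def)

lemma valid_abs: "valid l p q \<Longrightarrow> \<bar>p\<bar> \<noteq> \<bar>q\<bar>"
  by (simp add: valid_def)

lemma finite_idx [simp]: "finite (idx m l)"
  by (rule finite_subset[of _ "{- int l..int l}"]) (auto simp: idx_def)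

lemma rt_sym: "rt p q = rt q p"
  by (simp add: rt_def add.commute)

lemma wt_neg: "p \<noteq> 0 \<Longrightarrow> wt (- p) = - wt p"
  by (auto simp: wt_def kd_def fun_eq_iff)

lemma rt_neg: "valid l p q \<Longrightarrow> - rt p q = rt (- p) (- q)"
  using valid_nz[of l p q] by (auto simp: rt_def wt_neg)

lemma rt_apply: "rt p q k = kd (int k) p + kd (int k) q"
  by (simp add: rt_def wt_def)

lemma kd_neg: "p \<noteq> 0 \<Longrightarrow> kd (- p) q = - kd p q" "p \<noteq> 0 \<Longrightarrow> kd p (- q) = - kd p q"
  by (auto simp: kd_def)

lemma kd_eq_simps: "kd p q = 1 \<longleftrightarrow> q = p" "kd p q = 0 \<longleftrightarrow> \<bar>q\<bar> \<noteq> \<bar>p\<bar>" "kd p q \<le> 1"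
  by (auto simp: kd_def)

text \<open>The weights \<open>i\<close> and \<open>j\<close> are orthogonal and \<open>x\<close> is
  again plus or minus a basis vector, so at most one of the two terms is nonzero.\<close>

lemma kd_sum:
  assumes "valid l i j"
  shows "kd i x + kd j x \<le> 1" "kd i x + kd j x = 1 \<longleftrightarrow> x = i \<or> x = j"
     "kd i x + kd j x = 0 \<longleftrightarrow> \<bar>x\<bar> \<noteq> \<bar>i\<bar> \<and> \<bar>x\<bar> \<noteq> \<bar>j\<bar>"
proof -
  have z: "kd i x = 0 \<or> kd j x = 0" using valid_abs[OF assms] by (simp only: kd_eq_simps) metis
  note nz = valid_nz[OF assms]
  show "kd i x + kd j x \<le> 1" using z kd_eq_simps(3)[of i x] kd_eq_simps(3)[of j x] by linarith
  have "kd i x + kd j x = 1 \<longleftrightarrow> kd i x = 1 \<or> kd j x = 1" using z by force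
  then show "kd i x + kd j x = 1 \<longleftrightarrow> x = i \<or> x = j" using nz by (simp only: kd_eq_simps)
  have "kd i x + kd j x = 0 \<longleftrightarrow> kd i x = 0 \<and> kd j x = 0" using z by force
  then show "kd i x + kd j x = 0 \<longleftrightarrow> \<bar>x\<bar> \<noteq> \<bar>i\<bar> \<and> \<bar>x\<bar> \<noteq> \<bar>j\<bar>" by (simp only: kd_eq_simps)
qed

lemma kd_sym: "kd p q = kd q p"
  by (auto simp: kd_def)

lemma ev_rt: "p \<noteq> 0 \<Longrightarrow> ev (rt i j) p = kd p i + kd p j"
  by (cases "p > 0") (simp_all add: ev_def rt_apply kd_neg)

lemma wt_scaled_eps: "1 \<le> i \<Longrightarrow> s \<in> {1, -1} \<Longrightarrow> wt (s * int i) k = s * eps i k"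
  by (auto simp: wt_def kd_def eps_def)

lemma wt_eps:
  assumes "p \<noteq> 0" shows "wt p k = sgn p * eps (nat \<bar>p\<bar>) k"
proof -
  have "1 \<le> nat \<bar>p\<bar>" "sgn p \<in> {1, -1}" "sgn p * int (nat \<bar>p\<bar>) = p" using assms by (auto simp: sgn_if)
  with wt_scaled_eps[of "nat \<bar>p\<bar>" "sgn p" k] show ?thesis by simp
qed

lemma roots_iff: "\<alpha> \<in> roots l \<longleftrightarrow> (\<exists>p q. valid l p q \<and> \<alpha> = rt p q)"
proof
  assume "\<alpha> \<in> roots l"
  then obtain i j s t where *: "\<alpha> = (\<lambda>k. s * eps i k + t * eps j k)" "1 \<le> i" "i < j" "j \<le> l"
    "s \<in> {1, -1}" "t \<in> {1, -1}"
    unfolding roots_def by blast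
  have "valid l (s * int i) (t * int j)" using * by (auto simp: valid_def idx_def)
  moreover have "\<alpha> = rt (s * int i) (t * int j)"
    using * by (simp add: rt_def plus_fun_def wt_scaled_eps)
  ultimately show "\<exists>p q. valid l p q \<and> \<alpha> = rt p q" by blast
next
  assume "\<exists>p q. valid l p q \<and> \<alpha> = rt p q"
  then obtain p0 q0 where "valid l p0 q0" "\<alpha> = rt p0 q0" by blast
  \<comment> \<open>The definition of \<open>roots\<close> names the smaller coordinate first, so
    the two weights are ordered by absolute value.\<close>
  then obtain p q where v: "valid l p q" and a: "\<alpha> = rt p q" and lt: "\<bar>p\<bar> < \<bar>q\<bar>"
    by (metis linorder_neqE_linordered_idom valid_sym rt_sym valid_def)
  have nz: "p \<noteq> 0" "q \<noteq> 0" using valid_nz[OF v] by auto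
  have "\<alpha> = (\<lambda>k. sgn p * eps (nat \<bar>p\<bar>) k + sgn q * eps (nat \<bar>q\<bar>) k)"
    unfolding a rt_def plus_fun_def using nz by (simp add: wt_eps)
  moreover have "1 \<le> nat \<bar>p\<bar>" "nat \<bar>p\<bar> < nat \<bar>q\<bar>" "nat \<bar>q\<bar> \<le> l" "sgn p \<in> {1,-1}" "sgn q \<in> {1,-1}"
    using v lt nz by (auto simp: valid_def idx_def sgn_if)
  ultimately show "\<alpha> \<in> roots l" unfolding roots_def by blast
qed

lemma rt_roots: "valid l p q \<Longrightarrow> rt p q \<in> roots l"
  by (auto simp: roots_iff)

lemma root_cases:
  assumes "\<alpha> \<in> roots l" obtains p q where "valid l p q" "\<alpha> = rt p q"
  using assms by (auto simp: roots_iff)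

lemma finite_roots [simp]: "finite (roots l)"
proof -
  have "roots l \<subseteq> (\<lambda>(p,q). rt p q) ` (idx 1 l \<times> idx 1 l)"
    by (auto simp: roots_iff valid_def)
  then show ?thesis by (rule finite_subset) auto
qed

lemma root_neg: "\<alpha> \<in> roots l \<Longrightarrow> - \<alpha> \<in> roots l"
  by (metis root_cases rt_neg rt_roots valid_neg)

lemma inner_wt: 
  assumes "p \<in> idx 1 l" shows "inner_prod l \<alpha> (wt p) = ev \<alpha> p"
proof -
  have "inner_prod l \<alpha> (wt p) = (\<Sum>i=1..l. if i = nat \<bar>p\<bar> then ev \<alpha> p else 0)"
    unfolding inner_prod_def
    using assms by (intro sum.cong) (auto simp: wt_def kd_def ev_def idx_def)
  then show ?thesis using assms by (auto simp: idx_def)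
qed

lemma inner_add: "inner_prod l \<alpha> (\<beta> + \<gamma>) = inner_prod l \<alpha> \<beta> + inner_prod l \<alpha> \<gamma>"
  by (simp add: inner_prod_def sum.distrib algebra_simps)

lemma inner_sym: "inner_prod l \<alpha> \<beta> = inner_prod l \<beta> \<alpha>"
  by (simp add: inner_prod_def mult.commute)

lemma inner_diff: "inner_prod l \<alpha> (\<beta> - \<gamma>) = inner_prod l \<alpha> \<beta> - inner_prod l \<alpha> \<gamma>"
  by (simp add: inner_prod_def sum_subtractf algebra_simps)

lemma inner_uminus: "inner_prod l \<alpha> (- \<beta>) = - inner_prod l \<alpha> \<beta>"
  by (simp add: inner_prod_def sum_negf)

lemma inner_rt: "valid l p q \<Longrightarrow> inner_prod l \<alpha> (rt p q) = ev \<alpha> p + ev \<alpha> q"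
  by (simp add: rt_def inner_add inner_wt valid_def)

lemma inner_rt_rt: "valid l p q \<Longrightarrow> 
    inner_prod l (rt i j) (rt p q) = kd p i + kd p j + kd q i + kd q j"
  using valid_nz[of l p q] by (simp add: inner_rt ev_rt)

lemma inner_self: "\<alpha> \<in> roots l \<Longrightarrow> inner_prod l \<alpha> \<alpha> = 2"
  by (erule root_cases) (auto simp: inner_rt_rt kd_def valid_def idx_def)

lemma zero_not_root: "0 \<notin> roots l"
proof
  assume "0 \<in> roots l"
  from inner_self[OF this] show False by (simp add: inner_prod_def)
qed

text \<open>All roots have norm 2, so a difference that is a root forces inner product 1.
  Conversely, inner product 1 means that the roots share one weight, which cancels in the
  difference.\<close>

lemma root_diff_iff:
  assumes "\<gamma> \<in> roots l" "\<alpha> \<in> roots l"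
  shows "\<gamma> - \<alpha> \<in> roots l \<longleftrightarrow> inner_prod l \<gamma> \<alpha> = 1"
proof
  assume "\<gamma> - \<alpha> \<in> roots l"
  from inner_self[OF this] have "inner_prod l \<gamma> \<gamma> + inner_prod l \<alpha> \<alpha> - 2 * inner_prod l \<gamma> \<alpha> = 2"
    by (simp add: inner_diff inner_sym[of l "\<gamma> - \<alpha>"] inner_sym[of l \<alpha> \<gamma>])
  then show "inner_prod l \<gamma> \<alpha> = 1" using assms by (simp add: inner_self)
next
  assume 1: "inner_prod l \<gamma> \<alpha> = 1"
  obtain p q where g: "valid l p q" "\<gamma> = rt p q" using assms by (auto elim: root_cases)
  obtain i j where a: "valid l i j" "\<alpha> = rt i j" using assms by (auto elim: root_cases)
  have diff: "rt x y - rt x z = rt (- z) y" if "z \<noteq> 0" for x y z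
    using that by (simp add: rt_def wt_neg)
  have one: "kd i p + kd i q + kd j p + kd j q = 1"
    using 1 a g by (simp add: inner_rt_rt)
  note K = kd_sum[OF a(1)]
  \<comment> \<open>No weight of \<gamma> contributes more than 1, so the total 1 can only split as
    1 + 0.\<close>
  have "(kd i p + kd j p = 1 \<and> kd i q + kd j q = 0) \<or> (kd i p + kd j p = 0 \<and> kd i q + kd j q = 1)"
    using one K(1)[of p] K(1)[of q] by linarith
  then have "(p = i \<and> \<bar>q\<bar> \<noteq> \<bar>j\<bar>) \<or> (p = j \<and> \<bar>q\<bar> \<noteq> \<bar>i\<bar>) \<or> (q = i \<and> \<bar>p\<bar> \<noteq> \<bar>j\<bar>) \<or> (q = j \<and> \<bar>p\<bar> \<noteq> \<bar>i\<bar>)"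
    unfolding K by blast
  note nz = valid_nz[OF a(1)]
  from \<open>(p = i \<and> _) \<or> _\<close> have "\<exists>x y. valid l x y \<and> \<gamma> - \<alpha> = rt x y"
  proof (elim disjE conjE)

    assume "p = i" "\<bar>q\<bar> \<noteq> \<bar>j\<bar>"
    then show ?thesis using diff[of j i q] nz a g
      by (intro exI[of _ "-j"] exI[of _ q]) (auto simp: valid_def idx_def)
  next
    assume "p = j" "\<bar>q\<bar> \<noteq> \<bar>i\<bar>"
    then show ?thesis using diff[of i j q] nz a g rt_sym[of i j]
      by (intro exI[of _ "-i"] exI[of _ q]) (auto simp: valid_def idx_def)
  next
    assume "q = i" "\<bar>p\<bar> \<noteq> \<bar>j\<bar>"
    then show ?thesis using diff[of j i p] nz a g rt_sym[of p i]
      by (intro exI[of _ "-j"] exI[of _ p]) (auto simp: valid_def idx_def)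
  next
    assume "q = j" "\<bar>p\<bar> \<noteq> \<bar>i\<bar>"
    then show ?thesis using diff[of i j p] nz a g rt_sym[of i j] rt_sym[of p j]
      by (intro exI[of _ "-i"] exI[of _ p]) (auto simp: valid_def idx_def)
  qed
  then show "\<gamma> - \<alpha> \<in> roots l" by (auto simp: roots_iff)
qed

lemma root_add_iff:
  assumes "\<gamma> \<in> roots l" "\<alpha> \<in> roots l"
  shows "\<gamma> + \<alpha> \<in> roots l \<longleftrightarrow> inner_prod l \<gamma> \<alpha> = -1"
  using root_diff_iff[OF assms(1) root_neg[OF assms(2)]] by (simp add: inner_uminus)

text \<open>Equal roots have inner product 2, and this value is reached only if each weight of one
  root is a weight of the other.\<close>

lemma rt_eq_iff:
  assumes "valid l p q" "valid l i j"
  shows "rt p q = rt i j \<longleftrightarrow> (p = i \<and> q = j) \<or> (p = j \<and> q = i)"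
proof
  assume e: "rt p q = rt i j"
  have "inner_prod l (rt i j) (rt p q) = 2" using e inner_self[of "rt i j" l] rt_roots[OF assms(2)] by simp
  then have two: "kd p i + kd p j + kd q i + kd q j = 2" using assms by (simp add: inner_rt_rt)
  note K = kd_sum[OF assms(2), unfolded kd_sym[of i] kd_sym[of j]]
  have "kd p i + kd p j = 1" "kd q i + kd q j = 1"
    using K(1)[of p] K(1)[of q] two by linarith+
  then have "p = i \<or> p = j" "q = i \<or> q = j" unfolding K(2) by simp_all
  then show "(p = i \<and> q = j) \<or> (p = j \<and> q = i)"
    using valid_ne[OF assms(1)] by blast
qed (auto simp: rt_sym)

section \<open>Simple roots in coordinates and the coefficients of a root\<close>

lemma simple_root_rt:
  assumes "i \<in> {1..l}" "l > 4"
  shows "simple_root l i = (if i = 1 then rt (int l - 1) (int l) else rt (int (l + 1 - i)) (- int (l + 2 - i)))"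
    and "simple_root l i \<in> roots l"
proof -
  have eps: "eps i = wt (int i)" if "1 \<le> i" for i
    using wt_scaled_eps[of i 1] that by (auto simp: fun_eq_iff)
  have "eps (l + 1 - i) - eps (l + 2 - i) = rt (int (l + 1 - i)) (- int (l + 2 - i))"
  proof -
    have "1 \<le> l + 1 - i" "1 \<le> l + 2 - i" "int (l + 2 - i) \<noteq> 0" using assms by auto
    then show ?thesis using wt_neg[of "int (l + 2 - i)"]
      by (simp only: eps rt_def diff_conv_add_uminus not_False_eq_True)
  qed
  moreover have "eps (l - 1) + eps l = rt (int l - 1) (int l)"
    using assms by (simp add: eps rt_def of_nat_diff)
  ultimately show e: "simple_root l i = (if i = 1 then rt (int l - 1) (int l) else rt (int (l + 1 - i)) (- int (l + 2 - i)))"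
    by (simp only: simple_root_def split: if_split)
  have "valid l (int l - 1) (int l)" "i \<noteq> 1 \<Longrightarrow> valid l (int (l + 1 - i)) (- int (l + 2 - i))"
    using assms by (auto simp: valid_def idx_def)
  then show "simple_root l i \<in> roots l" unfolding e by (auto intro: rt_roots)
qed

lemma cartan_int_simple:
  assumes "k \<in> {1..l}" "l > 4" "valid l p q"
  shows "cartan_int l (simple_root l k) (rt p q) = ev (simple_root l k) p + ev (simple_root l k) q"
  using assms simple_root_rt(2)[of k l] by (simp add: cartan_int_def inner_self inner_rt)

text \<open>The sum telescopes: apart from the root numbered 1, coordinate \<open>p\<close> meets
  only the simple roots numbered \<open>l + 1 - p\<close> and \<open>l + 2 - p\<close>. The ring is
  general because the formula serves both for integral coefficients and for Cartan coordinates in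
  the field.\<close>

lemma simple_comb:
  fixes c :: "nat \<Rightarrow> 'a::comm_ring_1"
  assumes "l > 4"
  shows "(\<Sum>k=1..l. c k * of_int (simple_root l k p)) =
    (if p = 1 then c l else if 2 \<le> p \<and> p \<le> l - 2 then c (l + 1 - p) - c (l + 2 - p)
     else if p = l - 1 then c 1 + c 2 - c 3 else if p = l then c 1 - c 2 else 0)"
proof -
  have "(\<Sum>k=1..l. c k * of_int (simple_root l k p)) =
     c 1 * of_int (simple_root l 1 p) + (\<Sum>k=2..l. c k * of_int (simple_root l k p))"
    using assms by (simp add: sum.atLeast_Suc_atMost numeral_2_eq_2)
  also have "(\<Sum>k=2..l. c k * of_int (simple_root l k p)) =
     (\<Sum>k=2..l. (if k = l + 1 - p then (if p \<in> {1..<l} then c k else 0) else 0)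
             - (if k = l + 2 - p then (if p \<in> {2..l} then c k else 0) else 0))"
  proof (rule sum.cong[OF refl])
    fix k assume k: "k \<in> {2..l}"
    have 1: "p = l + 1 - k \<longleftrightarrow> k = l + 1 - p \<and> p \<in> {1..<l}" using k by auto
    have 2: "p = l + 2 - k \<longleftrightarrow> k = l + 2 - p \<and> p \<in> {2..l}" using k by auto
    have "simple_root l k p = (if p = l + 1 - k then 1 else 0) - (if p = l + 2 - k then 1 else 0)"
      using k by (simp add: simple_root_def eps_def)
    then show "c k * of_int (simple_root l k p) =
        (if k = l + 1 - p then (if p \<in> {1..<l} then c k else 0) else 0)
             - (if k = l + 2 - p then (if p \<in> {2..l} then c k else 0) else 0)"
      unfolding 1 2 by simp
  qed
  also have "\<dots> = (if p \<in> {1..<l} then c (l + 1 - p) else 0) - (if p \<in> {2..l} then c (l + 2 - p) else 0)"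
    unfolding sum_subtractf sum.delta[OF finite_atLeastAtMost] using assms by auto
  also have "c 1 * of_int (simple_root l 1 p) = (if p = l - 1 \<or> p = l then c 1 else 0)"
    using assms by (auto simp: simple_root_def eps_def)
  finally have *: "(\<Sum>k=1..l. c k * of_int (simple_root l k p)) =
    (if p = l - 1 \<or> p = l then c 1 else 0) + ((if p \<in> {1..<l} then c (l + 1 - p) else 0) - (if p \<in> {2..l} then c (l + 2 - p) else 0))" .
  consider "p = 0" | "p = 1" | "2 \<le> p" "p \<le> l - 2" | "p = l - 1" | "p = l" | "p > l" by linarith
  then show ?thesis
  proof cases
    case 3
    then have "p \<noteq> l - 1" "p \<noteq> l" "p \<in> {1..<l}" "p \<in> {2..l}" "p \<noteq> 1" using assms by auto
    then show ?thesis unfolding * using 3 by simp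
  next
    case 4
    then have f: "p \<in> {1..<l}" "p \<in> {2..l}" "p \<noteq> 1" "\<not> p \<le> l - 2" "l + 1 - p = 2" "l + 2 - p = 3"
      using assms by auto
    show ?thesis unfolding * by (simp only: f eqTrueI[OF 4] if_True if_False simp_thms add_diff_eq)
  next
    case 5
    then have f: "p \<notin> {1..<l}" "p \<in> {2..l}" "p \<noteq> 1" "\<not> p \<le> l - 2" "p \<noteq> l - 1" "l + 2 - p = 2"
      using assms by auto
    show ?thesis unfolding * by (simp only: f eqTrueI[OF 5] if_True if_False simp_thms) simp
  next
    case 1
    then have "p \<notin> {1..<l}" "p \<notin> {2..l}" "p \<noteq> 1" "\<not> 2 \<le> p" "p \<noteq> l - 1" "p \<noteq> l" using assms by auto
    then show ?thesis unfolding * by simp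
  next
    case 2
    then have "p \<in> {1..<l}" "p \<notin> {2..l}" "p \<noteq> l - 1" "p \<noteq> l" using assms by auto
    then show ?thesis unfolding * using 2 by simp
  next
    case 6
    then have "p \<notin> {1..<l}" "p \<notin> {2..l}" "p \<noteq> 1" "\<not> p \<le> l - 2" "p \<noteq> l - 1" "p \<noteq> l" using assms by auto
    then show ?thesis unfolding * by simp
  qed
qed

lemma root_comb_apply:
  assumes "l > 4"
  shows "root_comb l m p = 
    (if p = 1 then m l else if 2 \<le> p \<and> p \<le> l - 2 then m (l + 1 - p) - m (l + 2 - p)
     else if p = l - 1 then m 1 + m 2 - m 3 else if p = l then m 1 - m 2 else 0)"
  using simple_comb[OF assms, of m p] by (simp add: root_comb_def)

text \<open>Back substitution from coordinate 1 kills all coefficients from 3 on. The fork leaves c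
  1 + c 2 = 0 and c 1 - c 2 = 0, and this is where 2 must not vanish.\<close>

lemma comb_zero:
  fixes c :: "nat \<Rightarrow> 'a::idom"
  assumes l: "l > 4" and two: "(2::'a) \<noteq> 0"
    and z: "\<And>p. p \<in> {1..l} \<Longrightarrow> (\<Sum>k=1..l. c k * of_int (simple_root l k p)) = 0"
  shows "k \<in> {1..l} \<Longrightarrow> c k = 0"
proof -
  note z' = z[unfolded simple_comb[OF l]]
  have *: "p \<in> {1..l-2} \<Longrightarrow> c (l + 1 - p) = 0" for p
  proof (induction p)
    case (Suc p)
    show ?case
    proof (cases "p = 0")
      case True then show ?thesis using z'[of 1] l by simp
    next
      case False
      have "c (l + 1 - Suc p) - c (l + 2 - Suc p) = 0" using z'[of "Suc p"] Suc.prems l False by (auto split: if_splits)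
      moreover have "c (l + 2 - Suc p) = 0" using Suc False by simp
      ultimately show ?thesis by simp
    qed
  qed simp
  have ge3: "c k = 0" if "k \<in> {3..l}" for k
  proof -
    have "l + 1 - (l + 1 - k) = k" "l + 1 - k \<in> {1..l-2}" using that by auto
    then show ?thesis using *[of "l + 1 - k"] by simp
  qed
  have "l - 1 \<in> {1..l}" "l \<in> {1..l}" using l by auto
  moreover have "l - 1 \<noteq> 1" "\<not> l - 1 \<le> l - 2" "l \<noteq> 1" "\<not> l \<le> l - 2" "l \<noteq> l - 1" "c 3 = 0"
    using l ge3[of 3] by auto
  ultimately have "c 1 + c 2 = 0" "c 1 = c 2" using z'[of "l - 1"] z'[of l] by simp_all
  then have "2 * c 1 = 0" by simp
  then have "c 1 = 0" using two by auto
  moreover from this have "c 2 = 0" using \<open>c 1 = c 2\<close> by simp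
  ultimately show "k \<in> {1..l} \<Longrightarrow> c k = 0" using ge3[of k] by (cases "k = 1"; cases "k = 2") auto
qed

text \<open>The pairings with the fundamental coweights: partial coordinate sums along the chain,
  half of the full sum at the end nodes of the fork. The division by 2 is exact because the
  coordinate sum of a root is even.\<close>

definition solve_coeffs :: "nat \<Rightarrow> root \<Rightarrow> nat \<Rightarrow> int" where
  "solve_coeffs l \<alpha> k = (if k = 1 then (\<Sum>i=1..l. \<alpha> i) div 2
     else if k = 2 then (\<Sum>i=1..l. \<alpha> i) div 2 - \<alpha> l
     else if k \<in> {3..l} then (\<Sum>i=1..l + 1 - k. \<alpha> i) else 0)"

lemma sum_rt:
  assumes "valid l p q"
  shows "(\<Sum>i=1..n. rt p q i) = (if \<bar>p\<bar> \<le> int n then sgn p else 0) + (if \<bar>q\<bar> \<le> int n then sgn q else 0)"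
proof -
  have *: "(\<Sum>i=1..n. kd (int i) p) = (if \<bar>p\<bar> \<le> int n then sgn p else 0)" if "p \<in> idx 1 l" for p
  proof -
    have "(\<Sum>i=1..n. kd (int i) p) = (\<Sum>i=1..n. if i = nat \<bar>p\<bar> then sgn p else 0)"
      using that by (intro sum.cong) (auto simp: kd_def idx_def)
    then show ?thesis using that by (auto simp: idx_def)
  qed
  show ?thesis using assms *[of p] *[of q] by (simp add: rt_apply sum.distrib valid_def)
qed

lemma root_coeffs_spec:
  assumes l: "l > 4" and a: "\<alpha> \<in> roots l"
  shows "root_comb l (root_coeffs l \<alpha>) = \<alpha>" and "root_coeffs l \<alpha> = solve_coeffs l \<alpha>"
proof -
  obtain x y where v: "valid l x y" and axy: "\<alpha> = rt x y" using a by (rule root_cases)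
  have even: "even (\<Sum>i=1..l. \<alpha> i)"
    using v unfolding axy sum_rt[OF v] by (auto simp: valid_def idx_def sgn_if)
  have S: "(\<Sum>i=1..Suc n. \<alpha> i) = (\<Sum>i=1..n. \<alpha> i) + \<alpha> (Suc n)" for n by simp
  have comb: "root_comb l (solve_coeffs l \<alpha>) = \<alpha>"
  proof
    fix p
    consider "p = 0" | "p = 1" | "2 \<le> p" "p \<le> l - 2" | "p = l - 1" | "p = l" | "p > l" by linarith
    then show "root_comb l (solve_coeffs l \<alpha>) p = \<alpha> p"
    proof cases
      case 3
      then obtain n where n: "p = Suc n" "n \<ge> 1" by (cases p) auto
      have "l + 1 - (l + 1 - p) = p" "l + 1 - (l + 2 - p) = n" using 3 n by auto
      moreover have "l + 1 - p \<in> {3..l}" "l + 2 - p \<in> {3..l}" "p \<noteq> 1" using 3 n l by auto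
      ultimately have "solve_coeffs l \<alpha> (l + 1 - p) = (\<Sum>i=1..p. \<alpha> i)" "solve_coeffs l \<alpha> (l + 2 - p) = (\<Sum>i=1..n. \<alpha> i)"
        unfolding solve_coeffs_def by auto
      moreover have "root_comb l (solve_coeffs l \<alpha>) p = solve_coeffs l \<alpha> (l + 1 - p) - solve_coeffs l \<alpha> (l + 2 - p)"
        using 3 \<open>p \<noteq> 1\<close> by (simp only: root_comb_apply[OF l] if_False if_True simp_thms)
      ultimately have "root_comb l (solve_coeffs l \<alpha>) p = (\<Sum>i=1..p. \<alpha> i) - (\<Sum>i=1..n. \<alpha> i)" by (simp only:)
      also have "\<dots> = \<alpha> p" unfolding n(1) S by (rule add_diff_cancel_left')
      finally show ?thesis .
    next
      case 4
      have "(\<Sum>i=1..l. \<alpha> i) = (\<Sum>i=1..l - 2. \<alpha> i) + \<alpha> (l - 1) + \<alpha> l"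
      proof -
        have "Suc (l - 2) = l - 1" "Suc (l - 1) = l" using l by auto
        with S[of "l - 2"] S[of "l - 1"] show ?thesis by (simp only:)
      qed
      then show ?thesis using 4 l even by (auto simp add: root_comb_apply solve_coeffs_def)
    next
      case 6
      then have "p \<noteq> 1" "\<not> p \<le> l - 2" "p \<noteq> l - 1" "p \<noteq> l" using l by auto
      then have "root_comb l (solve_coeffs l \<alpha>) p = 0"
        by (simp only: root_comb_apply[OF l] if_False simp_thms)
      moreover have "kd (int p) x = 0" "kd (int p) y = 0" unfolding kd_eq_simps
        using 6 v unfolding valid_def idx_def by auto
      ultimately show ?thesis unfolding axy rt_apply by simp
    next
      case 1
      then have "p \<noteq> 1" "\<not> 2 \<le> p" "p \<noteq> l - 1" "p \<noteq> l" using l by auto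
      then have "root_comb l (solve_coeffs l \<alpha>) p = 0"
        by (simp only: root_comb_apply[OF l] if_False simp_thms)
      moreover have "kd (int p) x = 0" "kd (int p) y = 0" unfolding kd_eq_simps
        using 1 v unfolding valid_def idx_def by auto
      ultimately show ?thesis unfolding axy rt_apply by simp
    qed (use l in \<open>auto simp: root_comb_apply solve_coeffs_def\<close>)
  qed
  have uniq: "m = solve_coeffs l \<alpha>" if m: "\<forall>i. i \<notin> {1..l} \<longrightarrow> m i = 0" "root_comb l m = \<alpha>" for m
  proof
    fix k
    \<comment> \<open>Two solutions differ by a linear relation between the simple roots, and these
      are independent.\<close>
    have "k \<in> {1..l} \<Longrightarrow> m k - solve_coeffs l \<alpha> k = 0"
    proof (rule comb_zero[OF l, where c = "\<lambda>k. m k - solve_coeffs l \<alpha> k"])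
      fix p assume "p \<in> {1..l}"
      have "root_comb l m p - root_comb l (solve_coeffs l \<alpha>) p = 0" using m comb by simp
      then show "(\<Sum>k=1..l. (m k - solve_coeffs l \<alpha> k) * of_int (simple_root l k p)) = 0"
        by (simp add: root_comb_def sum_subtractf left_diff_distrib)
    qed auto
    then show "m k = solve_coeffs l \<alpha> k" using m l by (cases "k \<in> {1..l}") (auto simp: solve_coeffs_def)
  qed
  have "root_coeffs l \<alpha> = solve_coeffs l \<alpha>"
    unfolding root_coeffs_def
  proof (rule the_equality)
    show "(\<forall>i. i \<notin> {1..l} \<longrightarrow> solve_coeffs l \<alpha> i = 0) \<and> root_comb l (solve_coeffs l \<alpha>) = \<alpha>"
      using comb l by (auto simp: solve_coeffs_def)
  qed (use uniq in auto)
  then show "root_coeffs l \<alpha> = solve_coeffs l \<alpha>" "root_comb l (root_coeffs l \<alpha>) = \<alpha>"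
    using comb by auto
qed

text \<open>The first nonzero coordinate is 1, so no partial sum is negative; at the second end node
  the last coordinate is subtracted, which is harmless because it can be 1 only if the half sum is
  1.\<close>

lemma pos_rt:
  assumes "l > 4" "valid l p q" "0 < p" "p < \<bar>q\<bar>"
  shows "rt p q \<in> pos_roots l"
proof -
  have S0: "(\<Sum>i=1..n. rt p q i) \<ge> 0" for n
    unfolding sum_rt[OF assms(2)] using assms by (auto simp: sgn_if)
  have Sl: "(\<Sum>i=1..l. rt p q i) = 1 + sgn q"
    unfolding sum_rt[OF assms(2)] using assms by (auto simp: valid_def idx_def)
  have "rt p q l \<le> 1 \<and> (q < 0 \<longrightarrow> rt p q l \<le> 0)"
    using assms by (auto simp: rt_apply kd_def valid_def idx_def)
  then have "(1 + sgn q) div 2 - rt p q l \<ge> 0" "(1 + sgn q) div 2 \<ge> 0"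
    using assms by (auto simp: sgn_if)
  then have "solve_coeffs l (rt p q) k \<ge> 0" for k
    using S0 unfolding solve_coeffs_def Sl by auto
  then show ?thesis
    using root_coeffs_spec(2)[OF assms(1) rt_roots[OF assms(2)]] rt_roots[OF assms(2)]
    by (simp add: pos_roots_def)
qed

section \<open>The bracket in coordinates\<close>

lemma sum_fun_apply: "(\<Sum>b\<in>A. f b) c = (\<Sum>b\<in>A. f b c)" for f :: "'b \<Rightarrow> 'c \<Rightarrow> 'd::comm_monoid_add"
  by (induction A rule: infinite_finite_induct) (auto simp: plus_fun_def)

lemma finite_basis_indices [simp]: "finite (basis_indices l)"
  by (simp add: basis_indices_def)

lemma sum_basis_indices:
  "(\<Sum>b\<in>basis_indices l. f b) = (\<Sum>\<beta>\<in>roots l. f (Root \<beta>)) + (\<Sum>k=1..l. f (Cartan k))"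
  unfolding basis_indices_def
  by (subst sum.union_disjoint) (auto simp: sum.reindex inj_on_def)

lemma bracket_apply:
  "bracket l N x y c = (\<Sum>b\<in>basis_indices l. \<Sum>d\<in>basis_indices l. x b * y d * basis_bracket l N b d c)"
  by (simp add: bracket_def sum_fun_apply smult_vec_def)

lemma bracket_add_left: "bracket l N (x + x') y = bracket l N x y + bracket l N x' y"
  by (rule ext) (simp add: bracket_apply sum.distrib algebra_simps)

lemma bracket_add_right: "bracket l N x (y + y') = bracket l N x y + bracket l N x y'"
  by (rule ext) (simp add: bracket_apply sum.distrib algebra_simps)

lemma bracket_smult_right: "bracket l N x (c *\<^sub>v y) = c *\<^sub>v bracket l N x y"
  by (rule ext) (simp add: bracket_apply smult_vec_def sum_distrib_left mult_ac)

lemma bracket_zero_right: "bracket l N x 0 = 0"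
  by (rule ext) (simp add: bracket_apply)

lemma bracket_basis_left:
  assumes "b \<in> basis_indices l"
  shows "bracket l N (basis_vec b) y c = (\<Sum>d\<in>basis_indices l. y d * basis_bracket l N b d c)"
proof -
  have "bracket l N (basis_vec b) y c =
     (\<Sum>b'\<in>basis_indices l. if b' = b then (\<Sum>d\<in>basis_indices l. y d * basis_bracket l N b d c) else 0)"
    unfolding bracket_apply by (intro sum.cong) (auto simp: basis_vec_def)
  then show ?thesis using assms by simp
qed

lemma root_index: "\<alpha> \<in> roots l \<Longrightarrow> Root \<alpha> \<in> basis_indices l"
  by (simp add: basis_indices_def)

lemma bracket_Root:
  fixes y :: "'a::comm_ring_1 vec"
  assumes a: "\<alpha> \<in> roots l" and g: "\<gamma> \<in> roots l"
  shows "bracket l N (root_vec \<alpha>) y (Root \<gamma>) =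
    (if \<gamma> - \<alpha> \<in> roots l then of_int (N \<alpha> (\<gamma> - \<alpha>)) * y (Root (\<gamma> - \<alpha>)) else 0)
    - (if \<gamma> = \<alpha> then \<Sum>k=1..l. of_int (cartan_int l (simple_root l k) \<alpha>) * y (Cartan k) else 0)"
proof -
  have 1: "y (Root \<beta>) * basis_bracket l N (Root \<alpha>) (Root \<beta>) (Root \<gamma>) =
     (if \<beta> = \<gamma> - \<alpha> then of_int (N \<alpha> (\<gamma> - \<alpha>)) * y (Root (\<gamma> - \<alpha>)) else 0)" for \<beta>
  proof (cases "\<beta> = \<gamma> - \<alpha>")
    case True
    then have "\<alpha> + \<beta> = \<gamma>" by simp
    moreover have "\<beta> \<noteq> - \<alpha>" using True g zero_not_root[of l] by auto
    ultimately show ?thesis using True g by (simp add: smult_vec_def basis_vec_def)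
  next
    case False
    then have "\<gamma> \<noteq> \<alpha> + \<beta>" by auto
    then show ?thesis using False by (auto simp: smult_vec_def basis_vec_def h_vec_def sum_fun_apply)
  qed
  have 2: "(\<Sum>k=1..l. y (Cartan k) * basis_bracket l N (Root \<alpha>) (Cartan k) (Root \<gamma>))
    = - (if \<gamma> = \<alpha> then \<Sum>k=1..l. of_int (cartan_int l (simple_root l k) \<alpha>) * y (Cartan k) else 0)"
    by (auto simp: smult_vec_def basis_vec_def sum_negf mult.commute)
  show ?thesis
    unfolding bracket_basis_left[OF root_index[OF a]] sum_basis_indices 1 2
    by simp
qed

lemma bracket_not_root:
  assumes a: "\<alpha> \<in> roots l" and g: "\<gamma> \<notin> roots l"
  shows "bracket l N (root_vec \<alpha>) y (Root \<gamma>) = 0"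
proof -
  have 1: "basis_bracket l N (Root \<alpha>) (Root \<beta>) (Root \<gamma>) = 0" for \<beta>
    using g by (auto simp: smult_vec_def basis_vec_def h_vec_def sum_fun_apply)
  have 2: "basis_bracket l N (Root \<alpha>) (Cartan k) (Root \<gamma>) = 0" for k
    using g a by (auto simp: smult_vec_def basis_vec_def)
  show ?thesis
    unfolding bracket_basis_left[OF root_index[OF a]] sum_basis_indices 1 2 by simp
qed

lemma h_vec_Cartan:
  "h_vec l \<alpha> (Cartan k) = (if k \<in> {1..l} then of_int (root_coeffs l \<alpha> k) else 0)"
proof -
  have "h_vec l \<alpha> (Cartan k) = (\<Sum>i=1..l. if i = k then of_int (root_coeffs l \<alpha> k) else 0)"
    unfolding h_vec_def sum_fun_apply by (intro sum.cong) (auto simp: smult_vec_def basis_vec_def)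
  then show ?thesis by simp
qed

lemma bracket_Cartan:
  assumes a: "\<alpha> \<in> roots l"
  shows "bracket l N (root_vec \<alpha>) y (Cartan k) =
     (if k \<in> {1..l} then of_int (root_coeffs l \<alpha> k) * y (Root (- \<alpha>)) else 0)"
proof -
  have 1: "y (Root \<beta>) * basis_bracket l N (Root \<alpha>) (Root \<beta>) (Cartan k) =
     (if \<beta> = - \<alpha> then y (Root (- \<alpha>)) * h_vec l \<alpha> (Cartan k) else 0)" for \<beta>
    by (auto simp: smult_vec_def basis_vec_def)
  have 2: "basis_bracket l N (Root \<alpha>) (Cartan j) (Cartan k) = 0" for j
    by (auto simp: smult_vec_def basis_vec_def)
  show ?thesis
    unfolding bracket_basis_left[OF root_index[OF a]] sum_basis_indices 1 2
    using root_neg[OF a] by (simp add: h_vec_Cartan)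
qed

lemma bracket_root_root:
  assumes a: "\<alpha> \<in> roots l" and b: "\<beta> \<in> roots l"
  shows "bracket l N (root_vec \<alpha>) (root_vec \<beta>) = basis_bracket l N (Root \<alpha>) (Root \<beta>)"
proof
  fix c
  have "bracket l N (root_vec \<alpha>) (root_vec \<beta>) c =
     (\<Sum>d\<in>basis_indices l. if d = Root \<beta> then basis_bracket l N (Root \<alpha>) (Root \<beta>) c else 0)"
    unfolding bracket_basis_left[OF root_index[OF a]]
    by (intro sum.cong) (auto simp: basis_vec_def)
  then show "bracket l N (root_vec \<alpha>) (root_vec \<beta>) c = basis_bracket l N (Root \<alpha>) (Root \<beta>) c"
    using root_index[OF b] by simp
qed

text \<open>The eigenvalue of the Cartan part of \<open>y\<close> on the vector of weight
  \<open>p\<close> in the natural module; since all roots have norm 2, coroots pair with weights as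
  roots do.\<close>

definition Hc :: "nat \<Rightarrow> 'a::comm_ring_1 vec \<Rightarrow> int \<Rightarrow> 'a" where
  "Hc l y p = (\<Sum>k=1..l. y (Cartan k) * of_int (ev (simple_root l k) p))"

lemma Hc_neg: "p \<noteq> 0 \<Longrightarrow> Hc l y (- p) = - Hc l y p"
  by (cases "p > 0") (auto simp: Hc_def ev_def sum_negf)

lemma cartan_sum:
  assumes "l > 4" "valid l i j"
  shows "(\<Sum>k=1..l. of_int (cartan_int l (simple_root l k) (rt i j)) * y (Cartan k)) = Hc l y i + Hc l y j"
  unfolding Hc_def sum.distrib[symmetric] 
  by (intro sum.cong) (auto simp: cartan_int_simple[OF _ assms] algebra_simps)

lemma coeffs_sum:
  assumes l: "l > 4" and a: "\<alpha> \<in> roots l" 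
  shows "(\<Sum>k=1..l. root_coeffs l \<alpha> k * ev (simple_root l k) p) = ev \<alpha> p"
proof -
  have *: "(\<Sum>k=1..l. root_coeffs l \<alpha> k * simple_root l k q) = \<alpha> q" for q
    using root_coeffs_spec(1)[OF assms] by (simp add: root_comb_def fun_eq_iff)
  show ?thesis
  proof (cases "p > 0")
    case True then show ?thesis using *[of "nat p"] by (simp add: ev_def)
  next
    case False then show ?thesis using *[of "nat (- p)"] by (simp add: ev_def sum_negf)
  qed
qed

text \<open>The Cartan part of \<open>y\<close> is c h_alpha here, and h_alpha acts on the weight
  \<open>p\<close> through the pairing of \<alpha> with \<open>p\<close>.\<close>

lemma Hc_Cartan_part:
  assumes l: "l > 4" and a: "\<alpha> \<in> roots l" 
    and y: "\<And>k. k \<in> {1..l} \<Longrightarrow> y (Cartan k) = of_int (root_coeffs l \<alpha> k) * c"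
  shows "Hc l y p = of_int (ev \<alpha> p) * c"
proof -
  have "Hc l y p = (\<Sum>k=1..l. of_int (root_coeffs l \<alpha> k * ev (simple_root l k) p) * c)"
    unfolding Hc_def by (intro sum.cong) (auto simp: y mult_ac)
  also have "\<dots> = of_int (\<Sum>k=1..l. root_coeffs l \<alpha> k * ev (simple_root l k) p) * c"
    by (simp only: of_int_sum sum_distrib_right)
  finally show ?thesis by (simp only: coeffs_sum[OF l a])
qed

lemma rv_space: "\<alpha> \<in> roots l \<Longrightarrow> root_vec \<alpha> \<in> lie_space l"
  by (auto simp: lie_space_def basis_vec_def basis_indices_def)

lemma add_space: "x \<in> lie_space l \<Longrightarrow> y \<in> lie_space l \<Longrightarrow> x + y \<in> lie_space l"
  by (auto simp: lie_space_def)

lemma bracket_sum: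
  fixes N :: "root \<Rightarrow> root \<Rightarrow> int"
  assumes "\<alpha> \<in> roots l" "\<beta> \<in> roots l" "\<alpha> + \<beta> \<in> roots l"
  shows "bracket l N (root_vec \<alpha>) (root_vec \<beta>) = of_int (N \<alpha> \<beta>) *\<^sub>v root_vec (\<alpha> + \<beta>)"
proof -
  have "\<beta> \<noteq> - \<alpha>" using assms zero_not_root[of l] by auto
  then show ?thesis using assms by (simp add: bracket_root_root)
qed

lemma bracket_no_sum:
  assumes "\<alpha> \<in> roots l" "\<beta> \<in> roots l" "\<alpha> + \<beta> \<notin> roots l" "\<beta> \<noteq> - \<alpha>"
  shows "bracket l N (root_vec \<alpha>) (root_vec \<beta>) = 0"
  using assms by (simp add: bracket_root_root)

section \<open>Identities for the structure constants from the Jacobi identity\<close>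

context
  fixes l :: nat and N :: "root \<Rightarrow> root \<Rightarrow> int"
  assumes l: "l > 4" and chev: "chevalley_constants l N"
begin

lemma jacobi:
  fixes x :: "int vec"
  shows "x \<in> lie_space l \<Longrightarrow> y \<in> lie_space l \<Longrightarrow> z \<in> lie_space l \<Longrightarrow>
    bracket l N x (bracket l N y z) + bracket l N y (bracket l N z x)
          + bracket l N z (bracket l N x y) = 0"
  using chev by (auto simp: chevalley_constants_def)

lemma N_pm: "\<alpha> \<in> roots l \<Longrightarrow> \<beta> \<in> roots l \<Longrightarrow> \<alpha> + \<beta> \<in> roots l \<Longrightarrow> N \<alpha> \<beta> * N \<alpha> \<beta> = 1"
  using chev unfolding chevalley_constants_def by (metis insertE mult_1 mult_minus_left mult_minus_right singletonD minus_minus)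

lemma bracket_antisym:
  fixes x :: "int vec"
  assumes "x \<in> lie_space l" "y \<in> lie_space l"
  shows "bracket l N x y + bracket l N y x = 0"
proof -
  have sq: "bracket l N z z = 0" if "z \<in> lie_space l" for z :: "int vec"
    using chev that by (auto simp: chevalley_constants_def)
  have "bracket l N (x + y) (x + y) = 0" by (intro sq add_space assms)
  then show ?thesis by (simp add: bracket_add_left bracket_add_right sq assms add.commute)
qed

lemma N_antisym:
  assumes "\<alpha> \<in> roots l" "\<beta> \<in> roots l" "\<alpha> + \<beta> \<in> roots l"
  shows "N \<beta> \<alpha> = - N \<alpha> \<beta>"
proof -
  have "bracket l N (root_vec \<alpha>) (root_vec \<beta>) + bracket l N (root_vec \<beta>) (root_vec \<alpha>) = (0 :: int vec)"
    by (intro bracket_antisym rv_space assms)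
  then have "(of_int (N \<alpha> \<beta>) *\<^sub>v root_vec (\<alpha> + \<beta>) + of_int (N \<beta> \<alpha>) *\<^sub>v root_vec (\<alpha> + \<beta>)) (Root (\<alpha> + \<beta>)) = (0 :: int)"
    using assms by (simp add: bracket_sum add.commute[of \<beta> \<alpha>])
  then show ?thesis by (simp add: smult_vec_def basis_vec_def)
qed

text \<open>The Jacobi identity for three root vectors; since \<alpha> + \<gamma> is neither a root
  nor zero, the bracket of the outer two vanishes and only two terms survive.\<close>

lemma N_assoc:
  assumes r: "\<alpha> \<in> roots l" "\<beta> \<in> roots l" "\<gamma> \<in> roots l"
    "\<alpha> + \<beta> \<in> roots l" "\<beta> + \<gamma> \<in> roots l" "\<alpha> + \<beta> + \<gamma> \<in> roots l" 
    and n: "\<alpha> + \<gamma> \<notin> roots l" "\<alpha> + \<gamma> \<noteq> 0"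
  shows "N \<beta> \<gamma> * N \<alpha> (\<beta> + \<gamma>) = N \<alpha> \<beta> * N (\<alpha> + \<beta>) \<gamma>"
proof -
  have "\<gamma> \<noteq> - \<alpha>" "\<alpha> \<noteq> - \<gamma>" using n by auto
  then have z: "bracket l N (root_vec \<gamma>) (root_vec \<alpha>) = (0 :: int vec)"
    using n r by (intro bracket_no_sum) (auto simp: add.commute)
  have e: "\<gamma> + (\<alpha> + \<beta>) = \<alpha> + \<beta> + \<gamma>" "\<alpha> + (\<beta> + \<gamma>) = \<alpha> + \<beta> + \<gamma>" by (simp_all add: ac_simps)
  have "bracket l N (root_vec \<alpha>) (bracket l N (root_vec \<beta>) (root_vec \<gamma>)) +
     bracket l N (root_vec \<beta>) (bracket l N (root_vec \<gamma>) (root_vec \<alpha>)) +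
     bracket l N (root_vec \<gamma>) (bracket l N (root_vec \<alpha>) (root_vec \<beta>)) = (0 :: int vec)"
    by (intro jacobi rv_space r)
  then have "(of_int (N \<beta> \<gamma>) *\<^sub>v of_int (N \<alpha> (\<beta> + \<gamma>)) *\<^sub>v root_vec (\<alpha> + \<beta> + \<gamma>) 
    + of_int (N \<alpha> \<beta>) *\<^sub>v of_int (N \<gamma> (\<alpha> + \<beta>)) *\<^sub>v root_vec (\<alpha> + \<beta> + \<gamma>)) (Root (\<alpha> + \<beta> + \<gamma>)) = (0 :: int)"
    using r by (simp only: z bracket_zero_right bracket_sum bracket_smult_right e) simp
  then have "N \<beta> \<gamma> * N \<alpha> (\<beta> + \<gamma>) + N \<alpha> \<beta> * N \<gamma> (\<alpha> + \<beta>) = 0"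
    by (simp add: smult_vec_def basis_vec_def)
  moreover have "N \<gamma> (\<alpha> + \<beta>) = - N (\<alpha> + \<beta>) \<gamma>"
    using r by (intro N_antisym) auto
  ultimately show ?thesis by simp
qed

text \<open>The Jacobi identity for the root vectors of - \<alpha>, \<alpha>, \<beta>, read at
  e_beta. The middle term vanishes because \<beta> - \<alpha> is not a root, and the Cartan term
  contributes -1, so the product of the two constants is 1.\<close>

lemma N_neg:
  assumes r: "\<alpha> \<in> roots l" "\<beta> \<in> roots l" "\<alpha> + \<beta> \<in> roots l"
  shows "N (- \<alpha>) (\<alpha> + \<beta>) = N \<alpha> \<beta>"
proof -
  have na: "- \<alpha> \<in> roots l" using r root_neg by blast
  have inn: "inner_prod l \<alpha> \<beta> = -1" using r root_add_iff by blast
  have ne: "- \<alpha> \<noteq> - \<beta>" using inn inner_self[OF r(1)] by auto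
  have nr: "\<beta> + - \<alpha> \<notin> roots l"
    using root_add_iff[OF r(2) na] inn by (simp add: inner_uminus inner_sym[of l \<beta>])
  have z: "bracket l N (root_vec \<beta>) (root_vec (- \<alpha>)) = (0 :: int vec)"
    using nr r na ne by (intro bracket_no_sum) auto
  have hh: "bracket l N (root_vec (- \<alpha>)) (root_vec \<alpha>) = (h_vec l (- \<alpha>) :: int vec)"
    using bracket_root_root[OF na r(1), of N] by simp
  have e: "- \<alpha> + (\<alpha> + \<beta>) = \<beta>" by simp
  obtain i j where b: "valid l i j" "\<beta> = rt i j" using r(2) by (rule root_cases)
  have "Hc l (h_vec l (- \<alpha>)) p = of_int (ev (- \<alpha>) p) * (1::int)" for p
    by (intro Hc_Cartan_part l na) (simp add: h_vec_Cartan)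
  then have "(\<Sum>k=1..l. of_int (cartan_int l (simple_root l k) \<beta>) * h_vec l (- \<alpha>) (Cartan k)) = inner_prod l (- \<alpha>) \<beta>"
    unfolding b cartan_sum[OF l b(1)] by (simp add: inner_rt[OF b(1)])
  also have "\<dots> = 1" using inn inner_uminus[of l \<beta> \<alpha>] by (simp add: inner_sym)
  finally have c: "bracket l N (root_vec \<beta>) (h_vec l (- \<alpha>)) (Root \<beta>) = - (1 :: int)"
    by (simp add: bracket_Root[OF r(2) r(2)] zero_not_root)
  have "bracket l N (root_vec (- \<alpha>)) (bracket l N (root_vec \<alpha>) (root_vec \<beta>)) +
     bracket l N (root_vec \<alpha>) (bracket l N (root_vec \<beta>) (root_vec (- \<alpha>))) +
     bracket l N (root_vec \<beta>) (bracket l N (root_vec (- \<alpha>)) (root_vec \<alpha>)) = (0 :: int vec)"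
    by (intro jacobi rv_space r na)
  moreover have "bracket l N (root_vec (- \<alpha>)) (bracket l N (root_vec \<alpha>) (root_vec \<beta>)) =
    of_int (N \<alpha> \<beta>) *\<^sub>v of_int (N (- \<alpha>) (\<alpha> + \<beta>)) *\<^sub>v (root_vec \<beta> :: int vec)"
    by (simp only: bracket_sum[OF r] bracket_smult_right
        bracket_sum[of "- \<alpha>" l "\<alpha> + \<beta>" N, unfolded e, OF na r(3) r(2)])
  ultimately have "(of_int (N \<alpha> \<beta>) *\<^sub>v of_int (N (- \<alpha>) (\<alpha> + \<beta>)) *\<^sub>v root_vec \<beta>
     + bracket l N (root_vec \<beta>) (h_vec l (- \<alpha>))) (Root \<beta>) = (0 :: int)"
    by (simp only: z bracket_zero_right hh) simp
  then have "N \<alpha> \<beta> * N (- \<alpha>) (\<alpha> + \<beta>) = 1"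
    by (simp add: c) (simp add: smult_vec_def basis_vec_def)
  then show ?thesis using N_pm[OF r]
    by (metis mult.assoc mult.commute mult.right_neutral)
qed

end

section \<open>Signs of triples of weights\<close>

text \<open>\<open>sg p q\<close> is the factor between \<open>e\<^bsub>rt p q\<^esub>\<close> and the bivector \<open>f\<^sub>p \<and> f\<^sub>q\<close> of the natural module.
  It is found by solving the relations \<open>N = 1\<close> of a positive basis for roots of growing height.\<close>

definition sg :: "int \<Rightarrow> int \<Rightarrow> int" where
  "sg p q = sgn (q - p) * (if sgn p = sgn q then (-1) ^ nat (max \<bar>p\<bar> \<bar>q\<bar>) else 1)"

lemma sg_swap: "sg q p = - sg p q"
proof -
  have "sgn (p - q) = - sgn (q - p)" by (simp add: sgn_if)
  then show ?thesis by (simp add: sg_def max.commute)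
qed

lemma sg_neg: "sg (- q) (- p) = sg p q"
proof -
  have "sgn (- q) = sgn (- p) \<longleftrightarrow> sgn p = sgn q" by (auto simp: sgn_minus)
  then show ?thesis by (simp add: sg_def max.commute)
qed

lemma sg_sq: "p \<noteq> q \<Longrightarrow> sg p q * sg p q = 1"
proof -
  assume "p \<noteq> q"
  then have "sgn (q - p) * sgn (q - p) = 1" by (simp add: sgn_if)
  moreover have "((-1) ^ n) * ((-1) ^ n) = (1 :: int)" for n by (simp flip: power_mult_distrib)
  ultimately show ?thesis by (auto simp: sg_def mult_ac)
qed

lemma sg_opp: "0 < p \<Longrightarrow> q < 0 \<Longrightarrow> sg p q = -1" "p < 0 \<Longrightarrow> 0 < q \<Longrightarrow> sg p q = 1"
  by (auto simp: sg_def sgn_if)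

lemma sg_pos: "0 < p \<Longrightarrow> p < q \<Longrightarrow> sg p q = (-1) ^ nat q"
  by (auto simp: sg_def sgn_if)

lemma sg_pos': "0 < p \<Longrightarrow> p < q \<Longrightarrow> sg q p = - ((-1) ^ nat q)"
  using sg_pos sg_swap by metis

definition valid3 :: "nat \<Rightarrow> int \<Rightarrow> int \<Rightarrow> int \<Rightarrow> bool" where
  "valid3 l a b c \<longleftrightarrow> valid l a b \<and> valid l b c \<and> valid l a c"

lemma valid3_neg [simp]: "valid3 l (- a) b c = valid3 l a b c" "valid3 l a (- b) c = valid3 l a b c" 
  "valid3 l a b (- c) = valid3 l a b c"
  by (simp_all add: valid3_def)

lemma valid3_perm: "valid3 l b a c = valid3 l a b c" "valid3 l a c b = valid3 l a b c" "valid3 l c b a = valid3 l a b c"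
  by (auto simp: valid3_def valid_sym)

text \<open>A triple \<open>a, b, c\<close> stands for the roots \<open>wt a - wt b\<close> and \<open>wt b - wt c\<close>. The sign attached to it
  depends only on the set of the three indices, up to a common change of sign; the relations
  \<open>J\<close> and \<open>J'\<close> are the Jacobi identities for chains of three roots.\<close>

lemma triple_sign:
  fixes f :: "int \<Rightarrow> int \<Rightarrow> int \<Rightarrow> int"
  assumes l: "l > 4"
    and sq: "\<And>a b c. valid3 l a b c \<Longrightarrow> f a b c * f a b c = 1"
    and s12: "\<And>a b c. valid3 l a b c \<Longrightarrow> f b a c = f a b c"
    and rev: "\<And>a b c. valid3 l a b c \<Longrightarrow> f (- c) (- b) (- a) = f a b c"
    and J: "\<And>a b c d. valid3 l a b c \<Longrightarrow> valid3 l b c d \<Longrightarrow> valid3 l a b d \<Longrightarrow> valid3 l a c d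
         \<Longrightarrow> f b c d * f a b d = f a b c * f a c d"
    and J': "\<And>a b c. valid3 l a b c \<Longrightarrow> f c b a * f b (- a) (- c) = f a (- b) (- c) * f c (- a) (- b)"
    and P1: "\<And>i k. 0 < i \<Longrightarrow> i < k - 1 \<Longrightarrow> k \<le> int l \<Longrightarrow> f (- k) (- (k - 1)) (- i) = 1"
    and P2: "\<And>i j. 0 < i \<Longrightarrow> i < j \<Longrightarrow> j \<le> int l - 2 \<Longrightarrow> f j (j + 1) (- i) = 1"
    and P3: "\<And>i. 0 < i \<Longrightarrow> i < int l - 1 \<Longrightarrow> f (int l) (- (int l - 1)) (- i) = 1"
    and P4: "\<And>i. 0 < i \<Longrightarrow> i < int l - 1 \<Longrightarrow> f (int l - 1) (- int l) (- i) = 1"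
    and v: "valid3 l a b c"
  shows "f a b c = 1"
proof -
  have s23: "f a c b = f a b c" if "valid3 l a b c" for a b c
    using rev[of a b c] rev[of a c b] s12[of "- c" "- b" "- a"] that by (simp add: valid3_perm)
  have neg: "f (- a) (- b) (- c) = f a b c" if "valid3 l a b c" for a b c
    using rev[of c b a] s12[of a b c] s23[of b a c] s12[of b c a] that by (simp add: valid3_perm)
  have V: "valid3 l a b c" if "0 < \<bar>a\<bar>" "\<bar>a\<bar> < \<bar>b\<bar>" "\<bar>b\<bar> < \<bar>c\<bar>" "\<bar>c\<bar> \<le> int l" for a b c
    using that by (auto simp: valid3_def valid_def idx_def)
  \<comment> \<open>Positive triples: \<open>P1\<close> settles consecutive upper indices, and
    \<open>J\<close> raises the largest index by one.\<close>
  have C1: "f i j k = 1" if "0 < i" "i < j" "j < k" "k \<le> int l" for i j k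
  proof -
    have adj: "f i (k - 1) k = 1" if "0 < i" "i < k - 1" "k \<le> int l" for i k
      using P1[OF that] rev[of i "k - 1" k] V[of i "k - 1" k] that by simp
    have "j + 1 \<le> k" using that by simp
    then show ?thesis using that(4)
    proof (induction k rule: int_ge_induct)
      case base
      then show ?case using adj[of i "j + 1"] that by simp
    next
      case (step k)
      then have "f j k (k + 1) * f i j (k + 1) = f i j k * f i k (k + 1)"
        using that by (intro J V) auto
      moreover have "f j k (k + 1) = 1" "f i k (k + 1) = 1" "f i j k = 1"
        using adj[of j "k + 1"] adj[of i "k + 1"] step that by auto
      ultimately show ?case by simp
    qed
  qed
  have B1: "f (- i) (int l - 1) (- int l) = 1" if "0 < i" "i < int l - 1" for i
  proof -
    have "valid3 l i (int l - 1) (int l)" using that by (intro V) auto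
    then show ?thesis
      using P4[OF that] s23[of "int l - 1" "- int l" "- i"] s12[of "int l - 1" "- i" "- int l"]
      by (simp add: valid3_perm)
  qed
  have B2: "f (- i) (- (int l - 1)) (int l) = 1" if "0 < i" "i < int l - 1" for i
  proof -
    have "valid3 l i (int l - 1) (int l)" using that by (intro V) auto
    then show ?thesis
      using P3[OF that] s12[of "- (int l - 1)" "int l" "- i"] s23[of "- (int l - 1)" "- i" "int l"]
        s12[of "- i" "- (int l - 1)" "int l"]
      by (simp add: valid3_perm del: minus_diff_eq)
  qed
  define m where "m = int l - 1"
  have m: "m < int l" "0 < m" "\<And>j. j < int l \<Longrightarrow> j \<noteq> m \<Longrightarrow> j < m" using l by (auto simp: m_def)
  have B1: "f (- i) m (- int l) = 1" and B2: "f (- i) (- m) (int l) = 1" if "0 < i" "i < m" for i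
    using B1[of i] B2[of i] that by (simp_all add: m_def)
  \<comment> \<open>Smallest index negative: \<open>P2\<close> settles consecutive upper indices
    except the pair l - 1, l, which \<open>J'\<close> derives from \<open>B1\<close>,
    \<open>B2\<close> and the positive case; \<open>J\<close> then raises the largest index.\<close>
  have C2: "f (- i) j k = 1" if "0 < i" "i < j" "j < k" "k \<le> int l" for i j k
  proof -
    have adj: "f (- i) j (j + 1) = 1" if "0 < i" "i < j" "j + 1 \<le> int l" for i j
    proof (cases "j \<le> int l - 2")
      case True
      have "valid3 l i j (j + 1)" using that by (intro V) auto
      then show ?thesis using P2[OF that(1,2) True] s23[of j "j + 1" "- i"] s12[of j "- i" "j + 1"]
        by (simp add: valid3_perm)
    next
      case False
      then have j: "j = m" using that by (simp add: m_def)
      have v: "valid3 l i j (int l)" using that j by (intro V) (auto simp: m_def)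
      have "f (int l) j i * f j (- i) (- int l) = f i (- j) (- int l) * f (int l) (- i) (- j)"
        by (rule J'[OF v])
      moreover have b: "f (- i) (- j) (int l) = 1" "f (- i) j (- int l) = 1"
        using B2[of i] B1[of i] that j by simp_all
      moreover have "f (int l) j i = 1"
        using C1[of i j "int l"] s12[of "int l" j i] s23[of j "int l" i] s12[of j i "int l"] v that j m by (simp add: valid3_perm)
      moreover have "f j (- i) (- int l) = 1"
        using b s12[of "- i" j "- int l"] v by (simp add: valid3_perm)
      moreover have "f (int l) (- i) (- j) = 1"
        using b s12[of "- i" "int l" "- j"] s23[of "- i" "- j" "int l"] v by (simp add: valid3_perm)
      moreover have "f i (- j) (- int l) = f (- i) j (int l)"
        using neg[of "- i" j "int l"] v by simp
      ultimately show ?thesis using j by (simp add: m_def)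
    qed
    have "j + 1 \<le> k" using that by simp
    then show ?thesis using that(4)
    proof (induction k rule: int_ge_induct)
      case base
      then show ?case using adj[of i j] that by simp
    next
      case (step k)
      then have "f j k (k + 1) * f (- i) j (k + 1) = f (- i) j k * f (- i) k (k + 1)"
        using that by (intro J V) auto
      moreover have "f j k (k + 1) = 1" "f (- i) k (k + 1) = 1" "f (- i) j k = 1"
        using C1[of j k "k + 1"] adj[of i "k"] step that by auto
      ultimately show ?case by simp
    qed
  qed
  \<comment> \<open>Middle index negative: this is proved with largest index l, where
    \<open>B1\<close> and \<open>B2\<close> apply, and \<open>J\<close> carries it to smaller
    ones.\<close>
  have C3: "f i (- j) k = 1" if "0 < i" "i < j" "j < k" "k \<le> int l" for i j k
  proof -
    have top: "f i (- j) (int l) = 1" if "0 < i" "i < j" "j < int l" for i j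
    proof (cases "j = m")
      case True
      then have "f (- i) j (- int l) = 1" using B1[of i] that by simp
      then show ?thesis using neg[of i "- j" "int l"] V[of i j "int l"] that by simp
    next
      case False
      then have jm: "j < m" using m that by simp
      have "f (- j) (- m) (int l) * f i (- j) (int l) = f i (- j) (- m) * f i (- m) (int l)"
        using that jm m by (intro J V) auto
      moreover have "f (- j) (- m) (int l) = 1" using B2[of j] that jm by simp
      moreover have "f i (- j) (- m) = 1"
        using C2[of i j m] neg[of "- i" j m] V[of i j m] that jm m by simp
      moreover have "f i (- m) (int l) = 1"
        using B1[of i] neg[of i "- m" "int l"] V[of i m "int l"] that jm m by simp
      ultimately show ?thesis by simp
    qed
    show ?thesis
    proof (cases "k = int l")
      case True then show ?thesis using top that by simp
    next
      case False
      have "f (- j) k (int l) * f i (- j) (int l) = f i (- j) k * f i k (int l)"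
        using that False by (intro J V) auto
      moreover have "f (- j) k (int l) = 1" using C2[of j k "int l"] that False by simp
      moreover have "f i k (int l) = 1" using C1[of i k "int l"] that False by simp
      ultimately show ?thesis using top[of i j] that by simp
    qed
  qed
  \<comment> \<open>Largest index negative: \<open>J'\<close> relates the four sign patterns of one
    triple of absolute values, and three of them are already settled.\<close>
  have C4: "f i j (- k) = 1" if "0 < i" "i < j" "j < k" "k \<le> int l" for i j k
  proof -
    have v: "valid3 l i j k" using that by (intro V) auto
    have "f k j i * f j (- i) (- k) = f i (- j) (- k) * f k (- i) (- j)" by (rule J'[OF v])
    moreover have "f k j i = 1"
      using C1[OF that] s12[of k j i] s23[of j k i] s12[of j i k] v by (simp add: valid3_perm)
    moreover have "f j (- i) (- k) = 1"
      using C3[OF that] s12[of "- i" j "- k"] neg[of i "- j" k] v by (simp add: valid3_perm)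
    moreover have "f i (- j) (- k) = 1" using C2[OF that] neg[of "- i" j k] v by simp
    moreover have "f k (- i) (- j) = f i j (- k)"
      using s12[of "- i" k "- j"] s23[of "- i" "- j" k] neg[of i j "- k"] v by (simp add: valid3_perm)
    ultimately show ?thesis by simp
  qed
  have main: "f a b c = 1" if o: "\<bar>a\<bar> < \<bar>b\<bar>" "\<bar>b\<bar> < \<bar>c\<bar>" and v: "valid3 l a b c" for a b c
  proof -
    have c: "0 < \<bar>a\<bar>" "\<bar>c\<bar> \<le> int l" using v by (auto simp: valid3_def valid_def idx_def)
    have pos: "f a b c = 1" if o: "\<bar>a\<bar> < \<bar>b\<bar>" "\<bar>b\<bar> < c" and v: "valid3 l a b c" and c: "0 < \<bar>a\<bar>" "c \<le> int l" for a b c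
    proof -
      consider "a > 0" "b > 0" | "a < 0" "b > 0" | "a > 0" "b < 0" | "a < 0" "b < 0" using o c by linarith
      then show ?thesis
      proof cases
        case 1 then show ?thesis using C1[of a b c] o c by simp
      next
        case 2 then show ?thesis using C2[of "- a" b c] o c by simp
      next
        case 3 then show ?thesis using C3[of a "- b" c] o c by simp
      next
        case 4 then show ?thesis using C4[of "- a" "- b" c] neg[of a b c] v o c by simp
      qed
    qed
    show ?thesis
    proof (cases "c > 0")
      case True then show ?thesis using pos[of a b c] o v c by simp
    next
      case False then show ?thesis using pos[of "- a" "- b" "- c"] neg[of a b c] o v c by simp
    qed
  qed
  have "\<bar>a\<bar> \<noteq> \<bar>b\<bar>" "\<bar>b\<bar> \<noteq> \<bar>c\<bar>" "\<bar>a\<bar> \<noteq> \<bar>c\<bar>" using v by (auto simp: valid3_def valid_def)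
  then consider "\<bar>a\<bar> < \<bar>b\<bar>" "\<bar>b\<bar> < \<bar>c\<bar>" | "\<bar>a\<bar> < \<bar>c\<bar>" "\<bar>c\<bar> < \<bar>b\<bar>" | "\<bar>b\<bar> < \<bar>a\<bar>" "\<bar>a\<bar> < \<bar>c\<bar>"
    | "\<bar>b\<bar> < \<bar>c\<bar>" "\<bar>c\<bar> < \<bar>a\<bar>" | "\<bar>c\<bar> < \<bar>a\<bar>" "\<bar>a\<bar> < \<bar>b\<bar>" | "\<bar>c\<bar> < \<bar>b\<bar>" "\<bar>b\<bar> < \<bar>a\<bar>" by linarith
  then show ?thesis
  proof cases
    case 1 then show ?thesis using main v by simp
  next
    case 2 then show ?thesis using main[of a c b] s23[of a b c] v by (simp add: valid3_perm)
  next
    case 3 then show ?thesis using main[of b a c] s12[of a b c] v by (simp add: valid3_perm)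
  next
    case 4 then show ?thesis using main[of b c a] s12[of a b c] s23[of b a c] v by (simp add: valid3_perm)
  next
    case 5 then show ?thesis using main[of c a b] s23[of a b c] s12[of a c b] v by (simp add: valid3_perm)
  next
    case 6 then show ?thesis using main[of c b a] s12[of a b c] s23[of b a c] s12[of b c a] v by (simp add: valid3_perm)
  qed
qed

section \<open>The structure constants\<close>

lemma valid3_roots:
  assumes "valid3 l a b c"
  shows "rt a b \<in> roots l" "rt b c \<in> roots l" "rt a c \<in> roots l"
    "rt b a \<in> roots l" "rt c b \<in> roots l" "rt c a \<in> roots l"
  using assms by (auto simp: valid3_def rt_roots valid_sym)

lemma rt_add: "valid l q q' \<Longrightarrow> rt p (- q) + rt q t = rt p t"
  using valid_nz[of l q q'] by (simp add: rt_def wt_neg)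

lemma kd_valid: "valid l p q \<Longrightarrow> kd p q = 0" "valid l p q \<Longrightarrow> kd q p = 0"
  by (simp_all add: kd_eq_simps valid_def)

lemma valid3_sg:
  assumes "valid3 l a b c"
  shows "sg a b * sg a b = 1" "sg b c * sg b c = 1" "sg a c * sg a c = 1"
  using assms by (auto intro!: sg_sq simp: valid3_def dest: valid_ne)

lemma inner_zero_no_root:
  assumes "\<alpha> \<in> roots l" "\<beta> \<in> roots l" "inner_prod l \<alpha> \<beta> = 0"
  shows "\<alpha> + \<beta> \<notin> roots l" "\<alpha> + \<beta> \<noteq> 0"
proof -
  show "\<alpha> + \<beta> \<notin> roots l" using root_add_iff[OF assms(1,2)] assms(3) by simp
  show "\<alpha> + \<beta> \<noteq> 0"
  proof
    assume "\<alpha> + \<beta> = 0"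
    then have "\<beta> = - \<alpha>" by (simp add: eq_neg_iff_add_eq_0 add.commute)
    then show False using assms inner_self[of \<alpha> l] by (simp add: inner_uminus)
  qed
qed

lemma inner_simple:
  assumes l: "l > 4" and j: "j \<in> {1..l}"
  shows "inner_prod l \<alpha> (simple_root l j) = 
    (if j = 1 then ev \<alpha> (int l - 1) + ev \<alpha> (int l) else ev \<alpha> (int (l + 1 - j)) + ev \<alpha> (- int (l + 2 - j)))"
proof -
  have "valid l (int l - 1) (int l)" "j \<noteq> 1 \<Longrightarrow> valid l (int (l + 1 - j)) (- int (l + 2 - j))"
    using j l by (auto simp: valid_def idx_def)
  then show ?thesis using simple_root_rt(1)[OF j l] by (simp add: inner_rt)
qed

context
  fixes l :: nat and N :: "root \<Rightarrow> root \<Rightarrow> int"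
  assumes l: "l > 4" and chev: "chevalley_constants l N" and pos: "positive_constants l N"
begin

text \<open>The quotient of \<open>N\<close> by the structure constant that the signs \<open>sg\<close> predict.\<close>

definition nsg :: "int \<Rightarrow> int \<Rightarrow> int \<Rightarrow> int" where
  "nsg a b c = N (rt a (- b)) (rt b (- c)) * (sg a (- b) * sg b (- c) * sg a (- c))"

lemma nsg_sq:
  assumes v: "valid3 l a b c"
  shows "nsg a b c * nsg a b c = 1"
proof -
  have "valid l b c" using v by (simp add: valid3_def)
  then have e: "rt a (- b) + rt b (- c) = rt a (- c)" by (rule rt_add)
  have "N (rt a (- b)) (rt b (- c)) * N (rt a (- b)) (rt b (- c)) = 1"
    using valid3_roots[of l a "- b" "c"] valid3_roots[of l a b "- c"] v
    by (intro N_pm[OF l chev]) (simp_all add: e)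
  then show ?thesis
    using valid3_sg[of l a "- b" c] valid3_sg[of l a b "- c"] v unfolding nsg_def
    by (simp add: algebra_simps)
qed

text \<open>This is \<open>N_neg\<close> for the root \<open>rt a (- b)\<close>, whose negative is
  \<open>rt b (- a)\<close>.\<close>

lemma nsg_swap:
  assumes v: "valid3 l a b c"
  shows "nsg b a c = nsg a b c"
proof -
  have vs: "valid l a b" "valid l b c" using v by (simp_all add: valid3_def)
  have e: "rt a (- b) + rt b (- c) = rt a (- c)" by (rule rt_add[OF vs(2)])
  have n: "- rt a (- b) = rt b (- a)" using rt_neg[of l a "- b"] vs by (simp add: rt_sym)
  have "N (- rt a (- b)) (rt a (- b) + rt b (- c)) = N (rt a (- b)) (rt b (- c))"
    using valid3_roots[of l a "- b" "c"] valid3_roots[of l a b "- c"] v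
    by (intro N_neg[OF l chev]) (simp_all add: e)
  then have "N (rt b (- a)) (rt a (- c)) = N (rt a (- b)) (rt b (- c))" by (simp add: e n)
  moreover have "sg b (- a) = sg a (- b)" using sg_neg[of "- b" a] by simp
  ultimately show ?thesis by (simp add: nsg_def mult_ac)
qed

text \<open>Exchanging the two roots changes the sign of \<open>N\<close>, and each of the three
  factors \<open>sg\<close> changes sign as well.\<close>

lemma nsg_rev:
  assumes v: "valid3 l a b c"
  shows "nsg (- c) (- b) (- a) = nsg a b c"
proof -
  have vs: "valid l a b" "valid l b c" using v by (simp_all add: valid3_def)
  have e: "rt a (- b) + rt b (- c) = rt a (- c)" by (rule rt_add[OF vs(2)])
  have "N (rt b (- c)) (rt a (- b)) = - N (rt a (- b)) (rt b (- c))"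
    using valid3_roots[of l a "- b" "c"] valid3_roots[of l a b "- c"] v
    by (intro N_antisym[OF l chev]) (simp_all add: e)
  then show ?thesis
    by (simp add: nsg_def rt_sym[of "- c" b] rt_sym[of "- b" a] sg_swap[of "- c" b] sg_swap[of "- b" a] sg_swap[of "- c" a])
qed

text \<open>\<open>N_assoc\<close> for a chain with four distinct absolute values: the outer roots
  have no index in common up to sign and are therefore orthogonal.\<close>

lemma nsg_J:
  assumes v: "valid3 l a b c" "valid3 l b c d" "valid3 l a b d" "valid3 l a c d"
  shows "nsg b c d * nsg a b d = nsg a b c * nsg a c d"
proof -
  have vs: "valid l b c" "valid l c d" "valid l b d" "valid l a d" "valid l a c" "valid l a b"
    using v by (simp_all add: valid3_def)
  have e: "rt a (- b) + rt b (- c) = rt a (- c)" "rt b (- c) + rt c (- d) = rt b (- d)"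
    "rt a (- c) + rt c (- d) = rt a (- d)" 
    by (rule rt_add[OF vs(1)], rule rt_add[OF vs(2)], rule rt_add[OF vs(2)])
  have r: "rt a (- b) \<in> roots l" "rt b (- c) \<in> roots l" "rt c (- d) \<in> roots l" "rt a (- c) \<in> roots l" 
    "rt b (- d) \<in> roots l" "rt a (- d) \<in> roots l"
    using vs by (auto intro!: rt_roots)
  have "inner_prod l (rt c (- d)) (rt a (- b)) = 0"
    using vs by (subst inner_rt_rt) (simp_all add: kd_valid[of l])
  note 0 = inner_zero_no_root[OF r(3,1) this, unfolded add.commute[of "rt c (- d)"]]
  have A: "N (rt b (- c)) (rt c (- d)) * N (rt a (- b)) (rt b (- d)) = N (rt a (- b)) (rt b (- c)) * N (rt a (- c)) (rt c (- d))"
    using N_assoc[OF l chev r(1,2,3), unfolded e, OF r(4,5,6) 0] .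
  have sq: "sg a (- b) * sg a (- b) = 1" "sg b (- c) * sg b (- c) = 1" "sg c (- d) * sg c (- d) = 1"
     "sg a (- c) * sg a (- c) = 1" "sg b (- d) * sg b (- d) = 1" "sg a (- d) * sg a (- d) = 1"
    using vs by (auto intro!: sg_sq dest!: valid_ne)
  have "nsg b c d * nsg a b d = (N (rt b (- c)) (rt c (- d)) * N (rt a (- b)) (rt b (- d))) *
     (sg a (- b) * sg b (- c) * sg c (- d) * sg a (- d)) * (sg b (- d) * sg b (- d))"
    by (simp only: nsg_def mult_ac)
  also have "\<dots> = (N (rt a (- b)) (rt b (- c)) * N (rt a (- c)) (rt c (- d))) *
     (sg a (- b) * sg b (- c) * sg c (- d) * sg a (- d)) * (sg a (- c) * sg a (- c))"
    by (simp only: A sq)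
  also have "\<dots> = nsg a b c * nsg a c d" by (simp only: nsg_def mult_ac)
  finally show ?thesis .
qed

text \<open>A chain on three absolute values only: the outer roots \<open>rt a b\<close> and
  \<open>rt b (- a)\<close> use the same two coordinates but are orthogonal. The relation links all
  four sign patterns of a triple.\<close>

lemma nsg_J':
  assumes v: "valid3 l a b c"
  shows "nsg c b a * nsg b (- a) (- c) = nsg a (- b) (- c) * nsg c (- a) (- b)"
proof -
  have vs: "valid l a b" "valid l b c" "valid l a c" "valid l b a" "valid l c b" "valid l c a"
    using v by (simp_all add: valid3_def valid_sym)
  have e: "rt a b + rt (- b) c = rt a c" "rt (- b) c + rt b (- a) = rt c (- a)"
    "rt a c + rt b (- a) = rt b c" 
    using rt_add[of l "- b" a a c] rt_add[of l b a c "- a"] rt_add[of l "-a" b b c] vs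
    by (simp_all add: rt_sym[of "- b" c] rt_sym[of b "- a"] rt_sym[of b a] add.commute rt_sym[of c a] rt_sym[of c b])
     (simp_all add: rt_def wt_neg valid_nz[OF vs(1)] valid_nz[OF vs(2)])
  have r: "rt a b \<in> roots l" "rt (- b) c \<in> roots l" "rt b (- a) \<in> roots l" "rt a c \<in> roots l" 
    "rt c (- a) \<in> roots l" "rt b c \<in> roots l"
    using vs by (auto intro!: rt_roots)
  have "inner_prod l (rt b (- a)) (rt a b) = 0"
    using vs valid_nz[OF vs(1)] by (subst inner_rt_rt) (auto simp: kd_valid[of l] kd_def)
  note 0 = inner_zero_no_root[OF r(3,1) this, unfolded add.commute[of "rt b (- a)"]]
  have A: "N (rt (- b) c) (rt b (- a)) * N (rt a b) (rt c (- a)) = N (rt a b) (rt (- b) c) * N (rt a c) (rt b (- a))"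
    using N_assoc[OF l chev r(1,2,3), unfolded e, OF r(4,5,6) 0] .
  have "nsg c b a * nsg b (- a) (- c) = (N (rt (- b) c) (rt b (- a)) * N (rt a b) (rt c (- a))) *
     (sg a b * sg (- b) c * sg a c * sg c a * sg (- a) b * sg c b)"
    using valid3_sg(3)[of l a b c] valid3_sg(3)[of l "- a" b c] v
    by (simp add: nsg_def rt_sym[of c "- b"] rt_sym[of b a] rt_sym[of "- a" c]
        sg_swap[of c a] sg_swap[of c b] sg_swap[of b a]
        sg_swap[of c "- b"] sg_swap[of c "- a"] sg_swap[of b "- a"])
  also have "\<dots> = (N (rt a b) (rt (- b) c) * N (rt a c) (rt b (- a))) *
     (sg a b * sg (- b) c * sg a c * sg c a * sg (- a) b * sg c b)"
    by (simp only: A)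
  also have "\<dots> = nsg a (- b) (- c) * nsg c (- a) (- b)"
    by (simp add: nsg_def rt_sym[of c a] rt_sym[of "- a" b])
  finally show ?thesis .
qed

text \<open>The normalisation of a positive basis, with minimality of the simple root tested by
  inner products: subtracting a simple root leaves a root exactly when the inner product is
  1.\<close>

lemma nsg_extraspecial:
  assumes i: "i \<in> {1..l}" and a: "simple_root l i = rt a (- b)"
   and v: "valid3 l a b c" and p: "rt b (- c) \<in> pos_roots l" "rt a (- c) \<in> pos_roots l"
   and small: "\<And>j. j \<in> {1..<i} \<Longrightarrow> inner_prod l (rt a (- c)) (simple_root l j) \<noteq> 1"
  shows "N (rt a (- b)) (rt b (- c)) = 1"
proof -
  have vs: "valid l b c" using v by (simp_all add: valid3_def)
  have e: "rt a (- b) + rt b (- c) = rt a (- c)" by (rule rt_add[OF vs])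
  have r: "rt a (- c) \<in> roots l" using p(2) by (simp add: pos_roots_def)
  have "rt a (- c) - simple_root l j \<notin> roots l" if "j \<in> {1..<i}" for j
    using root_diff_iff[OF r, of "simple_root l j"] small[OF that] simple_root_rt(2)[of j l] that i l by auto
  then show ?thesis
    using pos[unfolded positive_constants_def, rule_format, OF i p(1)] p(2) unfolding a e by blast
qed

text \<open>The simple root is eps_(k-1) - eps_k, numbered \<open>l + 2 - k\<close>. Simple roots of
  smaller number involve only coordinates from k on and have inner product at most 0 with eps_i -
  eps_k.\<close>

lemma nsg_P1:
  assumes ik: "0 < i" "i < k - 1" "k \<le> int l"
  shows "nsg (- k) (- (k - 1)) (- i) = 1"
proof -
  define m where "m = l + 2 - nat k"
  have m: "m \<in> {1..l}" "m \<noteq> 1" "int (l + 1 - m) = k - 1" "int (l + 2 - m) = k" using ik by (auto simp: m_def)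
  have v: "valid3 l (- k) (- (k - 1)) (- i)" using ik by (auto simp: valid3_def valid_def idx_def)
  have "N (rt (- k) (- (- (k - 1)))) (rt (- (k - 1)) (- (- i))) = 1"
  proof (rule nsg_extraspecial[OF m(1) _ v])
    show "simple_root l m = rt (- k) (- (- (k - 1)))"
      unfolding simple_root_rt(1)[OF m(1) l] m(3,4) using m(2) by (simp add: rt_sym)
    show "rt (- (k - 1)) (- (- i)) \<in> pos_roots l" 
      unfolding rt_sym[of "- (k - 1)"] using ik v by (intro pos_rt l) (auto simp: valid3_def valid_sym)
    show "rt (- k) (- (- i)) \<in> pos_roots l" 
      unfolding rt_sym[of "- k"] using ik v by (intro pos_rt l) (auto simp: valid3_def valid_sym)
    fix j assume j: "j \<in> {1..<m}"
    have "int (l + 1 - j) \<ge> k" "int (l + 2 - j) > k" using j m by auto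
    then have "kd (int l - 1) i = 0" "kd (int l) i = 0" "kd (int l - 1) (- k) \<le> 0" "kd (int l) (- k) \<le> 0"
      "kd (int (l + 1 - j)) i = 0" "kd (int (l + 1 - j)) (- k) \<le> 0"
      "kd (- int (l + 2 - j)) i = 0" "kd (- int (l + 2 - j)) (- k) = 0"
      using ik unfolding kd_def by auto
    then show "inner_prod l (rt (- k) (- (- i))) (simple_root l j) \<noteq> 1"
      using j m ik by (subst inner_simple[OF l]) (auto simp: ev_rt)
  qed
  then show ?thesis using ik by (simp add: nsg_def sg_opp)
qed

text \<open>The simple root is eps_j - eps_(j+1). The bound stops at l - 2 because for j = l - 1 the
  root eps_(l-1) + eps_l, which has number 1, can also be subtracted from eps_i + eps_j.\<close>

lemma nsg_P2:
  assumes ij: "0 < i" "i < j" "j \<le> int l - 2"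
  shows "nsg j (j + 1) (- i) = 1"
proof -
  define m where "m = l + 1 - nat j"
  have m: "m \<in> {1..l}" "m \<noteq> 1" "int (l + 1 - m) = j" "int (l + 2 - m) = j + 1" using ij by (auto simp: m_def)
  have v: "valid3 l j (j + 1) (- i)" using ij by (auto simp: valid3_def valid_def idx_def)
  have "N (rt j (- (j + 1))) (rt (j + 1) (- (- i))) = 1"
  proof (rule nsg_extraspecial[OF m(1) _ v])
    show "simple_root l m = rt j (- (j + 1))"
      unfolding simple_root_rt(1)[OF m(1) l] m(3,4) using m(2) by (simp add: rt_sym)
    show "rt (j + 1) (- (- i)) \<in> pos_roots l" 
      unfolding rt_sym[of "j + 1"] using ij v by (intro pos_rt l) (auto simp: valid3_def valid_sym)
    show "rt j (- (- i)) \<in> pos_roots l" 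
      unfolding rt_sym[of j] using ij v by (intro pos_rt l) (auto simp: valid3_def valid_sym)
    fix k assume k: "k \<in> {1..<m}"
    have "int (l + 1 - k) > j" "int (l + 2 - k) > j" using k m by auto
    then have "kd (int l - 1) i = 0" "kd (int l) i = 0" "kd (int l - 1) j = 0" "kd (int l) j = 0"
      "kd (int (l + 1 - k)) i = 0" "kd (int (l + 1 - k)) j = 0"
      "kd (- int (l + 2 - k)) i = 0" "kd (- int (l + 2 - k)) j = 0"
      using ij unfolding kd_def by auto
    then show "inner_prod l (rt j (- (- i))) (simple_root l k) \<noteq> 1"
      using k m ij l by (subst inner_simple[OF l]) (auto simp: ev_rt)
  qed
  moreover have "nat (j + 1) = Suc (nat j)" using ij by simp
  ultimately show ?thesis using ij by (simp add: nsg_def sg_opp sg_pos')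
qed

text \<open>Here the simple root is eps_(l-1) + eps_l. It has number 1, so minimality is
  automatic.\<close>

lemma nsg_P34:
  assumes i: "0 < i" "i < int l - 1"
  shows "nsg (int l) (- (int l - 1)) (- i) = 1" "nsg (int l - 1) (- int l) (- i) = 1"
proof -
  have one: "1 \<in> {1..l}" using l by simp
  have v: "valid3 l (int l) (- (int l - 1)) (- i)" "valid3 l (int l - 1) (- int l) (- i)"
     using i by (auto simp: valid3_def valid_def idx_def)
  have s: "simple_root l 1 = rt (int l - 1) (int l)" using simple_root_rt(1)[OF one l] by simp
  have vi: "valid l i (int l - 1)" "valid l i (int l)" using i by (auto simp: valid_def idx_def)
  have "l = Suc (nat (int l - 1))" using l by simp
  then have n: "(-1) ^ l = - ((-1 :: int) ^ nat (int l - 1))" by (metis mult_minus_left mult_1 power_Suc)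
  have "N (rt (int l) (- (- (int l - 1)))) (rt (- (int l - 1)) (- (- i))) = 1"
  proof (rule nsg_extraspecial[OF one _ v(1)])
    show "simple_root l 1 = rt (int l) (- (- (int l - 1)))" using s by (simp add: rt_sym)
    show "rt (- (int l - 1)) (- (- i)) \<in> pos_roots l"
      unfolding rt_sym[of "- (int l - 1)"] using i vi by (intro pos_rt l) (auto simp del: minus_diff_eq)
    show "rt (int l) (- (- i)) \<in> pos_roots l"
      unfolding rt_sym[of "int l"] using i vi by (intro pos_rt l) auto
  qed simp
  then show "nsg (int l) (- (int l - 1)) (- i) = 1"
    using i sg_opp(2)[of "1 - int l" i] sg_pos'[of i "int l"] sg_pos'[of "int l - 1" "int l"]
    by (simp add: nsg_def flip: power_mult_distrib)
  have "N (rt (int l - 1) (- (- int l))) (rt (- int l) (- (- i))) = 1"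
  proof (rule nsg_extraspecial[OF one _ v(2)])
    show "simple_root l 1 = rt (int l - 1) (- (- int l))" using s by simp
    show "rt (- int l) (- (- i)) \<in> pos_roots l"
      unfolding rt_sym[of "- int l"] using i vi by (intro pos_rt l) auto
    show "rt (int l - 1) (- (- i)) \<in> pos_roots l"
      unfolding rt_sym[of "int l - 1"] using i vi by (intro pos_rt l) auto
  qed simp
  then show "nsg (int l - 1) (- int l) (- i) = 1"
    using i sg_opp(2)[of "- int l" i] sg_pos[of "int l - 1" "int l"] sg_pos'[of i "int l - 1"] n
    by (simp add: nsg_def flip: power_mult_distrib)
qed

text \<open>The bivectors f_p wedge f_q bracket without extra signs, so rescaling each by
  \<open>sg\<close> multiplies their constants by three factors; \<open>nsg\<close> equal to 1 says
  that \<open>N\<close> is of this form.\<close>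

theorem structure_constants:
  assumes v: "valid3 l i j q"
  shows "N (rt i j) (rt (- j) q) = sg i j * sg (- j) q * sg i q"
proof -
  have v': "valid3 l i (- j) (- q)" using v by simp
  have "nsg i (- j) (- q) = 1"
    by (rule triple_sign[OF l, of nsg, OF nsg_sq nsg_swap nsg_rev nsg_J nsg_J' nsg_P1 nsg_P2 nsg_P34 v'])
  then have 1: "N (rt i j) (rt (- j) q) * (sg i j * sg (- j) q * sg i q) = 1"
    by (simp add: nsg_def)
  have "(sg i j * sg (- j) q * sg i q) * (sg i j * sg (- j) q * sg i q) = (sg i j * sg i j) * (sg (- j) q * sg (- j) q) * (sg i q * sg i q)"
    by (simp only: mult_ac)
  also have "\<dots> = 1" using valid3_sg[of l i j q] valid3_sg[of l i "- j" q] v by simp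
  finally have 2: "(sg i j * sg (- j) q * sg i q) * (sg i j * sg (- j) q * sg i q) = 1" .
  have "x = s" if "x * s = 1" "s * s = 1" for x s :: int
    using that by (metis mult.assoc mult_1_left mult_1_right)
  from this[OF 1 2] show ?thesis .
qed

end

section \<open>Isometries of the natural module\<close>

type_synonym 'a nvec = "int \<Rightarrow> 'a"

definition unit_vec :: "int \<Rightarrow> 'a::comm_ring_1 nvec" where
  "unit_vec p = (\<lambda>q. if q = p then 1 else 0)"

text \<open>The action of \<open>x\<^bsub>rt i j\<^esub>\<close> on the natural module, up to the sign of the parameter.\<close>

definition opv :: "int \<Rightarrow> int \<Rightarrow> 'a::comm_ring_1 \<Rightarrow> 'a nvec \<Rightarrow> 'a nvec" where
  "opv i j c v = (\<lambda>p. if p = i then v i + c * v (- j) else if p = j then v j - c * v (- i) else v p)"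

text \<open>The split symmetric form in which the weights p and - p are dual. On the diagonal it is
  twice the sum of v p v(-p) over p > 0, which is the source of the factors 2 in the norms
  below.\<close>

definition Bil :: "nat \<Rightarrow> 'a::comm_ring_1 nvec \<Rightarrow> 'a nvec \<Rightarrow> 'a" where
  "Bil l v w = (\<Sum>p\<in>idx 1 l. v p * w (- p))"

text \<open>For \<open>m = 3\<close> these vectors form the space W of the two rows; for
  \<open>m = 4\<close> the plane of the weights 3, -3 is removed as well.\<close>

definition supp_in :: "nat \<Rightarrow> nat \<Rightarrow> 'a::comm_ring_1 nvec \<Rightarrow> bool" where
  "supp_in m l v \<longleftrightarrow> (\<forall>p. p \<notin> idx m l \<longrightarrow> v p = 0)"

lemma idx_uminus [simp]: "- p \<in> idx m l \<longleftrightarrow> p \<in> idx m l"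
  by (simp add: idx_def)

lemma uminus_image_idx: "uminus ` idx m l = idx m l"
  by (rule set_eqI) (metis add.inverse_inverse idx_uminus image_iff)

lemma idx_mono: "m' \<le> m \<Longrightarrow> p \<in> idx m l \<Longrightarrow> p \<in> idx m' l"
  by (auto simp: idx_def)

lemma Bil_sym: "Bil l v w = Bil l w v"
proof -
  have "Bil l v w = (\<Sum>p\<in>uminus ` idx 1 l. v p * w (- p))" unfolding Bil_def uminus_image_idx ..
  also have "\<dots> = Bil l w v" by (subst sum.reindex) (auto simp: Bil_def mult.commute)
  finally show ?thesis .
qed

lemma Bil_linear: "Bil l (\<lambda>p. a * v p + b * v' p) w = a * Bil l v w + b * Bil l v' w"
  by (simp add: Bil_def sum.distrib sum_distrib_left algebra_simps)

lemma Bil_linear_right: "Bil l w (\<lambda>p. a * v p + b * v' p) = a * Bil l w v + b * Bil l w v'"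
  using Bil_linear[of l a v b v' w] by (simp add: Bil_sym)

lemma Bil_unit: "i \<in> idx 1 l \<Longrightarrow> Bil l (unit_vec i) w = w (- i)"
proof -
  assume "i \<in> idx 1 l"
  moreover have "Bil l (unit_vec i) w = (\<Sum>p\<in>idx 1 l. if p = i then w (- i) else 0)"
    unfolding Bil_def by (intro sum.cong) (auto simp: unit_vec_def)
  ultimately show ?thesis by simp
qed

lemma Bil_unit_right: "i \<in> idx 1 l \<Longrightarrow> Bil l w (unit_vec i) = w (- i)"
  using Bil_unit Bil_sym by metis

lemma Bil_zero: "Bil l (\<lambda>_. 0) w = 0" "Bil l w (\<lambda>_. 0) = 0"
  by (simp_all add: Bil_def)

lemma Bil_quad: "Bil l (\<lambda>p. a * u p + b * w p) (\<lambda>p. c * u p + d * w p)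
   = a * c * Bil l u u + (a * d + b * c) * Bil l u w + b * d * Bil l w w"
  by (simp add: Bil_linear Bil_linear_right Bil_sym[of l w u] algebra_simps)

lemma opv_alt:
  assumes "i \<noteq> j"
  shows "opv i j c v = (\<lambda>p. 1 * (1 * v p + c * v (- j) * unit_vec i p) + (- c * v (- i)) * unit_vec j p)"
  using assms by (auto simp: opv_def unit_vec_def fun_eq_iff)

lemma opv_linear: "opv i j c (\<lambda>p. a * v p + b * w p) = (\<lambda>p. a * opv i j c v p + b * opv i j c w p)"
  by (auto simp: opv_def fun_eq_iff algebra_simps)

lemma Bil_opv:
  assumes "valid l i j"
  shows "Bil l (opv i j c v) (opv i j c w) = Bil l v w"
proof -
  have ij: "i \<in> idx 1 l" "j \<in> idx 1 l" "i \<noteq> j" using assms valid_ne[OF assms] by (auto simp: valid_def)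
  have n: "- i \<noteq> i" "- i \<noteq> j" "- j \<noteq> i" "- j \<noteq> j" using valid_ne[OF assms] by auto
  have "Bil l (opv i j c v) x = Bil l v x + c * v (- j) * x (- i) - c * v (- i) * x (- j)" for v x
    unfolding opv_alt[OF ij(3)] Bil_linear Bil_unit[OF ij(1)] Bil_unit[OF ij(2)] by simp
  note 1 = this
  have "opv i j c w (- i) = w (- i)" "opv i j c w (- j) = w (- j)" using n by (auto simp: opv_def)
  then show ?thesis
    using 1[of v "opv i j c w"] 1[of w v] by (simp add: Bil_sym[of l v "opv i j c w"] Bil_sym[of l w v] algebra_simps)
qed

lemma opv_inverse:
  assumes "valid l i j"
  shows "opv i j (- c) (opv i j c v) = v"
  using valid_ne[OF assms] by (auto simp: opv_def fun_eq_iff)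

text \<open>The group of elementary isometries in the coordinates of absolute value at least m: for
  1 it acts on the whole natural module, for 3 on W, and for 4 it fixes the plane of the weights 3,
  -3.\<close>

inductive_set Eops :: "nat \<Rightarrow> nat \<Rightarrow> ('a::comm_ring_1 nvec \<Rightarrow> 'a nvec) set" for m l where
  Eops_id: "(\<lambda>v. v) \<in> Eops m l"
| Eops_step: "h \<in> Eops m l \<Longrightarrow> i \<in> idx m l \<Longrightarrow> j \<in> idx m l \<Longrightarrow> \<bar>i\<bar> \<noteq> \<bar>j\<bar> \<Longrightarrow> (\<lambda>v. opv i j c (h v)) \<in> Eops m l"

lemma Eops_opv: "i \<in> idx m l \<Longrightarrow> j \<in> idx m l \<Longrightarrow> \<bar>i\<bar> \<noteq> \<bar>j\<bar> \<Longrightarrow> opv i j c \<in> Eops m l"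
  using Eops_step[OF Eops_id, of i m l j c] by simp

lemma Eops_comp: "h' \<in> Eops m l \<Longrightarrow> h \<in> Eops m l \<Longrightarrow> (\<lambda>v. h' (h v)) \<in> Eops m l"
  by (induction rule: Eops.induct) (auto intro: Eops.intros)

lemma Eops_mono: "h \<in> Eops m l \<Longrightarrow> m' \<le> m \<Longrightarrow> h \<in> Eops m' l"
  by (induction rule: Eops.induct) (auto intro: Eops.intros idx_mono)

lemma Eops_linear: "h \<in> Eops m l \<Longrightarrow> h (\<lambda>p. a * v p + b * w p) = (\<lambda>p. a * h v p + b * h w p)"
  by (induction rule: Eops.induct) (auto simp: opv_linear)

lemma Eops_zero: "h \<in> Eops m l \<Longrightarrow> h (\<lambda>_. 0) = (\<lambda>_. 0)"
  using Eops_linear[of h m l 0 "\<lambda>_. 0" 0 "\<lambda>_. 0"] by simp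

lemma Eops_outside: "h \<in> Eops m l \<Longrightarrow> p \<notin> idx m l \<Longrightarrow> h v p = v p"
  by (induction rule: Eops.induct) (auto simp: opv_def)

lemma Eops_supp: "h \<in> Eops m l \<Longrightarrow> m' \<le> m \<Longrightarrow> supp_in m' l v \<Longrightarrow> supp_in m' l (h v)"
  unfolding supp_in_def using Eops_outside idx_mono by metis

lemma Eops_fixed:
  assumes "h \<in> Eops m l" "\<And>p. p \<in> idx m l \<Longrightarrow> v p = 0"
  shows "h v = v"
  using assms by (induction rule: Eops.induct) (auto simp: opv_def fun_eq_iff)

lemma valid_idx: "1 \<le> m \<Longrightarrow> i \<in> idx m l \<Longrightarrow> j \<in> idx m l \<Longrightarrow> \<bar>i\<bar> \<noteq> \<bar>j\<bar> \<Longrightarrow> valid l i j"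
  using idx_mono[of 1 m] by (auto simp: valid_def)

lemma Bil_Eops: "h \<in> Eops m l \<Longrightarrow> 1 \<le> m \<Longrightarrow> Bil l (h v) (h w) = Bil l v w"
  by (induction rule: Eops.induct) (auto simp: Bil_opv valid_idx)

lemma Eops_inverse: "h \<in> Eops m l \<Longrightarrow> 1 \<le> m \<Longrightarrow> \<exists>h'\<in>Eops m l. \<forall>v. h' (h v) = v"
proof (induction rule: Eops.induct)
  case Eops_id
  then show ?case by (auto intro: Eops.Eops_id)
next
  case (Eops_step h i j c)
  then obtain h' where h': "h' \<in> Eops m l" "\<And>v. h' (h v) = v" by auto
  have "(\<lambda>v. h' (opv i j (- c) v)) \<in> Eops m l"
    using Eops_comp[OF h'(1) Eops_opv[of i m l j "- c"]] Eops_step by simp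
  moreover have "h' (opv i j (- c) (opv i j c (h v))) = v" for v
    using Eops_step h' by (simp add: opv_inverse[OF valid_idx])
  ultimately show ?case by (intro bexI[of _ "\<lambda>v. h' (opv i j (- c) v)"]) auto
qed

lemma Eops_eq_zero: "h \<in> Eops m l \<Longrightarrow> 1 \<le> m \<Longrightarrow> h v = (\<lambda>_. 0) \<longleftrightarrow> v = (\<lambda>_. 0)"
  using Eops_inverse[of h m l] Eops_zero by metis

lemma Eops_clear:
  fixes v :: "'a::field nvec"
  assumes m: "1 \<le> m" "m \<le> l" and t: "v (- int m) = t" "t \<noteq> 0"
    and K: "finite K" "K \<subseteq> {p \<in> idx m l. \<bar>p\<bar> \<noteq> int m}"
  shows "\<exists>h\<in>Eops m l. h v (- int m) = t \<and> (\<forall>k\<in>K. h v k = 0)"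
  using K
proof (induction K rule: finite_induct)
  case empty
  then show ?case using t by (auto intro!: bexI[of _ "\<lambda>v. v"] Eops_id)
next
  case (insert k K)
  then obtain h where h: "h \<in> Eops m l" "h v (- int m) = t" "\<And>k'. k' \<in> K \<Longrightarrow> h v k' = 0" by auto
  have k: "k \<in> idx m l" "\<bar>k\<bar> \<noteq> int m" using insert by auto
  have mm: "int m \<in> idx m l" using m by (auto simp: idx_def)
  have "(\<lambda>x. opv k (int m) (- h v k / t) (h x)) \<in> Eops m l"
    using h(1) k mm by (intro Eops_step) auto
  moreover have "opv k (int m) (- h v k / t) (h v) (- int m) = t"
    using h(2) k m by (auto simp: opv_def)
  moreover have "opv k (int m) (- h v k / t) (h v) k' = 0" if "k' \<in> insert k K" for k'
    using h(2,3) t insert.prems that by (auto simp: opv_def)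
  ultimately show ?case by (intro bexI[of _ "\<lambda>x. opv k (int m) (- h v k / t) (h x)"]) auto
qed

text \<open>The pivot at - m can be set to \<open>t\<close> only with the help of a nonzero entry
  outside the plane of m and - m. If there is none, \<open>m < l\<close> allows an entry of that
  plane to be copied to coordinate m + 1.\<close>

lemma Eops_reduce:
  fixes v :: "'a::field nvec"
  assumes m: "1 \<le> m" "m < l" and v: "p \<in> idx m l" "v p \<noteq> 0" and t: "t \<noteq> 0"
  shows "\<exists>h\<in>Eops m l. h v (- int m) = t \<and> (\<forall>k\<in>idx m l. \<bar>k\<bar> \<noteq> int m \<longrightarrow> h v k = 0)"
proof -
  have mm: "int m \<in> idx m l" "int (Suc m) \<in> idx m l" using m by (auto simp: idx_def)
  have "\<exists>h\<in>Eops m l. \<exists>k\<in>idx m l. \<bar>k\<bar> \<noteq> int m \<and> h v k \<noteq> 0"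
  proof (cases "\<exists>k\<in>idx m l. \<bar>k\<bar> \<noteq> int m \<and> v k \<noteq> 0")
    case True
    then show ?thesis by (auto intro!: bexI[of _ "\<lambda>v. v"] Eops_id)
  next
    case False
    then have p: "\<bar>p\<bar> = int m" using v by auto
    have "v (int (Suc m)) = 0" using False mm by auto
    then have "opv (int (Suc m)) (- p) 1 v (int (Suc m)) \<noteq> 0" using v by (simp add: opv_def)
    moreover have "opv (int (Suc m)) (- p) 1 \<in> Eops m l" using mm p v by (intro Eops_opv) auto
    ultimately show ?thesis using mm by (intro bexI[of _ "opv (int (Suc m)) (- p) 1"] bexI[of _ "int (Suc m)"]) auto
  qed
  then obtain h1 k where h1: "h1 \<in> Eops m l" "k \<in> idx m l" "\<bar>k\<bar> \<noteq> int m" "h1 v k \<noteq> 0" by blast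
  define v1 where "v1 = h1 v"
  define v2 where "v2 = opv (- int m) (- k) ((t - v1 (- int m)) / v1 k) v1"
  have h2: "(\<lambda>v. opv (- int m) (- k) ((t - v1 (- int m)) / v1 k) (h1 v)) \<in> Eops m l"
    using h1 mm by (intro Eops_step) auto
  have v2: "v2 (- int m) = t" using h1 by (simp add: v2_def opv_def v1_def)
  obtain h3 where h3: "h3 \<in> Eops m l" "h3 v2 (- int m) = t" "\<forall>k\<in>{p \<in> idx m l. \<bar>p\<bar> \<noteq> int m}. h3 v2 k = 0"
    using Eops_clear[of m l v2 t "{p \<in> idx m l. \<bar>p\<bar> \<noteq> int m}"] m v2 t by auto
  show ?thesis
    using Eops_comp[OF h3(1) h2] h3(2,3) unfolding v2_def v1_def
    by (intro bexI[of _ "\<lambda>v. h3 (opv (- int m) (- k) ((t - v1 (- int m)) / v1 k) (h1 v))"]) (auto simp: v1_def)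
qed

definition pvec :: "int \<Rightarrow> 'a::comm_ring_1 \<Rightarrow> 'a \<Rightarrow> 'a nvec" where
  "pvec k a b = (\<lambda>p. a * unit_vec (- k) p + b * unit_vec k p)"

lemma pvec_apply: "k \<noteq> 0 \<Longrightarrow> pvec k a b (- k) = a" "k \<noteq> 0 \<Longrightarrow> pvec k a b k = b" 
  "\<bar>p\<bar> \<noteq> \<bar>k\<bar> \<Longrightarrow> pvec k a b p = 0"
  by (auto simp: pvec_def unit_vec_def)

lemma Bil_pvec: "k \<in> idx 1 l \<Longrightarrow> Bil l w (pvec k a b) = a * w k + b * w (- k)"
  unfolding pvec_def Bil_linear_right by (simp add: Bil_unit_right)

lemma Bil_pvec_pvec: "k \<in> idx 1 l \<Longrightarrow> Bil l (pvec k a b) (pvec k c d) = b * c + a * d"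
  by (simp add: Bil_pvec pvec_apply) (auto simp: pvec_apply idx_def)

lemma supp_pvec: "k \<in> idx m l \<Longrightarrow> supp_in m l (pvec k a b)"
  by (auto simp: supp_in_def pvec_def unit_vec_def)

lemma pvec_eqI: 
  assumes "k \<noteq> 0" "v (- k) = a" "v k = b" "\<And>p. p \<noteq> k \<Longrightarrow> p \<noteq> - k \<Longrightarrow> v p = 0"
  shows "v = pvec k a b"
  using assms by (auto simp: pvec_def unit_vec_def fun_eq_iff)

text \<open>Once the vector lies in the plane of m and - m with entry -1 at - m, its norm determines
  the other entry. The value -1 is the one found in the rows of the normal forms.\<close>

lemma reduce_vector:
  fixes v :: "'a::field nvec"
  assumes m: "1 \<le> m" "m < l" and v: "supp_in m l v" "v \<noteq> (\<lambda>_. 0)" and q: "Bil l v v = 2 * r" and two: "(2::'a) \<noteq> 0"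
  shows "\<exists>h\<in>Eops m l. h v = pvec (int m) (-1) (- r)"
proof -
  obtain p where p: "v p \<noteq> 0" using v by auto
  then have "p \<in> idx m l" using v by (auto simp: supp_in_def)
  then obtain h where h: "h \<in> Eops m l" "h v (- int m) = -1" "\<forall>k\<in>idx m l. \<bar>k\<bar> \<noteq> int m \<longrightarrow> h v k = 0"
    using Eops_reduce[of m l p v "-1"] m p by auto
  have s: "supp_in m l (h v)" using Eops_supp[OF h(1) order_refl v(1)] .
  define y where "y = h v (int m)"
  have e: "h v = pvec (int m) (-1) y"
  proof (rule pvec_eqI)
    fix p assume "p \<noteq> int m" "p \<noteq> - int m"
    then show "h v p = 0" using h s by (cases "p \<in> idx m l") (auto simp: supp_in_def)
  qed (use m h y_def in auto)
  have mi: "int m \<in> idx 1 l" using m by (auto simp: idx_def)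
  have "Bil l (h v) (h v) = 2 * r" using Bil_Eops[OF h(1) m(1)] q by simp
  then have "- (2 * y) = 2 * r" unfolding e by (simp add: Bil_pvec_pvec[OF mi])
  then have "2 * y = 2 * (- r)" by (simp add: minus_equation_iff)
  then have "y = - r" using two mult_cancel_left[of 2 y "- r"] by simp
  then show ?thesis using h(1) e by metis
qed

section \<open>Pairs of vectors\<close>

definition zvec :: "'a::comm_ring_1 nvec" where "zvec = (\<lambda>_. 0)"

definition lin :: "'a::comm_ring_1 \<Rightarrow> 'a nvec \<Rightarrow> 'a \<Rightarrow> 'a nvec \<Rightarrow> 'a nvec" where
  "lin a v b w = (\<lambda>p. a * v p + b * w p)"

lemma lin_lin: "lin a (lin p v q w) b (lin r v s w) = lin (a * p + b * r) v (a * q + b * s) w"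
  by (auto simp: lin_def fun_eq_iff algebra_simps)

lemma Eops_lin: "h \<in> Eops m l \<Longrightarrow> h (lin a v b w) = lin a (h v) b (h w)"
  unfolding lin_def by (rule Eops_linear)

lemma Bil_lin: "Bil l (lin a u b w) (lin c u d w)
   = a * c * Bil l u u + (a * d + b * c) * Bil l u w + b * d * Bil l w w"
  unfolding lin_def by (rule Bil_quad)

lemma supp_lin: "supp_in m l v \<Longrightarrow> supp_in m l w \<Longrightarrow> supp_in m l (lin a v b w)"
  by (simp add: supp_in_def lin_def)

lemma lin_1_0: "lin 1 v 0 w = v" "lin 0 v 1 w = w"
  by (auto simp: lin_def)

text \<open>The generators mirror those of \<open>G_0\<close>: the two row operations come from the
  roots \<open>rt 1 (- 2)\<close> and \<open>rt 2 (- 1)\<close>, which generate SL_2, and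
  \<open>opv\<close> from the roots inside W.\<close>

inductive reach :: "nat \<Rightarrow> 'a::comm_ring_1 nvec \<Rightarrow> 'a nvec \<Rightarrow> 'a nvec \<Rightarrow> 'a nvec \<Rightarrow> bool"
  for l u0 w0 where
  reach_refl: "reach l u0 w0 u0 w0"
| reach_up: "reach l u0 w0 u w \<Longrightarrow> reach l u0 w0 (lin 1 u c w) w"
| reach_down: "reach l u0 w0 u w \<Longrightarrow> reach l u0 w0 u (lin c u 1 w)"
| reach_opv: "reach l u0 w0 u w \<Longrightarrow> i \<in> idx 3 l \<Longrightarrow> j \<in> idx 3 l \<Longrightarrow> \<bar>i\<bar> \<noteq> \<bar>j\<bar> \<Longrightarrow>
     reach l u0 w0 (opv i j c u) (opv i j c w)"

lemma reach_trans:
  assumes "reach l u1 w1 u2 w2" "reach l u0 w0 u1 w1" shows "reach l u0 w0 u2 w2"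
  using assms by (induction rule: reach.induct) (auto intro: reach.intros)

lemma reach_Eops: "h \<in> Eops 3 l \<Longrightarrow> reach l u w (h u) (h w)"
  by (induction rule: Eops.induct) (auto intro: reach.intros)

text \<open>A matrix of determinant 1 whose upper right entry q is nonzero is a product lower,
  upper, lower of elementary matrices, with q in the middle factor.\<close>

lemma reach_SL2:
  fixes u :: "'a::field nvec"
  assumes "p * s - q * r = 1"
  shows "reach l u w (lin p u q w) (lin r u s w)"
proof -
  have main: "reach l u w (lin p u q w) (lin r u s w)" if d: "p * s - q * r = 1" and q: "q \<noteq> 0"
    for p q r s :: 'a and u w :: "'a nvec"
  proof -
    define a b where "a = (p - 1) / q" and "b = (s - 1) / q"
    define w1 where "w1 = lin a u 1 w"
    define u1 where "u1 = lin 1 u q w1"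
    have "reach l u w u1 (lin b u1 1 w1)"
      unfolding u1_def w1_def by (intro reach.intros)
    moreover have "u1 = lin p u q w"
    proof -
      have 0: "1 + q * a = p" using q by (simp add: a_def)
      show ?thesis unfolding u1_def w1_def 0[symmetric] by (auto simp: lin_def fun_eq_iff algebra_simps)
    qed
    moreover have "lin b u1 1 w1 = lin r u s w"
    proof -
      have 1: "1 + b * q = s" using q by (simp add: b_def)
      have "a + b * p = (p * s - 1) / q" using q by (simp add: a_def b_def field_simps)
      also have "\<dots> = r" using q d by (simp add: field_simps)
      finally have 2: "a + b * p = r" .
      show ?thesis unfolding \<open>u1 = lin p u q w\<close> w1_def 1[symmetric] 2[symmetric]
        by (auto simp: lin_def fun_eq_iff algebra_simps)
    qed
    ultimately show ?thesis by simp
  qed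
  show ?thesis
  proof (cases "q = 0")
    case False then show ?thesis using main[OF assms] by simp
  next
    case True
    then have ps: "p * s = 1" using assms by simp
    then have "p \<noteq> 0" by auto
    \<comment> \<open>Replacing u by u + w turns the upper right entry 0 into - p, which is
      nonzero.\<close>
    have "reach l (lin 1 u 1 w) w (lin p (lin 1 u 1 w) (- p) w) (lin r (lin 1 u 1 w) (s - r) w)"
      using ps \<open>p \<noteq> 0\<close> by (intro main) (auto simp: algebra_simps)
    moreover have "lin p (lin 1 u 1 w) (- p) w = lin p u q w" "lin r (lin 1 u 1 w) (s - r) w = lin r u s w"
      using True by (auto simp: lin_def fun_eq_iff algebra_simps)
    ultimately show ?thesis using reach_trans[OF _ reach_up[OF reach_refl]] by metis
  qed
qed

text \<open>Isometries are linear and hence commute with row operations, so every word in the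
  generators collects into one matrix and one isometry.\<close>

lemma reach_matrix:
  assumes "reach l u0 w0 u w"
  shows "\<exists>h\<in>Eops 3 l. \<exists>p q r s. p * s - q * r = 1 \<and> u = h (lin p u0 q w0) \<and> w = h (lin r u0 s w0)"
  using assms
proof (induction rule: reach.induct)
  case reach_refl
  show ?case by (intro bexI[of _ "\<lambda>v. v"] exI[of _ 1] exI[of _ 0]) (auto simp: lin_1_0 Eops_id)
next
  case (reach_up u w c)
  then obtain h p q r s where h: "h \<in> Eops 3 l" "p * s - q * r = 1" "u = h (lin p u0 q w0)" "w = h (lin r u0 s w0)"
    by blast
  have "lin 1 u c w = h (lin (p + c * r) u0 (q + c * s) w0)"
    unfolding h(3,4) Eops_lin[OF h(1), symmetric] lin_lin by simp
  moreover have "(p + c * r) * s - (q + c * s) * r = 1" using h(2) by (simp add: algebra_simps)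
  ultimately show ?case using h(1,4) by blast
next
  case (reach_down u w c)
  then obtain h p q r s where h: "h \<in> Eops 3 l" "p * s - q * r = 1" "u = h (lin p u0 q w0)" "w = h (lin r u0 s w0)"
    by blast
  have "lin c u 1 w = h (lin (c * p + r) u0 (c * q + s) w0)"
    unfolding h(3,4) Eops_lin[OF h(1), symmetric] lin_lin by simp
  moreover have "p * (c * q + s) - q * (c * p + r) = 1" using h(2) by (simp add: algebra_simps)
  ultimately show ?case using h(1,3) by blast
next
  case (reach_opv u w i j c)
  then obtain h p q r s where h: "h \<in> Eops 3 l" "p * s - q * r = 1" "u = h (lin p u0 q w0)" "w = h (lin r u0 s w0)"
    by blast
  have "(\<lambda>v. opv i j c (h v)) \<in> Eops 3 l" using h(1) reach_opv by (intro Eops_step)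
  then show ?case using h(2,3,4) 
    by (intro bexI[of _ "\<lambda>v. opv i j c (h v)"] exI[of _ p] exI[of _ q] exI[of _ r] exI[of _ s]) auto
qed

text \<open>A Siegel transformation: the two contributions to coordinate 4 cancel on this vector,
  while a vector orthogonal to it is in general moved. It lies in the stabiliser but not among the
  operators of the planes from 4 on.\<close>

lemma siegel_fix: "opv 4 (- 3) b (opv 4 3 (- b * \<rho>) (pvec 3 (-1) (- \<rho>))) = pvec 3 (-1) (- \<rho>)"
  by (auto simp: fun_eq_iff opv_def pvec_def unit_vec_def)

lemma Bil_pvec_num: "l > 4 \<Longrightarrow> Bil l w (pvec 3 a b) = a * w 3 + b * w (- 3)"
   "l > 4 \<Longrightarrow> Bil l w (pvec 4 a b) = a * w 4 + b * w (- 4)"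
  by (auto intro!: Bil_pvec simp: idx_def)

lemma idx_num: "l > 4 \<Longrightarrow> 3 \<in> idx 3 l" "l > 4 \<Longrightarrow> - 3 \<in> idx 3 l" "l > 4 \<Longrightarrow> 4 \<in> idx 3 l" "l > 4 \<Longrightarrow> - 4 \<in> idx 3 l"
   "l > 4 \<Longrightarrow> 4 \<in> idx 4 l" "l > 4 \<Longrightarrow> - 4 \<in> idx 4 l" 
  by (auto simp: idx_def)

lemma idx_3_cases: "p \<in> idx 3 l \<Longrightarrow> p \<notin> idx 4 l \<Longrightarrow> p = 3 \<or> p = - 3"
  by (auto simp: idx_def)

text \<open>Witt's theorem in explicit form. First \<open>w\<close> is moved into the plane of 3,
  -3; then \<open>u\<close> is normalised inside the stabiliser of that vector by Siegel
  transformations and the operators of the planes 4, ..., l.\<close>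

lemma anisotropic_pair:
  fixes u w :: "'a::field nvec"
  assumes l: "l > 4" and two: "(2::'a) \<noteq> 0" and su: "supp_in 3 l u" and sw: "supp_in 3 l w"
    and orth: "Bil l u w = 0" and qw: "Bil l w w = 2 * \<rho>" "\<rho> \<noteq> 0" and qu: "Bil l u u = 2 * r" and u: "u \<noteq> zvec"
  shows "\<exists>h\<in>Eops 3 l. h w = pvec 3 (-1) (- \<rho>) \<and> h u = pvec 4 (-1) (- r)"
proof -
  define w1 :: "'a nvec" where "w1 = pvec 3 (-1) (- \<rho>)"
  have "w \<noteq> (\<lambda>_. 0)" using qw two by (auto simp: Bil_zero)
  then obtain h1 where h1: "h1 \<in> Eops 3 l" "h1 w = w1"
    using reduce_vector[of 3 l w \<rho>] l sw qw two by (auto simp: w1_def)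
  define u1 where "u1 = h1 u"
  have SE: "(\<lambda>v. opv 4 (- 3) b (opv 4 3 a v)) \<in> Eops 3 l" for a b :: 'a
    using idx_num[OF l] by (intro Eops_step Eops_opv) auto
  have perp: "v 3 = - \<rho> * v (- 3)" if "h \<in> Eops 3 l" "h w = w1" "v = h u" for h v
  proof -
    have "Bil l v w1 = 0" using Bil_Eops[OF that(1), of u w] that orth by simp
    then have "- v 3 - \<rho> * v (- 3) = 0" unfolding w1_def Bil_pvec_num(1)[OF l] by simp
    then show ?thesis by (simp add: minus_equation_iff[of "v 3"])
  qed
  have u1nz: "u1 \<noteq> (\<lambda>_. 0)" using Eops_eq_zero[OF h1(1)] u by (auto simp: u1_def zvec_def)
  have su1: "supp_in 3 l u1" unfolding u1_def by (rule Eops_supp[OF h1(1) order_refl su])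
  \<comment> \<open>If \<open>u1\<close> lies entirely in the plane of 3, -3, orthogonality fixes
    the ratio of its two entries, and a Siegel transformation creates the entry - 2 \<rho> u1(-3) at
    coordinate 4, which is nonzero.\<close>
  have "\<exists>h\<in>Eops 3 l. h w = w1 \<and> (\<exists>k\<in>idx 4 l. h u k \<noteq> 0)"
  proof (cases "\<exists>k\<in>idx 4 l. u1 k \<noteq> 0")
    case True then show ?thesis using h1 by (auto simp: u1_def)
  next
    case False
    have p1: "u1 3 = - \<rho> * u1 (- 3)" by (rule perp[OF h1 u1_def])
    obtain k where "u1 k \<noteq> 0" using u1nz by auto
    then have "k \<in> idx 3 l" "k \<notin> idx 4 l" using su1 False by (auto simp: supp_in_def)
    then have "u1 (- 3) \<noteq> 0" using \<open>u1 k \<noteq> 0\<close> p1 idx_3_cases[of k l] by auto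
    moreover have "u1 4 = 0" "u1 (- 4) = 0" using False idx_num[OF l] by auto
    ultimately have "opv 4 (- 3) 1 (opv 4 3 (- 1 * \<rho>) u1) 4 \<noteq> 0"
      using two qw p1 by (auto simp: opv_def)
    moreover have "opv 4 (- 3) 1 (opv 4 3 (- 1 * \<rho>) w1) = w1" unfolding w1_def by (rule siegel_fix)
    ultimately show ?thesis
      using Eops_comp[OF SE[of 1 "- 1 * \<rho>"] h1(1)] h1(2) idx_num[OF l]
      by (intro bexI[of _ "\<lambda>v. opv 4 (- 3) 1 (opv 4 3 (- 1 * \<rho>) (h1 v))"]) (auto simp: u1_def)
  qed
  then obtain h2 k where h2: "h2 \<in> Eops 3 l" "h2 w = w1" "k \<in> idx 4 l" "h2 u k \<noteq> 0" by blast
  \<comment> \<open>This step needs at least two planes among 4, ..., l; its operators leave the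
    plane of 3, -3 alone.\<close>
  obtain h3 where h3: "h3 \<in> Eops 4 l" "h3 (h2 u) (- 4) = -1" "\<forall>k\<in>idx 4 l. \<bar>k\<bar> \<noteq> 4 \<longrightarrow> h3 (h2 u) k = 0"
    using Eops_reduce[of 4 l k "h2 u" "-1"] h2(3,4) l by auto
  have h3': "h3 \<in> Eops 3 l" using Eops_mono[OF h3(1), of 3] by simp
  have "h3 w1 = w1"
  proof (rule Eops_fixed[OF h3(1)])
    fix p assume "p \<in> idx 4 l"
    then show "w1 p = 0" by (auto simp: w1_def pvec_def unit_vec_def idx_def)
  qed
  then have h4: "(\<lambda>v. h3 (h2 v)) \<in> Eops 3 l" "h3 (h2 w) = w1" using Eops_comp[OF h3' h2(1)] h2(2) by auto
  define u3 where "u3 = h3 (h2 u)"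
  define t where "t = u3 (- 3)"
  have p3: "u3 3 = - \<rho> * t" unfolding t_def using perp[OF h4 u3_def] by simp
  \<comment> \<open>The entry -1 at - 4 serves as pivot: the Siegel transformation with parameter -
    t removes both entries in the plane of 3, -3, whose ratio is known from
    \<open>p3\<close>.\<close>
  define h5 where "h5 = (\<lambda>v. opv 4 (- 3) (- t) (opv 4 3 (- (- t) * \<rho>) (h3 (h2 v))))"
  have h5: "h5 \<in> Eops 3 l" using Eops_comp[OF SE h4(1)] by (simp add: h5_def)
  have h5w: "h5 w = w1" unfolding h5_def h4(2) unfolding w1_def by (rule siegel_fix)
  have s5: "supp_in 3 l (h5 u)" by (rule Eops_supp[OF h5 order_refl su])
  have e: "h5 u = pvec 4 (-1) (h5 u 4)"
  proof (rule pvec_eqI)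
    show "h5 u (- 4) = -1" using h3(2) by (simp add: h5_def opv_def)
    fix p :: int assume p: "p \<noteq> 4" "p \<noteq> - 4"
    consider "p \<notin> idx 3 l" | "p = 3" | "p = - 3" | "p \<in> idx 4 l" using idx_3_cases by blast
    then show "h5 u p = 0"
    proof cases
      case 1 then show ?thesis using s5 by (simp add: supp_in_def)
    next
      case 2 then show ?thesis using p3 h3(2) by (simp add: h5_def opv_def u3_def[symmetric])
    next
      case 3 then show ?thesis using p3 h3(2) by (simp add: h5_def opv_def u3_def[symmetric] t_def)
    next
      case 4
      then have "\<bar>p\<bar> \<noteq> 4" "p \<noteq> 3" "p \<noteq> - 3" using p by (auto simp: idx_def)
      then show ?thesis using h3(3) 4 p by (simp add: h5_def opv_def)
    qed
  qed auto
  define y where "y = h5 u 4"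
  have e': "h5 u = pvec 4 (-1) y" using e by (simp add: y_def)
  have "Bil l (h5 u) (h5 u) = 2 * r" using Bil_Eops[OF h5] qu by simp
  then have "2 * y = 2 * (- r)" unfolding e' Bil_pvec_num(2)[OF l] 
    by (simp add: pvec_def unit_vec_def minus_equation_iff)
  then have "y = - r" using two mult_cancel_left[of 2 y "- r"] by simp
  then show ?thesis using h5 h5w e' unfolding w1_def by metis
qed

text \<open>An isotropic \<open>w1\<close> lies in its own orthogonal complement. Orthogonality
  removes coordinate 3 of \<open>u\<close>, and coordinate -3 is removed by adding a multiple of
  \<open>w1\<close>, a row operation instead of an isometry.\<close>

lemma isotropic_pair:
  fixes u w :: "'a::field nvec"
  assumes l: "l > 4" and two: "(2::'a) \<noteq> 0" and su: "supp_in 3 l u" and sw: "supp_in 3 l w"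
    and q: "Bil l u w = 0" "Bil l w w = 0" "Bil l u u = 0" and w: "w \<noteq> zvec"
  shows "reach l u w zvec (pvec 3 (-1) 0) \<or> reach l u w (pvec 4 (-1) 0) (pvec 3 (-1) 0)"
proof -
  define w1 :: "'a nvec" where "w1 = pvec 3 (-1) 0"
  obtain h1 where h1: "h1 \<in> Eops 3 l" "h1 w = w1"
    using reduce_vector[of 3 l w 0] l sw q two w by (auto simp: w1_def zvec_def)
  define u1 where "u1 = h1 u"
  define u2 where "u2 = lin 1 u1 (u1 (- 3)) w1"
  have r1: "reach l u w u1 w1" using reach_Eops[OF h1(1), of u w] h1(2) by (simp add: u1_def)
  have r2: "reach l u w u2 w1" unfolding u2_def by (rule reach_up[OF r1])
  have su1: "supp_in 3 l u1" unfolding u1_def by (rule Eops_supp[OF h1(1) order_refl su])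
  have sw1: "supp_in 3 l w1" unfolding w1_def using l by (intro supp_pvec) (auto simp: idx_def)
  have su2: "supp_in 3 l u2" unfolding u2_def by (rule supp_lin[OF su1 sw1])
  have b1: "Bil l u1 w1 = 0" "Bil l w1 w1 = 0" "Bil l u1 u1 = 0"
    using Bil_Eops[OF h1(1), of u w] Bil_Eops[OF h1(1), of w w] Bil_Eops[OF h1(1), of u u] h1(2) q by (simp_all add: u1_def)
  have "u1 3 = 0" using b1(1) unfolding w1_def Bil_pvec_num(1)[OF l] by simp
  then have u23: "u2 3 = 0" "u2 (- 3) = 0" by (simp_all add: u2_def lin_def w1_def pvec_def unit_vec_def)
  have q2: "Bil l u2 u2 = 0" unfolding u2_def Bil_lin by (simp add: b1)
  have su2': "supp_in 4 l u2"
    unfolding supp_in_def using su2 u23 idx_3_cases[of _ l] by (metis supp_in_def)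
  show ?thesis
  proof (cases "u2 = zvec")
    case True then show ?thesis using r2 by (simp add: w1_def)
  next
    case False
    then obtain h3 where h3: "h3 \<in> Eops 4 l" "h3 u2 = pvec 4 (-1) 0"
      using reduce_vector[of 4 l u2 0] l su2' q2 two by (auto simp: zvec_def)
    have h3': "h3 \<in> Eops 3 l" using Eops_mono[OF h3(1), of 3] by simp
    have "h3 w1 = w1"
    proof (rule Eops_fixed[OF h3(1)])
      fix p assume "p \<in> idx 4 l"
      then show "w1 p = 0" by (auto simp: w1_def pvec_def unit_vec_def idx_def)
    qed
    then show ?thesis using reach_trans[OF reach_Eops[OF h3', of u2 w1] r2] h3(2) by (simp add: w1_def)
  qed
qed

text \<open>Gram-Schmidt with determinant 1; an anisotropic second row suffices. If both vectors are
  isotropic, u + w has norm 2 Bil(u, w), nonzero as the characteristic is not 2.\<close>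

lemma diagonalise:
  fixes u w :: "'a::field nvec"
  assumes two: "(2::'a) \<noteq> 0" and nz: "Bil l u u \<noteq> 0 \<or> Bil l u w \<noteq> 0 \<or> Bil l w w \<noteq> 0"
  shows "\<exists>p q r s. p * s - q * r = 1 \<and> Bil l (lin r u s w) (lin r u s w) \<noteq> 0 \<and> Bil l (lin p u q w) (lin r u s w) = 0"
proof -
  have main: "\<exists>p q r s. p * s - q * r = 1 \<and> Bil l (lin r u s w) (lin r u s w) \<noteq> 0 \<and> Bil l (lin p u q w) (lin r u s w) = 0"
    if d: "p * s - q * r = 1" and n: "Bil l (lin r u s w) (lin r u s w) \<noteq> 0" for p q r s
  proof -
    define c where "c = - Bil l (lin p u q w) (lin r u s w) / Bil l (lin r u s w) (lin r u s w)"
    have e: "lin (p + c * r) u (q + c * s) w = lin 1 (lin p u q w) c (lin r u s w)" unfolding lin_lin by simp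
    have "Bil l (lin (p + c * r) u (q + c * s) w) (lin r u s w) = 
       Bil l (lin p u q w) (lin r u s w) + c * Bil l (lin r u s w) (lin r u s w)"
      using Bil_lin[of l 1 "lin p u q w" c "lin r u s w" 0 1] unfolding e lin_1_0 by simp
    also have "\<dots> = 0" using n by (simp add: c_def)
    finally have "Bil l (lin (p + c * r) u (q + c * s) w) (lin r u s w) = 0" .
    moreover have "(p + c * r) * s - (q + c * s) * r = 1" using d by (simp add: algebra_simps)
    ultimately show ?thesis using n by blast
  qed
  show ?thesis
  proof (cases "Bil l w w = 0")
    case False then show ?thesis using main[of 1 1 0 0] by (simp add: lin_1_0)
  next
    case ww: True
    show ?thesis
    proof (cases "Bil l u u = 0")
      case False then show ?thesis using main[of 0 0 "-1" 1] by (simp add: lin_1_0)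
    next
      case True
      then have "Bil l u w \<noteq> 0" using ww nz by simp
      then have "Bil l (lin 1 u 1 w) (lin 1 u 1 w) \<noteq> 0" unfolding Bil_lin using ww True two by simp
      then show ?thesis using main[of 1 1 0 1] by simp
    qed
  qed
qed

text \<open>The rows \<open>1\<close> and \<open>2\<close> of the bivector of a normal form. The vector \<open>e\<^sub>\<tau>\<close> enters with a sign opposite
  to that of \<open>e\<^sub>\<lambda>\<close>, \<open>e\<^sub>\<rho>\<close> and \<open>e\<^sub>\<sigma>\<close>; this is why \<open>x\<^sup>2 - k y\<^sup>2\<close> and not \<open>x\<^sup>2 + k y\<^sup>2\<close> governs the dark orbits.\<close>

fun pair_u :: "'k::field orbit_type \<Rightarrow> 'k nvec" where
  "pair_u Zero = pvec 4 0 0"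
| "pair_u Singular = pvec 4 0 0"
| "pair_u (Brilliant_a a) = pvec 4 0 0"
| "pair_u Brilliant_b = pvec 4 (-1) 0"
| "pair_u (Luminous a) = pvec 4 (-1) 0"
| "pair_u (Dark k a) = pvec 4 (-1) (k / a)"

fun pair_w :: "'k::field orbit_type \<Rightarrow> 'k nvec" where
  "pair_w Zero = pvec 3 0 0"
| "pair_w Singular = pvec 3 (-1) 0"
| "pair_w (Brilliant_a a) = pvec 3 (-1) (- a)"
| "pair_w Brilliant_b = pvec 3 (-1) 0"
| "pair_w (Luminous a) = pvec 3 (-1) (- a)"
| "pair_w (Dark k a) = pvec 3 (-1) (- a)"

lemma pvec_zero: "pvec k 0 0 = zvec"
  by (simp add: pvec_def zvec_def)

lemma representative_exists:
  assumes "equiv A r" "representatives A r R" "x \<in> A"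
  shows "\<exists>a\<in>R. (x, a) \<in> r"
proof -
  have "r `` {x} \<in> A // r" using assms(3) by (rule quotientI)
  then have "\<exists>!a. a \<in> R \<inter> r `` {x}" using assms(2) by (simp only: representatives_def)
  then show ?thesis by auto
qed

lemma representative_unique:
  assumes "equiv A r" "representatives A r R" "a \<in> R" "b \<in> R" "(a, b) \<in> r"
  shows "a = b"
proof -
  have "a \<in> A" using assms unfolding representatives_def by blast
  then have "r `` {a} \<in> A // r" by (rule quotientI)
  then have "\<exists>!c. c \<in> R \<inter> r `` {a}" using assms(2) by (simp only: representatives_def)
  moreover have "a \<in> r `` {a}" using equiv_class_self[OF assms(1) \<open>a \<in> A\<close>] .
  ultimately show ?thesis using assms(3-5) by (metis IntI Image_singleton_iff)
qed

text \<open>The rank of the Gram matrix separates the cases: rank 0 gives Zero, Singular and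
  Brilliant_b, rank 1 gives Brilliant_a and Luminous, rank 2 gives Dark.\<close>

theorem pair_classification:
  fixes u w :: "'k::field nvec"
  assumes l: "l > 4" and two: "(2::'k) \<noteq> 0" and su: "supp_in 3 l u" and sw: "supp_in 3 l w"
    and S: "representatives units_of_field square_rel S"
    and R: "\<And>k. k \<in> units_of_field \<Longrightarrow> representatives units_of_field (norm_rel k) (R k)"
  shows "\<exists>t\<in>orbit_types S R. reach l u w (pair_u t) (pair_w t)"
proof (cases "Bil l u u \<noteq> 0 \<or> Bil l u w \<noteq> 0 \<or> Bil l w w \<noteq> 0")
  case False
  show ?thesis
  proof (cases "u = zvec \<and> w = zvec")
    case True
    then show ?thesis using reach_refl[of l u w]
      by (intro bexI[of _ Zero]) (auto simp: pvec_zero orbit_types_def)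
  next
    case nz: False
    have *: "\<exists>t\<in>orbit_types S R. reach l u w (pair_u t) (pair_w t)" 
      if "supp_in 3 l u" "supp_in 3 l w" "Bil l u w = 0" "Bil l w w = 0" "Bil l u u = 0" "w \<noteq> zvec" for u w :: "'k nvec"
      using isotropic_pair[OF l two that]
    proof
      assume "reach l u w zvec (pvec 3 (-1) 0)"
      then show ?thesis by (intro bexI[of _ Singular]) (auto simp: pvec_zero orbit_types_def)
    next
      assume "reach l u w (pvec 4 (-1) 0) (pvec 3 (-1) 0)"
      then show ?thesis by (intro bexI[of _ Brilliant_b]) (auto simp: pvec_zero orbit_types_def)
    qed
    show ?thesis
    proof (cases "w = zvec")
      case False then show ?thesis using * su sw \<open>\<not> (_ \<or> _)\<close> by blast
    next
      case True
      \<comment> \<open>A quarter turn makes the second vector the nonzero one.\<close>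
      have r: "reach l u w (lin 0 u (-1) w) (lin 1 u 0 w)" by (rule reach_SL2) simp
      have e: "lin 1 u 0 w = u" "lin 0 u (-1) w = zvec" using True by (auto simp: lin_def zvec_def)
      have "\<exists>t\<in>orbit_types S R. reach l zvec u (pair_u t) (pair_w t)"
        using * [of zvec u] su nz True \<open>\<not> (_ \<or> _)\<close> by (auto simp: zvec_def supp_in_def Bil_zero)
      then show ?thesis using reach_trans[OF _ r] unfolding e by blast
    qed
  qed
next
  case True
  then obtain p q r s where d: "p * s - q * r = 1" and n: "Bil l (lin r u s w) (lin r u s w) \<noteq> 0" 
    and o: "Bil l (lin p u q w) (lin r u s w) = 0" using diagonalise[OF two] by metis
  define u1 w1 where "u1 = lin p u q w" and "w1 = lin r u s w"
  have r1: "reach l u w u1 w1" unfolding u1_def w1_def by (rule reach_SL2[OF d])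
  have su1: "supp_in 3 l u1" "supp_in 3 l w1" unfolding u1_def w1_def using su sw by (auto intro: supp_lin)
  define \<rho> where "\<rho> = Bil l w1 w1 / 2"
  define \<eta> where "\<eta> = Bil l u1 u1 / 2"
  have b: "Bil l u1 w1 = 0" "Bil l w1 w1 = 2 * \<rho>" "Bil l u1 u1 = 2 * \<eta>" "\<rho> \<noteq> 0"
    using n o two by (auto simp: \<rho>_def \<eta>_def u1_def w1_def)
  show ?thesis
  proof (cases "\<eta> = 0")
    case True
    obtain a where a: "a \<in> S" "(\<rho>, a) \<in> square_rel"
      using representative_exists[OF equiv_square_rel S, of \<rho>] b(4) by (auto simp: units_of_field_def)
    then obtain c where c: "c \<noteq> 0" "\<rho> = a * c^2" "a \<noteq> 0" by (auto simp: square_rel_def units_of_field_def)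
    \<comment> \<open>A diagonal matrix of determinant 1 moves the half norm \<rho> to its
      representative a modulo squares; the first vector stays isotropic.\<close>
    define u2 w2 where "u2 = lin c u1 0 w1" and "w2 = lin 0 u1 (1 / c) w1"
    have r2: "reach l u w u2 w2" unfolding u2_def w2_def
      using c by (intro reach_trans[OF reach_SL2 r1]) auto
    have s2: "supp_in 3 l u2" "supp_in 3 l w2" unfolding u2_def w2_def using su1 by (auto intro: supp_lin)
    have b2: "Bil l u2 w2 = 0" "Bil l w2 w2 = 2 * a" "Bil l u2 u2 = 2 * 0"
      unfolding u2_def w2_def Bil_lin b using c True by (auto simp: power2_eq_square)
    show ?thesis
    proof (cases "u2 = zvec")
      case z: True
      have "w2 \<noteq> (\<lambda>_. 0)" using b2 two c by (auto simp: Bil_zero)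
      then obtain h where h: "h \<in> Eops 3 l" "h w2 = pvec 3 (-1) (- a)"
        using reduce_vector[of 3 l w2 a] l s2 b2 two by auto
      have "h u2 = zvec" using Eops_zero[OF h(1)] z by (simp add: zvec_def)
      then have "reach l u w zvec (pvec 3 (-1) (- a))" using reach_trans[OF reach_Eops[OF h(1)] r2] h(2) by metis
      then show ?thesis using a by (intro bexI[of _ "Brilliant_a a"]) (auto simp: pvec_zero orbit_types_def)
    next
      case False
      then obtain h where h: "h \<in> Eops 3 l" "h w2 = pvec 3 (-1) (- a)" "h u2 = pvec 4 (-1) 0"
        using anisotropic_pair[OF l two s2 b2(1,2) _ b2(3)] c by auto
      then have "reach l u w (pvec 4 (-1) 0) (pvec 3 (-1) (- a))" using reach_trans[OF reach_Eops[OF h(1)] r2] by metis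
      then show ?thesis using a by (intro bexI[of _ "Luminous a"]) (auto simp: orbit_types_def)
    qed
  next
    case False
    \<comment> \<open>Minus the determinant of the matrix of half norms; the sign matches the normal
      form, whose half norms are - k / a and a.\<close>
    define k where "k = - (\<eta> * \<rho>)"
    have k: "k \<in> units_of_field" using False b by (simp add: k_def units_of_field_def)
    obtain a where a: "a \<in> R k" "(\<rho>, a) \<in> norm_rel k"
      using representative_exists[OF equiv_norm_rel R[OF k], of \<rho>] b(4) by (auto simp: units_of_field_def)
    then obtain x y where xy: "x^2 - k * y^2 = \<rho> * a" and an: "a \<noteq> 0" by (auto simp: norm_rel_def units_of_field_def)
    have xy': "x * x + \<eta> * \<rho> * (y * y) = \<rho> * a" using xy by (simp add: k_def power2_eq_square)
    \<comment> \<open>The second vector is chosen with half norm a. The first is the multiple of its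
      orthogonal complement that gives determinant 1, so its half norm must be - k / a.\<close>
    define u2 w2 where "u2 = lin (x / a) u1 (- (y * \<eta> / a)) w1" and "w2 = lin y u1 (x / \<rho>) w1"
    have det: "x / a * (x / \<rho>) - (- (y * \<eta> / a)) * y = 1"
    proof -
      have "x / a * (x / \<rho>) - (- (y * \<eta> / a)) * y = (x * x + \<eta> * \<rho> * (y * y)) / (\<rho> * a)"
        using an b by (simp add: field_simps)
      then show ?thesis using xy' an b by simp
    qed
    have r2: "reach l u w u2 w2" unfolding u2_def w2_def by (rule reach_trans[OF reach_SL2[OF det] r1])
    have s2: "supp_in 3 l u2" "supp_in 3 l w2" unfolding u2_def w2_def using su1 by (auto intro: supp_lin)
    have b21: "Bil l u2 w2 = 0"
      unfolding u2_def w2_def Bil_lin b using an b(4) by (simp add: field_simps)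
    have b22: "Bil l w2 w2 = 2 * a"
    proof -
      have "Bil l w2 w2 = 2 * ((x * x + \<eta> * \<rho> * (y * y)) / \<rho>)"
        unfolding w2_def Bil_lin b using b(4) by (simp add: field_simps)
      then show ?thesis using xy' b(4) by simp
    qed
    have b23: "Bil l u2 u2 = 2 * (- (k / a))"
    proof -
      have "Bil l u2 u2 = 2 * \<eta> * ((x * x + \<eta> * \<rho> * (y * y)) / (a * a))"
        unfolding u2_def Bil_lin b using an by (simp add: field_simps)
      also have "\<dots> = 2 * (- (k / a))" unfolding xy' using an by (simp add: k_def field_simps)
      finally show ?thesis .
    qed
    have "u2 \<noteq> zvec"
    proof
      assume "u2 = zvec"
      then have "2 * (- (k / a)) = 0" using b23 by (simp add: zvec_def Bil_zero)
      then show False using two k an by (simp add: units_of_field_def)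
    qed
    then obtain h where h: "h \<in> Eops 3 l" "h w2 = pvec 3 (-1) (- a)" "h u2 = pvec 4 (-1) (k / a)"
      using anisotropic_pair[OF l two s2 b21 b22 an b23] by auto
    then have "reach l u w (pvec 4 (-1) (k / a)) (pvec 3 (-1) (- a))" using reach_trans[OF reach_Eops[OF h(1)] r2] by metis
    then show ?thesis using a k by (intro bexI[of _ "Dark k a"]) (auto simp: orbit_types_def)
  qed
qed

section \<open>Invariants that separate the types of pairs\<close>

lemma pvec_num:
  "pvec 3 a b 3 = b" "pvec 3 a b (- 3) = a" "pvec 3 a b 4 = 0" "pvec 3 a b (- 4) = 0"
  "pvec 4 a b 3 = 0" "pvec 4 a b (- 3) = 0" "pvec 4 a b 4 = b" "pvec 4 a b (- 4) = a"
  by (simp_all add: pvec_def unit_vec_def)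

lemma Bil_pair:
  assumes "l > 4"
  shows "Bil l (pair_u t) (pair_w t') = 0" 
  using assms by (cases t; cases t') (simp_all add: Bil_pvec_num pvec_num)

lemma Bil_pair_u:
  assumes "l > 4"
  shows "Bil l (pair_u t) (pair_u t) = (case t of Dark k a \<Rightarrow> - (2 * (k / a)) | _ \<Rightarrow> 0)" 
  using assms by (cases t) (simp_all add: Bil_pvec_num pvec_num)

lemma Bil_pair_w:
  assumes "l > 4"
  shows "Bil l (pair_w t) (pair_w t) = (case t of Dark k a \<Rightarrow> 2 * a | Brilliant_a a \<Rightarrow> 2 * a | Luminous a \<Rightarrow> 2 * a | _ \<Rightarrow> 0)" 
  using assms by (cases t) (simp_all add: Bil_pvec_num pvec_num)

text \<open>Tells Singular from Brilliant_b and Brilliant_a from Luminous, pairs of types that the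
  Gram matrix cannot distinguish.\<close>

definition dependent_pair :: "'a::comm_ring_1 nvec \<Rightarrow> 'a nvec \<Rightarrow> bool" where
  "dependent_pair u w \<longleftrightarrow> (\<exists>a b. (a \<noteq> 0 \<or> b \<noteq> 0) \<and> lin a u b w = zvec)"

lemma dependent_pair_type:
  "dependent_pair (pair_u t) (pair_w t) \<longleftrightarrow> (case t of Zero \<Rightarrow> True | Singular \<Rightarrow> True | Brilliant_a a \<Rightarrow> True | _ \<Rightarrow> False)"
proof -
  have "x = 0 \<and> y = 0" if "lin x (pvec 4 (-1) c) y (pvec 3 (-1) d) = zvec" for x y c d :: 'a
    using fun_cong[OF that, of "- 4"] fun_cong[OF that, of "- 3"] by (simp add: lin_def pvec_def unit_vec_def zvec_def)
  moreover have "dependent_pair (pvec 4 0 0) v" for v :: "'a nvec"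
    unfolding dependent_pair_def by (intro exI[of _ 1] exI[of _ 0]) (auto simp: pvec_zero lin_def zvec_def)
  ultimately show ?thesis by (cases t) (auto simp: dependent_pair_def)
qed

lemma zero_pair_type: "pair_u t = zvec \<and> pair_w t = zvec \<longleftrightarrow> t = Zero"
proof -
  have "pvec 3 (-1) d \<noteq> zvec" for d :: 'a
  proof
    assume "pvec 3 (-1) d = zvec"
    from fun_cong[OF this, of "- 3"] show False by (simp add: pvec_def unit_vec_def zvec_def)
  qed
  then show ?thesis by (cases t) (auto simp: pvec_zero)
qed

text \<open>By \<open>reach_matrix\<close> the Gram matrix changes by congruence with a matrix of
  determinant 1: its determinant is kept, and the new lower diagonal entry is a value of the old
  form.\<close>

lemma reach_invariants:
  fixes u w :: "'k::field nvec"
  assumes r: "reach l u0 w0 u w" and orth: "Bil l u0 w0 = 0" "Bil l u w = 0"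
  shows "u0 = zvec \<and> w0 = zvec \<Longrightarrow> u = zvec \<and> w = zvec"
    and "dependent_pair u0 w0 \<Longrightarrow> dependent_pair u w"
    and "Bil l u u * Bil l w w = Bil l u0 u0 * Bil l w0 w0"
    and "\<exists>r s. Bil l w w = r^2 * Bil l u0 u0 + s^2 * Bil l w0 w0"
proof -
  obtain h p q r s where h: "h \<in> Eops 3 l" "p * s - q * r = 1" "u = h (lin p u0 q w0)" "w = h (lin r u0 s w0)"
    using reach_matrix[OF r] by blast
  have B: "Bil l (h v) (h v') = Bil l v v'" for v v' by (rule Bil_Eops[OF h(1)]) simp
  show "u = zvec \<and> w = zvec" if "u0 = zvec \<and> w0 = zvec"
    using that Eops_zero[OF h(1)] unfolding h by (simp add: zvec_def lin_def)
  show "dependent_pair u w" if "dependent_pair u0 w0"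
  proof -
    obtain a b where ab: "a \<noteq> 0 \<or> b \<noteq> 0" "lin a u0 b w0 = zvec" using \<open>dependent_pair u0 w0\<close> by (auto simp: dependent_pair_def)
    define x y where "x = a * s - b * r" and "y = b * p - a * q"
    have "x * p + y * r = a * (p * s - q * r)" "x * q + y * s = b * (p * s - q * r)"
      by (simp_all add: x_def y_def algebra_simps)
    then have e: "x * p + y * r = a" "x * q + y * s = b" using h(2) by simp_all
    have "lin x u y w = h (lin a u0 b w0)"
      unfolding h(3,4) Eops_lin[OF h(1), symmetric] lin_lin e ..
    then have "lin x u y w = zvec" using ab Eops_zero[OF h(1)] by (simp add: zvec_def)
    moreover have "x \<noteq> 0 \<or> y \<noteq> 0" using e ab by auto
    ultimately show ?thesis by (auto simp: dependent_pair_def)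
  qed
  define A C where "A = Bil l u0 u0" and "C = Bil l w0 w0"
  have u: "Bil l u u = p^2 * A + q^2 * C" and w: "Bil l w w = r^2 * A + s^2 * C" and uw: "p * r * A + q * s * C = 0"
    using orth unfolding h(3,4) B Bil_lin A_def C_def by (simp_all add: power2_eq_square)
  \<comment> \<open>Lagrange's identity; the last square is that of Bil(u, w), which
    vanishes.\<close>
  have "Bil l u u * Bil l w w = (p * s - q * r)^2 * (A * C) + (p * r * A + q * s * C)^2"
    unfolding u w by (simp add: power2_eq_square algebra_simps)
  then show "Bil l u u * Bil l w w = Bil l u0 u0 * Bil l w0 w0" unfolding uw h(2) by (simp add: A_def C_def)
  show "\<exists>r s. Bil l w w = r^2 * Bil l u0 u0 + s^2 * Bil l w0 w0" using w unfolding A_def C_def by blast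
qed

text \<open>Vanishing, dependence and the Gram determinant reduce the problem to equal types, and in
  the dark case to equal k. The parameter is then settled by the represented value: up to squares in
  rank 1, up to the norm form in rank 2.\<close>

theorem pair_type_unique:
  fixes t t' :: "'k::field orbit_type"
  assumes l: "l > 4" and two: "(2::'k) \<noteq> 0"
    and S: "representatives units_of_field square_rel S"
    and R: "\<And>k. k \<in> units_of_field \<Longrightarrow> representatives units_of_field (norm_rel k) (R k)"
    and t: "t \<in> orbit_types S R" "t' \<in> orbit_types S R"
    and r: "reach l (pair_u t) (pair_w t) (pair_u t') (pair_w t')" "reach l (pair_u t') (pair_w t') (pair_u t) (pair_w t)"
  shows "t = t'"
proof -
  note o = Bil_pair[OF l]
  have zero: "t = Zero \<longleftrightarrow> t' = Zero"
    using reach_invariants(1)[OF r(1) o o] reach_invariants(1)[OF r(2) o o] unfolding zero_pair_type by blast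
  have "dependent_pair (pair_u t) (pair_w t) \<longleftrightarrow> dependent_pair (pair_u t') (pair_w t')"
    using reach_invariants(2)[OF r(1) o o] reach_invariants(2)[OF r(2) o o] by blast
  note dep = this[unfolded dependent_pair_type]
  note B = Bil_pair_u[OF l] Bil_pair_w[OF l]
  note disc = reach_invariants(3)[OF r(1) o o, unfolded B]
  note w1 = reach_invariants(4)[OF r(1) o o, unfolded B] and w2 = reach_invariants(4)[OF r(2) o o, unfolded B]
  have Snz: "a \<noteq> 0" if "a \<in> S" for a using S that by (auto simp: representatives_def units_of_field_def)
  have Rnz: "a \<noteq> 0" if "a \<in> R k" "k \<noteq> 0" for a k
    using R[of k] that by (auto simp: representatives_def units_of_field_def)
  have tS: "a \<in> S" if "Brilliant_a a \<in> orbit_types S R \<or> Luminous a \<in> orbit_types S R" for a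
    using that by (auto simp: orbit_types_def)
  have tR: "k \<noteq> 0 \<and> a \<in> R k \<and> a \<noteq> 0" if "Dark k a \<in> orbit_types S R" for a k
    using that Rnz by (auto simp: orbit_types_def units_of_field_def)
  have sq: "a = a'" if "a \<in> S" "a' \<in> S" "2 * a' = s^2 * (2 * a)" for a a' s :: 'k
  proof -
    have "2 * a' = 2 * (a * s^2)" using that(3) by (simp add: mult_ac)
    then have "a' = a * s^2" using two mult_cancel_left[of 2 a' "a * s^2"] by simp
    moreover from this have "s \<noteq> 0" using Snz that by force
    ultimately have "(a', a) \<in> square_rel" using Snz that by (auto simp: square_rel_def units_of_field_def)
    then show ?thesis using representative_unique[OF equiv_square_rel S] that by metis
  qed
  have pf: "(2::'k) * 2 \<noteq> 0" by (rule no_zero_divisors[OF two two])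
  then have four: "(4::'k) \<noteq> 0" by simp
  have dark: "k = k' \<and> a = a'" if "Dark k a \<in> orbit_types S R" "Dark k' a' \<in> orbit_types S R"
    "- (2 * (k' / a')) * (2 * a') = - (2 * (k / a)) * (2 * a)"
    "2 * a' = r^2 * (- (2 * (k / a))) + s^2 * (2 * a)" for k a k' a' r s
  proof -
    note n = tR[OF that(1)] tR[OF that(2)]
    have "(2 * 2) * k' = (2 * 2) * k" using that(3) n by (simp add: field_simps)
    then have k: "k' = k" using pf mult_cancel_left by blast
    \<comment> \<open>Multiplication by a turns the value s^2 a - r^2 k / a into the norm (s a)^2 -
      k r^2.\<close>
    have "2 * (a * a') = a * (2 * a')" by simp
    also have "\<dots> = 2 * ((s * a)^2 - k * r^2)" unfolding that(4) using n by (simp add: field_simps power2_eq_square)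
    finally have "a * a' = (s * a)^2 - k * r^2" using two unfolding mult_cancel_left by blast
    then have "(a, a') \<in> norm_rel k" using n unfolding norm_rel_def units_of_field_def by (auto intro: exI[of _ "s * a"])
    then show ?thesis using representative_unique[OF equiv_norm_rel R[of k]] n k by (auto simp: units_of_field_def)
  qed
  show ?thesis
  proof (cases t)
    case Zero then show ?thesis using zero by simp
  next
    case Singular
    then show ?thesis using zero dep w1 t Snz[OF tS] two by (cases t') auto
  next
    case T: (Brilliant_a a)
    show ?thesis
    proof (cases t')
      case T': (Brilliant_a a')
      obtain s where "2 * a' = s^2 * (2 * a)" using w1 T T' by auto
      then have "a = a'" using sq[of a a' s] tS[of a] tS[of a'] t T T' by simp
      then show ?thesis using T T' by simp
    qed (use T zero dep w1 w2 t Snz[OF tS] tR two four in auto)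
  next
    case Brilliant_b
    then show ?thesis using zero dep disc w1 t Snz[OF tS] tR two four by (cases t') auto
  next
    case T: (Luminous a)
    show ?thesis
    proof (cases t')
      case T': (Luminous a')
      obtain s where "2 * a' = s^2 * (2 * a)" using w1 T T' by auto
      then have "a = a'" using sq[of a a' s] tS[of a] tS[of a'] t T T' by simp
      then show ?thesis using T T' by simp
    qed (use T zero dep disc w1 w2 t Snz[OF tS] tR two four in auto)
  next
    case T: (Dark k a)
    show ?thesis
    proof (cases t')
      case T': (Dark k' a')
      obtain r s where "2 * a' = r^2 * (- (2 * (k / a))) + s^2 * (2 * a)"
        using w1 unfolding T T' orbit_type.case by blast
      moreover have "- (2 * (k' / a')) * (2 * a') = - (2 * (k / a)) * (2 * a)"
        using disc unfolding T T' orbit_type.case .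
      ultimately show ?thesis using dark[of k a k' a'] t unfolding T T' by blast
    qed (use T zero dep disc t Snz[OF tS] tR two four in auto)
  qed
qed

section \<open>Bivectors\<close>

text \<open>The Lie algebra as the space of bivectors \<open>\<Lambda>\<^sup>2 V\<close> of the natural module \<open>V\<close>, on which \<open>x\<^bsub>rt i j\<^esub>\<close>
  acts as the tensor square of an isometry of \<open>V\<close>. The entries at \<open>(p, - p)\<close> hold the Cartan part.\<close>

definition Psi :: "nat \<Rightarrow> 'a::comm_ring_1 vec \<Rightarrow> int \<Rightarrow> int \<Rightarrow> 'a" where
  "Psi l y p q = (if p \<in> idx 1 l \<and> q \<in> idx 1 l then
     (if q = - p then Hc l y p else if q = p then 0 else of_int (sg p q) * y (Root (rt p q))) else 0)"

definition wedge :: "'a::comm_ring_1 nvec \<Rightarrow> 'a nvec \<Rightarrow> int \<Rightarrow> int \<Rightarrow> 'a" where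
  "wedge a b = (\<lambda>p q. a p * b q - b p * a q)"

definition tens :: "('a nvec \<Rightarrow> 'a nvec) \<Rightarrow> (int \<Rightarrow> int \<Rightarrow> 'a) \<Rightarrow> int \<Rightarrow> int \<Rightarrow> 'a" where
  "tens h T = (\<lambda>p q. h (\<lambda>p'. h (T p') q) p)"

text \<open>The derivative of \<open>tens (opv i j c)\<close> at c = 0, that is, the action of a
  root vector on the tensor square.\<close>

definition dv :: "int \<Rightarrow> int \<Rightarrow> (int \<Rightarrow> int \<Rightarrow> 'a::comm_ring_1) \<Rightarrow> int \<Rightarrow> int \<Rightarrow> 'a" where
  "dv i j Y p q = (if p = i then Y (- j) q else if p = j then - Y (- i) q else 0)
     + (if q = i then Y p (- j) else if q = j then - Y p (- i) else 0)"

lemma Psi_valid: "valid l p q \<Longrightarrow> Psi l y p q = of_int (sg p q) * y (Root (rt p q))"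
  using valid_ne[of l p q] by (auto simp: Psi_def valid_def)

lemma Psi_opp: "p \<in> idx 1 l \<Longrightarrow> Psi l y p (- p) = Hc l y p"
  by (simp add: Psi_def)

lemma Psi_diag: "p \<in> idx 1 l \<Longrightarrow> Psi l y p p = 0"
  by (auto simp: Psi_def idx_def)

lemma Psi_outside: "p \<notin> idx 1 l \<or> q \<notin> idx 1 l \<Longrightarrow> Psi l y p q = 0"
  by (auto simp: Psi_def)

lemma idx_pair_cases:
  assumes "p \<in> idx 1 l" "q \<in> idx 1 l" obtains "q = - p" | "q = p" | "valid l p q"
  using assms unfolding valid_def by (metis abs_eq_iff)

lemma Psi_skew: "Psi l y q p = - Psi l y p q"
proof (cases "p \<in> idx 1 l \<and> q \<in> idx 1 l")
  case True
  then have i: "p \<in> idx 1 l" "q \<in> idx 1 l" by auto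
  then show ?thesis
  proof (cases rule: idx_pair_cases)
    case 1
    have "p \<noteq> 0" using i by (auto simp: idx_def)
    then show ?thesis using 1 Psi_opp[OF i(1), of y] Psi_opp[OF i(2), of y] by (simp add: Hc_neg)
  next
    case 2 then show ?thesis using i by (simp add: Psi_diag)
  next
    case 3
    then show ?thesis using Psi_valid[of l q p y] by (simp add: Psi_valid valid_sym sg_swap[of q p] rt_sym[of q p])
  qed
qed (auto simp: Psi_outside)

lemma Psi_add: "Psi l (x + y) p q = Psi l x p q + Psi l y p q"
  by (simp add: Psi_def Hc_def sum.distrib algebra_simps)

lemma Psi_smult: "Psi l (c *\<^sub>v x) p q = c * Psi l x p q"
  by (simp add: Psi_def Hc_def smult_vec_def sum_distrib_left algebra_simps)

lemma dv_swap: "i \<noteq> j \<Longrightarrow> dv j i Y p q = - dv i j Y p q"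
  by (auto simp: dv_def)

lemma dv_skew:
  assumes "\<And>p q. Y q p = - Y p q" shows "dv i j Y q p = - dv i j Y p q"
proof -
  have "Y p (- i) = - Y (- i) p" "Y p (- j) = - Y (- j) p" "Y q (- i) = - Y (- i) q" "Y q (- j) = - Y (- j) q"
    by (rule assms)+
  note e = this
  show ?thesis unfolding dv_def e by simp
qed

lemma sg_sq_valid: "valid l p q \<Longrightarrow> of_int (sg p q) * (of_int (sg p q) * x) = (x :: 'a::comm_ring_1)"
  using sg_sq[of p q] valid_ne[of l p q] by (metis mult.assoc mult_1 of_int_1 of_int_mult)

section \<open>Elementary root elements as tensor squares of isometries\<close>

lemma elem_root_alt:
  fixes y :: "'k::field vec"
  shows "elem_root l N \<alpha> c y = y + (c *\<^sub>v bracket l N (root_vec \<alpha>) y 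
     + (c^2 / 2) *\<^sub>v bracket l N (root_vec \<alpha>) (bracket l N (root_vec \<alpha>) y))"
proof -
  have "{..2::nat} = {0, 1, 2}" by auto
  then show ?thesis unfolding elem_root_def
    by (simp add: numeral_2_eq_2 smult_vec_def plus_fun_def fun_eq_iff add.assoc)
qed

lemma bracket_in_space: "\<alpha> \<in> roots l \<Longrightarrow> bracket l N (root_vec \<alpha>) y \<in> lie_space l"
  unfolding lie_space_def basis_indices_def
proof (intro CollectI allI impI)
  fix b assume a: "\<alpha> \<in> roots l" and b: "b \<notin> Root ` roots l \<union> Cartan ` {1..l}"
  show "bracket l N (root_vec \<alpha>) y b = 0"
  proof (cases b)
    case (Root \<gamma>)
    then have "\<gamma> \<notin> roots l" using b by auto
    then show ?thesis using a Root by (simp add: bracket_not_root)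
  next
    case (Cartan k)
    then have "k \<notin> {1..l}" using b by blast
    then show ?thesis using a Cartan by (auto simp: bracket_Cartan)
  qed
qed

lemma smult_space: "x \<in> lie_space l \<Longrightarrow> c *\<^sub>v x \<in> lie_space l"
  by (auto simp: lie_space_def smult_vec_def)

lemma elem_root_space: "\<alpha> \<in> roots l \<Longrightarrow> y \<in> lie_space l \<Longrightarrow> elem_root l N \<alpha> c y \<in> lie_space l"
  unfolding elem_root_alt by (intro add_space smult_space bracket_in_space)

text \<open>Root coordinates are recovered up to a sign, Cartan coordinates from their eigenvalues
  on the weights; the latter requires 2 to be nonzero, by \<open>comb_zero\<close>.\<close>

lemma Psi_inject:
  fixes y y' :: "'k::field vec"
  assumes l: "l > 4" and two: "(2::'k) \<noteq> 0" and y: "y \<in> lie_space l" "y' \<in> lie_space l" and e: "\<And>p q. p \<in> idx 1 l \<Longrightarrow> q \<in> idx 1 l \<Longrightarrow> Psi l y p q = Psi l y' p q"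
  shows "y = y'"
proof
  fix b
  show "y b = y' b"
  proof (cases "b \<in> basis_indices l")
    case False then show ?thesis using y by (auto simp: lie_space_def)
  next
    case True
    then consider \<alpha> where "b = Root \<alpha>" "\<alpha> \<in> roots l" | k where "b = Cartan k" "k \<in> {1..l}" by (auto simp: basis_indices_def)
    then show ?thesis
    proof cases
      case 1
      then obtain p q where v: "valid l p q" "\<alpha> = rt p q" by (auto elim: root_cases)
      have "of_int (sg p q) * y (Root (rt p q)) = of_int (sg p q) * y' (Root (rt p q))"
        using e[of p q] v unfolding Psi_valid[OF v(1), symmetric] by (simp add: valid_def)
      then show ?thesis using sg_sq_valid[OF v(1)] 1 v by metis
    next
      case 2
      have "y (Cartan k) - y' (Cartan k) = 0"
      proof (rule comb_zero[OF l two _ 2(2), where c = "\<lambda>k. y (Cartan k) - y' (Cartan k)"])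
        fix p assume "p \<in> {1..l}"
        then have p: "int p \<in> idx 1 l" "p > 0" by (auto simp: idx_def)
        have "Hc l y (int p) = Hc l y' (int p)" using e[of "int p" "- int p"] p by (simp add: Psi_opp)
        then show "(\<Sum>k=1..l. (y (Cartan k) - y' (Cartan k)) * of_int (simple_root l k p)) = 0"
          using p by (simp add: Hc_def ev_def left_diff_distrib sum_subtractf)
      qed
      then show ?thesis using 2 by simp
    qed
  qed
qed

lemma Psi_root_vec:
  assumes ij: "valid l i j"
  shows "Psi l (root_vec (rt i j)) p q = of_int (sg i j) * wedge (unit_vec i) (unit_vec j) p q"
proof (cases "p \<in> idx 1 l \<and> q \<in> idx 1 l")
  case False
  moreover have "p \<noteq> i" "p \<noteq> j" if "p \<notin> idx 1 l" for p using ij that by (auto simp: valid_def)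
  ultimately show ?thesis by (auto simp: Psi_outside wedge_def unit_vec_def)
next
  case True
  then have pq: "p \<in> idx 1 l" "q \<in> idx 1 l" by auto
  note ne = valid_ne[OF ij]
  from pq show ?thesis
  proof (cases rule: idx_pair_cases)
    case 1
    then show ?thesis using ne by (auto simp: Psi_opp[OF pq(1)] Hc_def basis_vec_def wedge_def unit_vec_def)
  next
    case 2
    then show ?thesis by (auto simp: Psi_diag[OF pq(1)] wedge_def)
  next
    case 3
    then show ?thesis using ne valid_ne[OF 3]
      by (auto simp: Psi_valid basis_vec_def rt_eq_iff[OF 3 ij] wedge_def unit_vec_def sg_swap[of j i])
  qed
qed

context
  fixes l :: nat and N :: "root \<Rightarrow> root \<Rightarrow> int"
  assumes l: "l > 4" and chev: "chevalley_constants l N" and pos: "positive_constants l N"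
begin

text \<open>For q = j the entry of the bracket comes from the Cartan part, for q = - j both sides
  vanish, and in the remaining case the computed structure constants enter.\<close>

lemma Psi_bracket_row:
  fixes y :: "'a::comm_ring_1 vec"
  assumes ij: "valid l i j" and iq: "valid l i q"
  shows "Psi l (bracket l N (root_vec (rt i j)) y) i q = of_int (sg i j) * dv i j (Psi l y) i q"
proof -
  note ne = valid_ne[OF ij] valid_ne[OF iq]
  have r: "rt i j \<in> roots l" "rt i q \<in> roots l" using ij iq by (auto intro: rt_roots)
  have inn: "inner_prod l (rt i q) (rt i j) = 1 + kd j q"
    unfolding inner_rt_rt[OF ij] using ij iq by (simp add: kd_valid[of l] valid_sym) (simp add: kd_def)
  have P: "Psi l (bracket l N (root_vec (rt i j)) y) i q = of_int (sg i q) * bracket l N (root_vec (rt i j)) y (Root (rt i q))"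
    by (rule Psi_valid[OF iq])
  have diff: "rt i q - rt i j = rt (- j) q" using ne by (simp add: rt_def wt_neg)
  consider "q = j" | "q = - j" | "valid l j q"
    using ij iq unfolding valid_def by (metis abs_eq_iff)
  then show ?thesis
  proof cases
    case 1
    have idx: "i \<in> idx 1 l" "j \<in> idx 1 l" "- j \<in> idx 1 l" "- i \<in> idx 1 l" using ij by (auto simp: valid_def)
    have "rt i q - rt i j \<notin> roots l" using root_diff_iff[OF r(2,1)] inn 1 by (simp add: kd_def)
    then have b: "bracket l N (root_vec (rt i j)) y (Root (rt i q)) = - (Hc l y i + Hc l y j)"
      unfolding 1 bracket_Root[OF r(1) r(1)] cartan_sum[OF l ij] by (simp add: zero_not_root)
    have "dv i j (Psi l y) i q = Psi l y (- j) (- (- j)) - Psi l y i (- i)" using 1 ne by (simp add: dv_def)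
    also have "\<dots> = - Hc l y j - Hc l y i" unfolding Psi_opp[OF idx(3)] Psi_opp[OF idx(1)] using ne by (simp add: Hc_neg)
    finally have d: "dv i j (Psi l y) i q = - Hc l y j - Hc l y i" .
    show ?thesis unfolding P b d using 1 by (simp add: algebra_simps)
  next
    case 2
    have "rt i q - rt i j \<notin> roots l" using root_diff_iff[OF r(2,1)] inn 2 ne by (simp add: kd_def)
    moreover have "rt i q \<noteq> rt i j" using rt_eq_iff[OF iq ij] 2 ne by auto
    moreover have "dv i j (Psi l y) i q = 0" using 2 ne ij Psi_diag[of "- j" l y] by (auto simp: dv_def valid_def)
    ultimately show ?thesis unfolding P by (simp add: bracket_Root[OF r])
  next
    case 3
    have v3: "valid3 l i j q" using ij iq 3 by (simp add: valid3_def)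
    have "rt i q - rt i j \<in> roots l" using root_diff_iff[OF r(2,1)] inn 3 by (simp add: kd_valid)
    moreover have "rt i q \<noteq> rt i j" using rt_eq_iff[OF iq ij] valid_ne[OF 3] by auto
    ultimately have b: "bracket l N (root_vec (rt i j)) y (Root (rt i q)) 
       = of_int (sg i j * sg (- j) q * sg i q) * y (Root (rt (- j) q))"
      by (simp add: bracket_Root[OF r] diff structure_constants[OF l chev pos v3])
    have vjq: "valid l (- j) q" using 3 by simp
    have "dv i j (Psi l y) i q = of_int (sg (- j) q) * y (Root (rt (- j) q))"
      using ne valid_ne[OF 3] Psi_valid[OF vjq, of y] by (simp add: dv_def)
    then show ?thesis unfolding P b using sg_sq_valid[OF iq, of "of_int (sg i j) * (of_int (sg (- j) q) * y (Root (rt (- j) q)))"]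
      by (simp add: mult_ac)
  qed
qed

text \<open>Skew symmetry reduces the columns i, j to the rows i, j. The entries (p, - p) receive
  the multiple of h_alpha; all other entries are zero on both sides.\<close>

lemma Psi_bracket:
  fixes y :: "'a::comm_ring_1 vec"
  assumes ij: "valid l i j"
  shows "Psi l (bracket l N (root_vec (rt i j)) y) p q = of_int (sg i j) * dv i j (Psi l y) p q"
proof -
  note ne = valid_ne[OF ij]
  have r: "rt i j \<in> roots l" "- rt i j \<in> roots l" using ij rt_roots root_neg by blast+
  have row: "Psi l (bracket l N (root_vec (rt i j)) y) p q = of_int (sg i j) * dv i j (Psi l y) p q"
    if v: "valid l p q" and p: "p = i \<or> p = j" for p q
    using p
  proof
    assume "p = i" then show ?thesis using Psi_bracket_row[OF ij] v by simp
  next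
    assume "p = j"
    then show ?thesis using Psi_bracket_row[of j i q y] ij v ne dv_swap[of i j "Psi l y"]
      by (simp add: valid_sym rt_sym[of j i] sg_swap[of j i])
  qed
  show ?thesis
  proof (cases "p \<in> idx 1 l \<and> q \<in> idx 1 l")
    case False
    moreover have "p \<noteq> i" "p \<noteq> j" if "p \<notin> idx 1 l" for p using ij that by (auto simp: valid_def)
    ultimately show ?thesis by (auto simp: Psi_outside dv_def)
  next
    case True
    then have pq: "p \<in> idx 1 l" "q \<in> idx 1 l" by auto
    then show ?thesis
    proof (cases rule: idx_pair_cases)
      case 1
      have pnz: "p \<noteq> 0" using pq by (auto simp: idx_def)
      have H: "Hc l (bracket l N (root_vec (rt i j)) y) p = of_int (ev (rt i j) p) * y (Root (- rt i j))"
        by (rule Hc_Cartan_part[OF l r(1)]) (simp add: bracket_Cartan[OF r(1)])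
      have vn: "valid l (- j) (- i)" "valid l (- i) (- j)" using ij by (simp_all add: valid_sym)
      have Y: "Psi l y (- j) (- i) = of_int (sg i j) * y (Root (- rt i j))"
        "Psi l y (- i) (- j) = - (of_int (sg i j) * y (Root (- rt i j)))"
        unfolding Psi_valid[OF vn(1)] Psi_valid[OF vn(2)] rt_neg[OF ij]
        by (simp_all add: sg_neg rt_sym[of "- j"] sg_swap[of j i])
      have "of_int (ev (rt i j) p) * y (Root (- rt i j)) = of_int (sg i j) * dv i j (Psi l y) p (- p)"
        using ne pnz sg_sq_valid[OF ij, of "y (Root (- rt i j))"]
        by (auto simp: ev_rt kd_def dv_def Y minus_equation_iff)
      then show ?thesis using 1 H by (simp add: Psi_opp[OF pq(1)])
    next
      case 2
      then show ?thesis using ne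
        by (auto simp: Psi_diag[OF pq(1)] dv_def Psi_skew[of l y "- j"] Psi_skew[of l y "- i"])
    next
      case 3
      consider "p = i \<or> p = j" | "q = i \<or> q = j" | "p \<noteq> i" "p \<noteq> j" "q \<noteq> i" "q \<noteq> j" by blast
      then show ?thesis
      proof cases
        case 1 then show ?thesis using row[OF 3] by simp
      next
        case 2
        have "valid l q p" using 3 by (simp add: valid_sym)
        have sk: "dv i j (Psi l y) q p = - dv i j (Psi l y) p q" by (rule dv_skew[OF Psi_skew])
        from row[OF \<open>valid l q p\<close> 2] show ?thesis
          using Psi_skew[of l "bracket l N (root_vec (rt i j)) y" p q] sk by simp
      next
        case 4: 3
        have "kd i p \<le> 0" "kd i q \<le> 0" "kd j p \<le> 0" "kd j q \<le> 0" using 4 by (auto simp: kd_def)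
        then have "inner_prod l (rt p q) (rt i j) \<noteq> 1" unfolding inner_rt_rt[OF ij] by linarith
        then have "rt p q - rt i j \<notin> roots l" using root_diff_iff[OF rt_roots[OF 3] r(1)] by simp
        moreover have "rt p q \<noteq> rt i j" using rt_eq_iff[OF 3 ij] 4 by auto
        ultimately show ?thesis unfolding Psi_valid[OF 3] using 4 by (simp add: bracket_Root[OF r(1) rt_roots[OF 3]] dv_def)
      qed
    qed
  qed
qed

text \<open>Write \<open>opv\<close> as 1 + d n. Then n^2 = 0, so the square of \<open>dv\<close> is
  twice n tensor n, and the quadratic exponential is exactly the tensor square of 1 + d n.\<close>

lemma Psi_elem_root:
  fixes y :: "'k::field vec"
  assumes ij: "valid l i j" and two: "(2::'k) \<noteq> 0"
  shows "Psi l (elem_root l N (rt i j) c y) = tens (opv i j (of_int (sg i j) * c)) (Psi l y)"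
proof (intro ext)
  fix p q
  note ne = valid_ne[OF ij]
  define d where "d = of_int (sg i j) * c"
  have dd: "d * d = c^2" using sg_sq_valid[OF ij, of "c * c"] by (simp add: d_def power2_eq_square mult_ac)
  define Y where "Y = Psi l y"
  have lin: "dv i j (\<lambda>p q. of_int (sg i j) * dv i j Y p q) p q = of_int (sg i j) * dv i j (dv i j Y) p q"
    by (simp add: dv_def algebra_simps)
  have 1: "Psi l (bracket l N (root_vec (rt i j)) y) = (\<lambda>p q. of_int (sg i j) * dv i j Y p q)"
    by (simp add: Psi_bracket[OF ij] fun_eq_iff Y_def)
  have 2: "Psi l (bracket l N (root_vec (rt i j)) (bracket l N (root_vec (rt i j)) y)) p q = dv i j (dv i j Y) p q"
    unfolding Psi_bracket[OF ij, of "bracket l N (root_vec (rt i j)) y"] 1 lin by (rule sg_sq_valid[OF ij])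
  have E: "tens (opv i j d) Y p q = Y p q + (d * dv i j Y p q + (c^2 / 2) * dv i j (dv i j Y) p q)"
    using ne two unfolding dd[symmetric]
    by (auto simp: tens_def opv_def dv_def algebra_simps)
  show "Psi l (elem_root l N (rt i j) c y) p q = tens (opv i j (of_int (sg i j) * c)) (Psi l y) p q"
    unfolding elem_root_alt Psi_add Psi_smult 1 2 E[unfolded d_def Y_def] Y_def by (simp add: mult_ac)
qed

end

lemma tens_wedge:
  assumes "\<And>a v b w. h (\<lambda>p. a * v p + b * w p) = (\<lambda>p. a * h v p + b * h w p)"
  shows "tens h (wedge a b) = wedge (h a) (h b)"
proof (intro ext)
  fix p q
  have 1: "h (wedge a b p') q = a p' * h b q + (- b p') * h a q" for p'
    using assms[of "a p'" b "- b p'" a] by (simp add: wedge_def fun_eq_iff)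
  have "tens h (wedge a b) p q = h (\<lambda>p'. h b q * a p' + (- h a q) * b p') p"
    unfolding tens_def 1 by (simp add: mult.commute)
  then show "tens h (wedge a b) p q = wedge (h a) (h b) p q" unfolding assms by (simp add: wedge_def algebra_simps)
qed

section \<open>The action on the first layer\<close>

lemma two_neq_zero: "CHAR('k::field) \<noteq> 2 \<Longrightarrow> (2::'k) \<noteq> 0"
proof
  assume c: "CHAR('k) \<noteq> 2" and "(2::'k) = 0"
  then have "of_nat 2 = (0::'k)" by simp
  then have "CHAR('k) dvd 2" by (simp only: of_nat_eq_0_iff_char_dvd)
  then have "CHAR('k) = 1 \<or> CHAR('k) = 2" using two_is_prime_nat unfolding prime_nat_iff by blast
  then show False using c by simp
qed

text \<open>From node 3 on, the coefficient counts which of p, q are at most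
  \<open>l + 1 - k\<close>. The bound q < l makes the last coordinate zero, so both end nodes carry
  coefficient 1.\<close>

lemma root_comb_positive_root:
  assumes l: "l > 4" and p: "0 < p" "p < q" "q < int l"
    and m: "m 1 = 1" "m 2 = 1" "\<And>k. k \<in> {3..l} \<Longrightarrow> m k = (if int k \<le> int l + 1 - q then 2 else if int k \<le> int l + 1 - p then 1 else 0)"
  shows "root_comb l m = rt p q"
proof -
  have v: "valid l p q" using p by (auto simp: valid_def idx_def)
  have S: "(\<Sum>i=1..n. rt p q i) = (if q \<le> int n then 2 else if p \<le> int n then 1 else 0)" for n
    unfolding sum_rt[OF v] using p by auto
  have z: "rt p q l = 0" using p by (simp add: rt_apply kd_eq_simps(2)[THEN iffD2])
  have "m k = solve_coeffs l (rt p q) k" if k: "k \<in> {1..l}" for k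
  proof -
    consider "k = 1" | "k = 2" | "k \<in> {3..l}" using k by force
    then show ?thesis
    proof cases
      case 1 then show ?thesis using m(1) p by (simp add: solve_coeffs_def S[unfolded One_nat_def])
    next
      case 2 then show ?thesis using m(2) p z by (simp add: solve_coeffs_def S[unfolded One_nat_def])
    next
      case 3
      then have "int (l + 1 - k) = int l + 1 - int k" by auto
      then have "solve_coeffs l (rt p q) k = (if q \<le> int l + 1 - int k then 2 else if p \<le> int l + 1 - int k then 1 else 0)"
        using 3 S[of "l + 1 - k"] unfolding solve_coeffs_def by auto
      then show ?thesis using m(3)[OF 3] by simp
    qed
  qed
  then have "root_comb l m = root_comb l (solve_coeffs l (rt p q))"
    unfolding root_comb_def by (intro ext sum.cong) auto
  then show ?thesis using root_coeffs_spec[OF l rt_roots[OF v]] by simp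
qed

lemma root_delta_rt: "l > 4 \<Longrightarrow> root_delta l = rt 1 2"
  unfolding root_delta_def by (rule root_comb_positive_root) auto

lemma root_rho_rt: "l > 4 \<Longrightarrow> root_rho l = rt 2 3"
  unfolding root_rho_def by (rule root_comb_positive_root) auto

lemma root_tau_rt: "l > 4 \<Longrightarrow> root_tau l = rt 1 4"
  unfolding root_tau_def by (rule root_comb_positive_root) auto

lemma root_lambda_rt:
  assumes "l > 4" shows "root_lambda l = rt 2 (- 3)"
proof -
  have "l - 1 \<in> {1..l}" "l - 1 \<noteq> 1" "l + 1 - (l - 1) = 2" "l + 2 - (l - 1) = 3" using assms by auto
  then show ?thesis using simple_root_rt(1)[of "l - 1" l] assms by (simp add: root_lambda_def)
qed

lemma root_sigma_rt:
  assumes "l > 4" shows "root_sigma l = rt 1 (- 4)"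
proof -
  have m: "l - 2 \<in> {1..l}" "l - 2 \<noteq> 1" "l + 1 - (l - 2) = 3" "l + 2 - (l - 2) = 4" 
     "l \<in> {1..l}" "l \<noteq> 1" "l + 1 - l = 1" "l + 2 - l = 2" using assms by auto
  have "simple_root l (l - 2) = rt 3 (- 4)" "simple_root l l = rt 1 (- 2)"
    using simple_root_rt(1)[OF m(1) assms, unfolded if_not_P[OF m(2)] m(3,4)]
      simple_root_rt(1)[OF m(5) assms, unfolded if_not_P[OF m(6)] m(7,8)] by simp_all
  then show ?thesis using root_lambda_rt[OF assms] unfolding root_sigma_def root_lambda_def
    by (simp add: rt_def wt_neg)
qed

text \<open>The degree of a weight in the grading defined by \<delta> = eps_1 + eps_2; the roots of
  degree 0 and 1 are those of \<open>roots0\<close> and \<open>roots1\<close>.\<close>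

definition hgt :: "int \<Rightarrow> int" where
  "hgt p = kd 1 p + kd 2 p"

lemma hgt_cases:
  assumes "p \<in> idx 1 l"
  obtains "p \<in> {1, 2}" "hgt p = 1" | "p \<in> {- 1, - 2}" "hgt p = - 1" | "p \<in> idx 3 l" "hgt p = 0"
proof -
  have "p = 1 \<or> p = 2 \<or> p = - 1 \<or> p = - 2 \<or> p \<in> idx 3 l" using assms by (auto simp: idx_def)
  then show ?thesis using that
  proof (elim disjE)
    assume "p \<in> idx 3 l"
    then have "hgt p = 0" by (auto simp: hgt_def idx_def kd_def)
    then show ?thesis using that(3) \<open>p \<in> idx 3 l\<close> by blast
  qed (auto simp: hgt_def kd_def)
qed

lemma valid_12: "l > 4 \<Longrightarrow> valid l 1 2"
  by (auto simp: valid_def idx_def)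

lemma inner_delta: "l > 4 \<Longrightarrow> inner_prod l (rt p q) (root_delta l) = hgt p + hgt q"
  unfolding root_delta_rt by (simp add: inner_rt_rt[OF valid_12] hgt_def)

lemma inner_bounds:
  assumes "\<alpha> \<in> roots l" "\<beta> \<in> roots l" shows "\<bar>inner_prod l \<alpha> \<beta>\<bar> \<le> 2"
proof -
  obtain p q i j where v: "valid l p q" "\<beta> = rt p q" "valid l i j" "\<alpha> = rt i j" using assms by (metis root_cases)
  have "kd p x + kd q x \<le> 1" for x by (rule kd_sum(1)[OF v(1)])
  moreover have "- (kd p x + kd q x) \<le> 1" for x
    using kd_sum(1)[of l "- p" "- q" x] v(1) kd_neg(1)[of p x] kd_neg(1)[of q x] valid_nz[OF v(1)] by simp
  ultimately show ?thesis unfolding v inner_rt_rt[OF v(1)] 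
    by (smt (verit, ccfv_threshold))
qed

lemma root_angle_eq:
  assumes "\<alpha> \<in> roots l" "\<beta> \<in> roots l"
  shows "root_angle l \<alpha> \<beta> = arccos (real_of_int (inner_prod l \<alpha> \<beta>) / 2)"
  by (simp add: root_angle_def inner_self assms)

lemma cos_root_angle:
  assumes "\<alpha> \<in> roots l" "\<beta> \<in> roots l"
  shows "2 * cos (root_angle l \<alpha> \<beta>) = inner_prod l \<alpha> \<beta>"
proof -
  have "\<bar>real_of_int (inner_prod l \<alpha> \<beta>) / 2\<bar> \<le> 1" using inner_bounds[OF assms] by linarith
  then show ?thesis unfolding root_angle_eq[OF assms] by (simp add: cos_arccos_abs)
qed

lemma roots1_roots: "\<alpha> \<in> roots1 l \<Longrightarrow> \<alpha> \<in> roots l"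
  by (simp add: roots1_def)

lemma roots1_inner:
  assumes "l > 4" "\<alpha> \<in> roots l"
  shows "\<alpha> \<in> roots1 l \<longleftrightarrow> inner_prod l \<alpha> (root_delta l) = 1"
proof -
  have d: "root_delta l \<in> roots l" unfolding root_delta_rt[OF assms(1)] by (rule rt_roots[OF valid_12[OF assms(1)]])
  have c: "2 * cos (root_angle l \<alpha> (root_delta l)) = inner_prod l \<alpha> (root_delta l)" by (rule cos_root_angle[OF assms(2) d])
  show ?thesis
  proof
    assume "\<alpha> \<in> roots1 l"
    then have ang: "root_angle l \<alpha> (root_delta l) = pi / 3" by (simp add: roots1_def)
    from c[unfolded ang] show "inner_prod l \<alpha> (root_delta l) = 1" by (simp add: cos_60)
  next
    assume "inner_prod l \<alpha> (root_delta l) = 1"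
    then have "root_angle l \<alpha> (root_delta l) = arccos (1 / 2)" using root_angle_eq[OF assms(2) d] by simp
    also have "\<dots> = arccos (cos (pi / 3))" by (simp add: cos_60)
    also have "\<dots> = pi / 3" by (rule arccos_cos) auto
    finally show "\<alpha> \<in> roots1 l" using assms by (simp add: roots1_def)
  qed
qed

lemma roots1_iff:
  assumes "l > 4"
  shows "\<alpha> \<in> roots1 l \<longleftrightarrow> (\<exists>j\<in>idx 3 l. \<alpha> = rt 1 j \<or> \<alpha> = rt 2 j)"
proof
  assume ex: "\<exists>j\<in>idx 3 l. \<alpha> = rt 1 j \<or> \<alpha> = rt 2 j"
  then obtain j i where j: "j \<in> idx 3 l" "\<alpha> = rt i j" "i = 1 \<or> i = 2" by blast
  have v: "valid l i j" using j assms by (auto simp: valid_def idx_def)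
  have "hgt i = 1" "hgt j = 0" using j by (auto simp: hgt_def kd_def idx_def)
  then show "\<alpha> \<in> roots1 l" using roots1_inner[OF assms rt_roots[OF v]] j inner_delta[OF assms] by simp
next
  assume a: "\<alpha> \<in> roots1 l"
  then have r: "\<alpha> \<in> roots l" by (rule roots1_roots)
  then obtain p q where v: "valid l p q" "\<alpha> = rt p q" by (rule root_cases)
  have s: "hgt p + hgt q = 1" using roots1_inner[OF assms r] a inner_delta[OF assms] v by simp
  have idx: "p \<in> idx 1 l" "q \<in> idx 1 l" using v by (auto simp: valid_def)
  show "\<exists>j\<in>idx 3 l. \<alpha> = rt 1 j \<or> \<alpha> = rt 2 j"
    using hgt_cases[OF idx(1)]
  proof cases
    case 1
    then have "hgt q = 0" using s by simp
    then have "q \<in> idx 3 l" using hgt_cases[OF idx(2)] by auto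
    then show ?thesis using 1 v by blast
  next
    case 2
    then show ?thesis using s hgt_cases[OF idx(2)] by auto
  next
    case 3
    then have "hgt q = 1" using s by simp
    then have "q = 1 \<or> q = 2" using hgt_cases[OF idx(2)] by auto
    then show ?thesis using 3 v rt_sym[of p q] by blast
  qed
qed

lemma roots0_iff:
  assumes "l > 4"
  shows "\<alpha> \<in> roots0 l \<longleftrightarrow> (\<exists>i\<in>idx 3 l. \<exists>j\<in>idx 3 l. \<bar>i\<bar> \<noteq> \<bar>j\<bar> \<and> \<alpha> = rt i j) \<or> \<alpha> = rt 1 (- 2) \<or> \<alpha> = rt 2 (- 1)"
proof
  assume a: "\<alpha> \<in> roots0 l"
  then have r: "\<alpha> \<in> roots l" by (simp add: roots0_def)
  then obtain p q where v: "valid l p q" "\<alpha> = rt p q" by (rule root_cases)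
  have s: "hgt p + hgt q = 0" using inner_delta[OF assms, of p q] v a by (simp add: roots0_def)
  have idx: "p \<in> idx 1 l" "q \<in> idx 1 l" using v by (auto simp: valid_def)
  show "(\<exists>i\<in>idx 3 l. \<exists>j\<in>idx 3 l. \<bar>i\<bar> \<noteq> \<bar>j\<bar> \<and> \<alpha> = rt i j) \<or> \<alpha> = rt 1 (- 2) \<or> \<alpha> = rt 2 (- 1)"
    using hgt_cases[OF idx(1)]
  proof cases
    case 1
    then have "hgt q = -1" using s by simp
    then have "q = - 1 \<or> q = - 2" using hgt_cases[OF idx(2)] by auto
    then show ?thesis using 1 v(2) valid_ne[OF v(1)] by auto
  next
    case 2
    then have "hgt q = 1" using s by simp
    then have "q = 1 \<or> q = 2" using hgt_cases[OF idx(2)] by auto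
    then show ?thesis using 2 v(2) valid_ne[OF v(1)] rt_sym[of p q] by auto
  next
    case 3
    then have "hgt q = 0" using s by simp
    then have "q \<in> idx 3 l" using hgt_cases[OF idx(2)] by auto
    then show ?thesis using 3 v valid_abs[OF v(1)] by blast
  qed
next
  assume "(\<exists>i\<in>idx 3 l. \<exists>j\<in>idx 3 l. \<bar>i\<bar> \<noteq> \<bar>j\<bar> \<and> \<alpha> = rt i j) \<or> \<alpha> = rt 1 (- 2) \<or> \<alpha> = rt 2 (- 1)"
  then obtain i j where ij: "\<alpha> = rt i j" "valid l i j" "hgt i + hgt j = 0"
  proof (elim disjE bexE conjE)
    fix i j assume ij: "i \<in> idx 3 l" "j \<in> idx 3 l" "\<bar>i\<bar> \<noteq> \<bar>j\<bar>" "\<alpha> = rt i j"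
    have "hgt i = 0" "hgt j = 0" using ij by (auto simp: hgt_def kd_def idx_def)
    then show ?thesis using that ij valid_idx[of 3 i l j] by auto
  next
    assume "\<alpha> = rt 1 (- 2)"
    then show ?thesis using that[of 1 "- 2"] valid_12[OF assms] by (simp add: hgt_def kd_def)
  next
    assume "\<alpha> = rt 2 (- 1)"
    then show ?thesis using that[of 2 "- 1"] valid_12[OF assms] by (simp add: hgt_def kd_def valid_sym)
  qed
  then show "\<alpha> \<in> roots0 l" using inner_delta[OF assms, of i j] rt_roots[of l i j] by (simp add: roots0_def)
qed

lemma roots0_roots: "roots0 l \<subseteq> roots l"
  by (auto simp: roots0_def)

lemma space_V1_iff: "x \<in> space_V1 l \<longleftrightarrow> (\<forall>b. b \<notin> Root ` roots1 l \<longrightarrow> x b = 0)"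
proof
  have fin: "finite (roots1 l)" by (rule finite_subset[OF _ finite_roots[of l]]) (auto simp: roots1_def)
  have e: "(\<Sum>\<alpha>\<in>roots1 l. c \<alpha> *\<^sub>v root_vec \<alpha>) b = (case b of Root \<beta> \<Rightarrow> if \<beta> \<in> roots1 l then c \<beta> else 0 | Cartan k \<Rightarrow> 0)" for c :: "root \<Rightarrow> 'a" and b
  proof (cases b)
    case (Root \<beta>)
    have "(\<Sum>\<alpha>\<in>roots1 l. c \<alpha> *\<^sub>v root_vec \<alpha>) b = (\<Sum>\<alpha>\<in>roots1 l. if \<alpha> = \<beta> then c \<beta> else 0)"
      unfolding sum_fun_apply Root by (intro sum.cong) (auto simp: smult_vec_def basis_vec_def)
    then show ?thesis using fin Root by simp
  next
    case (Cartan k)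
    then show ?thesis by (simp add: sum_fun_apply smult_vec_def basis_vec_def)
  qed
  show "\<forall>b. b \<notin> Root ` roots1 l \<longrightarrow> x b = 0" if "x \<in> space_V1 l"
    using that by (auto simp: space_V1_def e split: basis_index.splits)
  assume a: "\<forall>b. b \<notin> Root ` roots1 l \<longrightarrow> x b = 0"
  have "x = (\<Sum>\<alpha>\<in>roots1 l. x (Root \<alpha>) *\<^sub>v root_vec \<alpha>)"
  proof
    fix b show "x b = (\<Sum>\<alpha>\<in>roots1 l. x (Root \<alpha>) *\<^sub>v root_vec \<alpha>) b"
      unfolding e using a by (auto split: basis_index.split)
  qed
  then show "x \<in> space_V1 l" unfolding space_V1_def by (intro CollectI exI[of _ "\<lambda>\<alpha>. x (Root \<alpha>)"]) simp
qed

lemma V1_lie_space: "x \<in> space_V1 l \<Longrightarrow> x \<in> lie_space l"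
  unfolding space_V1_iff lie_space_def basis_indices_def using roots1_roots by blast

lemma elem_group_comp:
  assumes "g \<in> elem_group l N \<Phi>" "g' \<in> elem_group l N \<Phi>"
  shows "(\<lambda>v. g (g' v)) \<in> elem_group l N \<Phi>"
  using assms by (induction rule: elem_group.induct) (auto intro: elem_group.intros)

lemma elem_group_mono: "g \<in> elem_group l N \<Phi> \<Longrightarrow> \<Phi> \<subseteq> \<Phi>' \<Longrightarrow> g \<in> elem_group l N \<Phi>'"
  by (induction rule: elem_group.induct) (auto intro: elem_group.intros)

lemma elem_group_generator: "\<alpha> \<in> \<Phi> \<Longrightarrow> elem_root l N \<alpha> c \<in> elem_group l N \<Phi>"
  using elem_group.mult[OF elem_group.one, of \<alpha> \<Phi> l N c] by simp

lemma tens_opv_inverse: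
  assumes "valid l i j"
  shows "tens (opv i j (- c)) (tens (opv i j c) Y) = Y"
  using valid_ne[OF assms] by (intro ext) (auto simp: tens_def opv_def algebra_simps)

section \<open>The group \<open>G_0\<close> acting on the rows 1 and 2\<close>

locale chevalley_D =
  fixes l :: nat and N :: "root \<Rightarrow> root \<Rightarrow> int" and K :: "'k::field itself"
  assumes l: "l > 4" and chev: "chevalley_constants l N" and pos: "positive_constants l N"
    and two: "(2 :: 'k) \<noteq> 0"
begin

abbreviation xr :: "root \<Rightarrow> 'k \<Rightarrow> 'k vec \<Rightarrow> 'k vec" where "xr \<equiv> elem_root l N"

lemma xr_space: "\<alpha> \<in> roots l \<Longrightarrow> y \<in> lie_space l \<Longrightarrow> xr \<alpha> c y \<in> lie_space l"
  by (rule elem_root_space)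

lemmas Psi_xr = Psi_elem_root[OF l chev pos _ two]
lemmas Psi_inj = Psi_inject[OF l two]
lemmas Psi_rv = Psi_root_vec

text \<open>Checked on bivectors, where \<open>opv\<close> is inverted by changing the sign of its
  parameter. The restriction to \<open>lie_space\<close> is there because \<open>Psi\<close> cannot
  see coordinates outside the basis.\<close>

lemma xr_inverse:
  assumes "\<alpha> \<in> roots l" "y \<in> lie_space l"
  shows "xr \<alpha> (- c) (xr \<alpha> c y) = y"
proof -
  obtain i j where v: "valid l i j" "\<alpha> = rt i j" using assms(1) by (rule root_cases)
  show ?thesis
    by (rule Psi_inj) (use assms v in \<open>auto intro!: xr_space simp: Psi_xr tens_opv_inverse\<close>)
qed

lemma group_space: "g \<in> elem_group l N \<Phi> \<Longrightarrow> \<Phi> \<subseteq> roots l \<Longrightarrow> y \<in> lie_space l \<Longrightarrow> (g y :: 'k vec) \<in> lie_space l"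
  by (induction rule: elem_group.induct) (auto intro: xr_space)

lemma group_inverse:
  assumes "(g :: 'k vec \<Rightarrow> 'k vec) \<in> elem_group l N \<Phi>" "\<Phi> \<subseteq> roots l"
  shows "\<exists>g'\<in>elem_group l N \<Phi>. \<forall>y\<in>lie_space l. g' (g y) = y \<and> g (g' y) = y"
  using assms
proof (induction rule: elem_group.induct)
  case one
  show ?case by (intro bexI[of _ "\<lambda>v. v"]) (auto intro: elem_group.one)
next
  case (mult g \<alpha> a)
  then obtain g' where g': "g' \<in> elem_group l N \<Phi>" "\<And>y. y \<in> lie_space l \<Longrightarrow> g' (g y) = y" "\<And>y. y \<in> lie_space l \<Longrightarrow> g (g' y) = y"
    by blast
  have r: "\<alpha> \<in> roots l" using mult by blast
  have "(\<lambda>v. g' (xr \<alpha> (- a) v)) \<in> elem_group l N \<Phi>"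
    by (rule elem_group_comp[OF g'(1) elem_group_generator[OF mult(2)]])
  moreover have "g' (xr \<alpha> (- a) (xr \<alpha> a (g y))) = y" if "y \<in> lie_space l" for y
    using that g' group_space[OF mult(1,4)] by (simp add: xr_inverse[OF r])
  moreover have "xr \<alpha> a (g (g' (xr \<alpha> (- a) y))) = y" if "y \<in> lie_space l" for y
    using that g'(3) xr_space[OF r] xr_inverse[OF r, of _ "- a"] by simp
  ultimately show ?case by (intro bexI[of _ "\<lambda>v. g' (xr \<alpha> (- a) v)"]) auto
qed

lemma V1_Cartan: "x \<in> space_V1 l \<Longrightarrow> Hc l x p = 0"
  unfolding Hc_def by (intro sum.neutral) (auto simp: space_V1_iff)

text \<open>Roots of degree 0 preserve the grading by \<delta>; the Cartan part stays zero because -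
  \<alpha> has degree 0 and so does not occur in \<open>x\<close>.\<close>

lemma V1_bracket:
  fixes x :: "'k vec"
  assumes x: "x \<in> space_V1 l" and a: "\<alpha> \<in> roots0 l"
  shows "bracket l N (root_vec \<alpha>) x \<in> space_V1 l"
  unfolding space_V1_iff
proof (intro allI impI)
  fix b assume b: "b \<notin> Root ` roots1 l"
  have r: "\<alpha> \<in> roots l" and z: "inner_prod l \<alpha> (root_delta l) = 0" using a by (auto simp: roots0_def)
  have x0: "x (Cartan k) = 0" "\<gamma> \<notin> roots1 l \<Longrightarrow> x (Root \<gamma>) = 0" for k \<gamma> using x by (auto simp: space_V1_iff)
  have na: "- \<alpha> \<notin> roots1 l"
  proof
    assume "- \<alpha> \<in> roots1 l"
    then have "inner_prod l (- \<alpha>) (root_delta l) = 1" using roots1_inner[OF l] roots1_roots by blast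
    then show False using z by (simp add: inner_sym[of l _ "root_delta l"] inner_uminus)
  qed
  show "bracket l N (root_vec \<alpha>) x b = 0"
  proof (cases b)
    case (Cartan k) then show ?thesis by (simp add: bracket_Cartan[OF r] x0(2)[OF na])
  next
    case (Root \<gamma>)
    show ?thesis
    proof (cases "\<gamma> \<in> roots l")
      case False then show ?thesis using Root bracket_not_root[OF r] by simp
    next
      case True
      have "\<gamma> - \<alpha> \<notin> roots1 l"
      proof
        assume "\<gamma> - \<alpha> \<in> roots1 l"
        then have "inner_prod l (\<gamma> - \<alpha>) (root_delta l) = 1" using roots1_inner[OF l] roots1_roots by blast
        then have "inner_prod l \<gamma> (root_delta l) = 1" using z by (simp add: inner_sym[of l _ "root_delta l"] inner_diff)
        then show False using roots1_inner[OF l True] b Root by blast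
      qed
      then show ?thesis unfolding Root by (simp add: bracket_Root[OF r True] x0 zero_not_root)
    qed
  qed
qed

lemma V1_add: "x \<in> space_V1 l \<Longrightarrow> y \<in> space_V1 l \<Longrightarrow> x + y \<in> space_V1 l"
  by (simp add: space_V1_iff)

lemma V1_smult: "x \<in> space_V1 l \<Longrightarrow> c *\<^sub>v x \<in> space_V1 l"
  by (simp add: space_V1_iff smult_vec_def)

lemma V1_xr: "x \<in> space_V1 l \<Longrightarrow> \<alpha> \<in> roots0 l \<Longrightarrow> xr \<alpha> c x \<in> space_V1 l"
  unfolding elem_root_alt by (intro V1_add V1_smult V1_bracket)

lemma V1_rv: "\<alpha> \<in> roots1 l \<Longrightarrow> root_vec \<alpha> \<in> space_V1 l"
  by (auto simp: space_V1_iff basis_vec_def)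

lemma not_roots1: "rt 1 2 \<notin> roots1 l" "rt 1 (- 2) \<notin> roots1 l" "rt 2 1 \<notin> roots1 l" "rt 2 (- 1) \<notin> roots1 l"
proof -
  have v: "valid l 1 2" "valid l 1 (- 2)" "valid l 2 1" "valid l 2 (- 1)" using valid_12[OF l] by (simp_all add: valid_sym)
  note i = inner_delta[OF l] roots1_inner[OF l]
  show "rt 1 2 \<notin> roots1 l" "rt 1 (- 2) \<notin> roots1 l" "rt 2 1 \<notin> roots1 l" "rt 2 (- 1) \<notin> roots1 l"
    using v[THEN rt_roots] by (simp_all add: i) (simp_all add: hgt_def kd_def)
qed

lemma V1_rows_zero:
  assumes x: "x \<in> space_V1 l" and ip: "i = 1 \<or> i = 2" and p: "p \<in> {1, - 1, 2, - 2}"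
  shows "Psi l x i p = 0"
proof -
  have idx: "(1::int) \<in> idx 1 l" "(2::int) \<in> idx 1 l" using l by (auto simp: idx_def)
  have v: "valid l 1 2" "valid l 1 (- 2)" "valid l 2 1" "valid l 2 (- 1)" using valid_12[OF l] by (simp_all add: valid_sym)
  have x0: "\<gamma> \<notin> roots1 l \<Longrightarrow> x (Root \<gamma>) = 0" for \<gamma> using x by (auto simp: space_V1_iff)
  show ?thesis using ip p
    by (auto simp: Psi_diag[OF idx(1)] Psi_diag[OF idx(2)] Psi_opp[OF idx(1)] Psi_opp[OF idx(2)] V1_Cartan[OF x]
        Psi_valid[OF v(1)] Psi_valid[OF v(2)] Psi_valid[OF v(3)] Psi_valid[OF v(4)] x0 not_roots1)
qed

lemma V1_rows_supp:
  assumes x: "x \<in> space_V1 l" and i: "i = 1 \<or> i = 2"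
  shows "supp_in 3 l (Psi l x i)"
  unfolding supp_in_def
proof (intro allI impI)
  fix p assume p: "p \<notin> idx 3 l"
  show "Psi l x i p = 0"
  proof (cases "p \<in> idx 1 l")
    case True
    then have "p \<in> {1, - 1, 2, - 2}" using p by (auto simp: idx_def)
    then show ?thesis by (rule V1_rows_zero[OF x i])
  qed (simp add: Psi_outside)
qed

lemma V1_eqI:
  fixes x x' :: "'k vec"
  assumes x: "x \<in> space_V1 l" "x' \<in> space_V1 l" and e: "Psi l x 1 = Psi l x' 1" "Psi l x 2 = Psi l x' 2"
  shows "x = x'"
proof
  fix b
  show "x b = x' b"
  proof (cases "b \<in> Root ` roots1 l")
    case False then show ?thesis using x by (simp add: space_V1_iff)
  next
    case True
    then obtain i j where ij: "b = Root (rt i j)" "j \<in> idx 3 l" "i = 1 \<or> i = 2" using roots1_iff[OF l] by blast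
    have v: "valid l i j" using ij l by (auto simp: valid_def idx_def)
    have "Psi l x i j = Psi l x' i j" using e ij by auto
    then show ?thesis unfolding Psi_valid[OF v] using sg_sq_valid[OF v] ij by metis
  qed
qed

text \<open>The rows 1 and 2 vanish in the columns 1, -1, 2, -2. Hence the SL_2 generators act
  through the row index alone and the generators inside W through the column index alone. The
  parameter - c reflects \<open>sg 1 (- 2) = -1\<close>.\<close>

lemma V1_action:
  fixes x :: "'k vec"
  assumes x: "x \<in> space_V1 l"
  shows "\<And>i j. i \<in> idx 3 l \<Longrightarrow> j \<in> idx 3 l \<Longrightarrow> \<bar>i\<bar> \<noteq> \<bar>j\<bar> \<Longrightarrow> m = 1 \<or> m = 2 \<Longrightarrow>
       Psi l (xr (rt i j) c x) m = opv i j (of_int (sg i j) * c) (Psi l x m)"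
    and "Psi l (xr (rt 1 (- 2)) c x) 1 = lin 1 (Psi l x 1) (- c) (Psi l x 2)"
    and "Psi l (xr (rt 1 (- 2)) c x) 2 = Psi l x 2"
    and "Psi l (xr (rt 2 (- 1)) c x) 1 = Psi l x 1"
    and "Psi l (xr (rt 2 (- 1)) c x) 2 = lin (- c) (Psi l x 1) 1 (Psi l x 2)"
proof -
  have v: "valid l 1 (- 2)" "valid l 2 (- 1)" using valid_12[OF l] by (simp_all add: valid_sym)
  note z = V1_rows_zero[OF x]
  show "Psi l (xr (rt i j) c x) m = opv i j (of_int (sg i j) * c) (Psi l x m)" 
    if "i \<in> idx 3 l" "j \<in> idx 3 l" "\<bar>i\<bar> \<noteq> \<bar>j\<bar>" "m = 1 \<or> m = 2" for i j
  proof -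
    have v: "valid l i j" by (rule valid_idx[OF _ that(1-3)]) simp
    have "m \<noteq> i" "m \<noteq> j" using that by (auto simp: idx_def)
    then show ?thesis unfolding Psi_xr[OF v] by (auto simp: tens_def opv_def fun_eq_iff)
  qed
  show "Psi l (xr (rt 1 (- 2)) c x) 1 = lin 1 (Psi l x 1) (- c) (Psi l x 2)"
    "Psi l (xr (rt 1 (- 2)) c x) 2 = Psi l x 2"
    unfolding Psi_xr[OF v(1)] by (auto simp: tens_def opv_def fun_eq_iff lin_def z sg_opp)
  show "Psi l (xr (rt 2 (- 1)) c x) 1 = Psi l x 1"
    "Psi l (xr (rt 2 (- 1)) c x) 2 = lin (- c) (Psi l x 1) 1 (Psi l x 2)"
    unfolding Psi_xr[OF v(2)] by (auto simp: tens_def opv_def fun_eq_iff lin_def z sg_opp)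
qed

lemma roots0_gens: "rt 1 (- 2) \<in> roots0 l" "rt 2 (- 1) \<in> roots0 l" 
  "i \<in> idx 3 l \<Longrightarrow> j \<in> idx 3 l \<Longrightarrow> \<bar>i\<bar> \<noteq> \<bar>j\<bar> \<Longrightarrow> rt i j \<in> roots0 l"
  by (auto simp: roots0_iff[OF l])

text \<open>Each generator of \<open>reach\<close> is realised by a root element whose parameter is
  corrected by the sign \<open>sg\<close>; together with the converse this replaces
  \<open>G_0\<close> by operations on pairs.\<close>

lemma reach_G0:
  fixes x :: "'k vec"
  assumes x: "x \<in> space_V1 l" and r: "reach l (Psi l x 1) (Psi l x 2) u w"
  shows "\<exists>g\<in>group_G0 l N. g x \<in> space_V1 l \<and> Psi l (g x) 1 = u \<and> Psi l (g x) 2 = w"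
  using r
proof (induction rule: reach.induct)
  case reach_refl
  show ?case using x by (intro bexI[of _ "\<lambda>v. v"]) (auto intro: elem_group.one)
next
  case (reach_up u w c)
  then obtain g where g: "g \<in> group_G0 l N" "g x \<in> space_V1 l" "Psi l (g x) 1 = u" "Psi l (g x) 2 = w" by blast
  show ?case using V1_action(2,3)[OF g(2), of "- c"] g V1_xr[OF g(2) roots0_gens(1)]
    by (intro bexI[of _ "\<lambda>v. xr (rt 1 (- 2)) (- c) (g v)"]) (auto intro: elem_group.mult roots0_gens)
next
  case (reach_down u w c)
  then obtain g where g: "g \<in> group_G0 l N" "g x \<in> space_V1 l" "Psi l (g x) 1 = u" "Psi l (g x) 2 = w" by blast
  show ?case using V1_action(4,5)[OF g(2), of "- c"] g V1_xr[OF g(2) roots0_gens(2)]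
    by (intro bexI[of _ "\<lambda>v. xr (rt 2 (- 1)) (- c) (g v)"]) (auto intro: elem_group.mult roots0_gens)
next
  case (reach_opv u w i j c)
  then obtain g where g: "g \<in> group_G0 l N" "g x \<in> space_V1 l" "Psi l (g x) 1 = u" "Psi l (g x) 2 = w" by blast
  have v: "valid l i j" by (rule valid_idx[OF _ reach_opv(2-4)]) simp
  have sc: "of_int (sg i j) * (of_int (sg i j) * c) = c" by (rule sg_sq_valid[OF v])
  show ?case using V1_action(1)[OF g(2) reach_opv(2-4), of _ "of_int (sg i j) * c", unfolded sc] g 
      V1_xr[OF g(2) roots0_gens(3)[OF reach_opv(2-4)]] roots0_gens(3)[OF reach_opv(2-4)]
    by (intro bexI[of _ "\<lambda>v. xr (rt i j) (of_int (sg i j) * c) (g v)"]) (auto intro: elem_group.mult)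
qed

lemma G0_reach:
  fixes x :: "'k vec"
  assumes g: "g \<in> group_G0 l N" and x: "x \<in> space_V1 l"
  shows "g x \<in> space_V1 l \<and> reach l (Psi l x 1) (Psi l x 2) (Psi l (g x) 1) (Psi l (g x) 2)"
  using g
proof (induction rule: elem_group.induct)
  case one
  then show ?case using x by (auto intro: reach_refl)
next
  case (mult g \<alpha> c)
  then have gx: "g x \<in> space_V1 l" and r: "reach l (Psi l x 1) (Psi l x 2) (Psi l (g x) 1) (Psi l (g x) 2)" by auto
  from mult(2) consider i j where "i \<in> idx 3 l" "j \<in> idx 3 l" "\<bar>i\<bar> \<noteq> \<bar>j\<bar>" "\<alpha> = rt i j" | "\<alpha> = rt 1 (- 2)" | "\<alpha> = rt 2 (- 1)"
    unfolding roots0_iff[OF l] by blast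
  then have "reach l (Psi l x 1) (Psi l x 2) (Psi l (xr \<alpha> c (g x)) 1) (Psi l (xr \<alpha> c (g x)) 2)"
  proof cases
    case 1
    then show ?thesis using V1_action(1)[OF gx 1(1-3)] reach_opv[OF r 1(1-3)] by simp
  next
    case 2
    then show ?thesis using V1_action(2,3)[OF gx] reach_up[OF r] by simp
  next
    case 3
    then show ?thesis using V1_action(4,5)[OF gx] reach_down[OF r] by simp
  qed
  then show ?case using V1_xr[OF gx mult(2)] by simp
qed

end

section \<open>Angles between root elements\<close>

text \<open>The product of two bivectors regarded as endomorphisms of the natural module by means of
  the form.\<close>

definition bprod :: "nat \<Rightarrow> (int \<Rightarrow> int \<Rightarrow> 'a::comm_ring_1) \<Rightarrow> (int \<Rightarrow> int \<Rightarrow> 'a) \<Rightarrow> int \<Rightarrow> int \<Rightarrow> 'a" where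
  "bprod l Y Z p q = (\<Sum>k\<in>idx 1 l. Y p k * Z (- k) q)"

text \<open>The form that the natural module induces on its tensor square; on decomposable bivectors
  it is twice a 2 by 2 determinant.\<close>

definition bform :: "nat \<Rightarrow> (int \<Rightarrow> int \<Rightarrow> 'a::comm_ring_1) \<Rightarrow> (int \<Rightarrow> int \<Rightarrow> 'a) \<Rightarrow> 'a" where
  "bform l Y Z = (\<Sum>p\<in>idx 1 l. \<Sum>q\<in>idx 1 l. Y p q * Z (- p) (- q))"

text \<open>For nonzero bivectors this says that the two planes share a line.\<close>

definition common_factor :: "(int \<Rightarrow> int \<Rightarrow> 'a::comm_ring_1) \<Rightarrow> (int \<Rightarrow> int \<Rightarrow> 'a) \<Rightarrow> bool" where
  "common_factor Y Z \<longleftrightarrow> (\<exists>a b d. Y = wedge a b \<and> Z = wedge a d)"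

definition bscale :: "'a::comm_ring_1 \<Rightarrow> (int \<Rightarrow> int \<Rightarrow> 'a) \<Rightarrow> int \<Rightarrow> int \<Rightarrow> 'a" where
  "bscale c Y = (\<lambda>p q. c * Y p q)"

lemma bprod_wedge: "bprod l (wedge a b) (wedge e f) p q =
   a p * f q * Bil l b e - a p * e q * Bil l b f - b p * f q * Bil l a e + b p * e q * Bil l a f"
  unfolding bprod_def wedge_def Bil_def sum_distrib_left sum_subtractf[symmetric] sum.distrib[symmetric]
  by (intro sum.cong) (auto simp: algebra_simps)

lemma bform_wedge: "bform l (wedge a b) (wedge e f) = 2 * (Bil l a e * Bil l b f - Bil l a f * Bil l b e)"
proof -
  have "bform l (wedge a b) (wedge e f) = (\<Sum>p\<in>idx 1 l. a p * e (- p) * Bil l b f - a p * f (- p) * Bil l b e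
     - b p * e (- p) * Bil l a f + b p * f (- p) * Bil l a e)"
    unfolding bform_def
  proof (rule sum.cong[OF refl])
    fix p
    show "(\<Sum>q\<in>idx 1 l. wedge a b p q * wedge e f (- p) (- q)) = a p * e (- p) * Bil l b f - a p * f (- p) * Bil l b e
     - b p * e (- p) * Bil l a f + b p * f (- p) * Bil l a e"
      unfolding wedge_def Bil_def sum_distrib_left sum_subtractf[symmetric] sum.distrib[symmetric]
      by (intro sum.cong) (auto simp: algebra_simps)
  qed
  also have "\<dots> = Bil l a e * Bil l b f - Bil l a f * Bil l b e - Bil l b e * Bil l a f + Bil l b f * Bil l a e"
    unfolding Bil_def[of l a e] Bil_def[of l a f] Bil_def[of l b e] Bil_def[of l b f] sum_distrib_right sum_subtractf sum.distrib ..
  finally show ?thesis by (simp add: algebra_simps)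
qed

lemma tens_wedge_Eops: "h \<in> Eops m l \<Longrightarrow> tens h (wedge a b) = wedge (h a) (h b)"
  by (rule tens_wedge) (rule Eops_linear)

lemma bscale_wedge: "bscale c (wedge a b) = wedge (lin c a 0 a) b" "bscale c (wedge a b) = wedge a (lin c b 0 b)"
  by (auto simp: bscale_def wedge_def lin_def fun_eq_iff algebra_simps)

lemma bscale_bscale: "bscale c (bscale d Y) = bscale (c * d) Y" "bscale 1 Y = Y"
  by (auto simp: bscale_def fun_eq_iff algebra_simps)

text \<open>The entries of the product are bilinear in the vectors, with coefficients that are
  values of \<open>Bil\<close> and hence invariant. So the relation may be transformed by
  \<open>h\<close> first in the index p and then in q.\<close>

lemma bprod_Eops_zero:
  assumes h: "h \<in> Eops 1 l" and z: "\<And>p q. bprod l (wedge a b) (wedge e f) p q = 0"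
  shows "bprod l (wedge (h a) (h b)) (wedge (h e) (h f)) p q = 0"
proof -
  define A B C D where "A = Bil l b e" and "B = Bil l b f" and "C = Bil l a e" and "D = Bil l a f"
  have z': "a p * f q * A - a p * e q * B - b p * f q * C + b p * e q * D = 0" for p q
    using z[of p q] unfolding bprod_wedge A_def B_def C_def D_def .
  have h0: "h zvec = zvec" using Eops_zero[OF h] by (simp add: zvec_def)
  have 1: "h a p * f q * A - h a p * e q * B - h b p * f q * C + h b p * e q * D = 0" for p q
  proof -
    have "lin (f q * A - e q * B) a (- (f q * C) + e q * D) b = zvec"
      using z'[of _ q] by (auto simp: lin_def zvec_def fun_eq_iff algebra_simps)
    then have "lin (f q * A - e q * B) (h a) (- (f q * C) + e q * D) (h b) = zvec" using Eops_lin[OF h] h0 by metis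
    from fun_cong[OF this, of p] show ?thesis by (simp add: lin_def zvec_def algebra_simps)
  qed
  have "lin (h a p * A - h b p * C) f (- (h a p * B) + h b p * D) e = zvec"
    using 1[of p] by (auto simp: lin_def zvec_def fun_eq_iff algebra_simps)
  then have "lin (h a p * A - h b p * C) (h f) (- (h a p * B) + h b p * D) (h e) = zvec" using Eops_lin[OF h] h0 by metis
  from fun_cong[OF this, of q] have "h a p * h f q * A - h a p * h e q * B - h b p * h f q * C + h b p * h e q * D = 0"
    by (simp add: lin_def zvec_def algebra_simps)
  then show ?thesis unfolding bprod_wedge A_def B_def C_def D_def using Bil_Eops[OF h] by simp
qed

abbreviation rbv :: "int \<Rightarrow> int \<Rightarrow> int \<Rightarrow> int \<Rightarrow> 'a::comm_ring_1" where
  "rbv i j \<equiv> wedge (unit_vec i) (unit_vec j)"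

lemma rbv_swap: "rbv j i = bscale (- 1) (rbv i j)"
  by (auto simp: bscale_def wedge_def fun_eq_iff)

lemma Bil_unit_unit: "i \<in> idx 1 l \<Longrightarrow> Bil l (unit_vec i) (unit_vec k) = (if k = - i then 1 else 0)"
  unfolding Bil_unit by (auto simp: unit_vec_def)

lemma bprod_bscale: "bprod l (bscale c Y) (bscale d Z) p q = c * d * bprod l Y Z p q"
  by (simp add: bprod_def bscale_def sum_distrib_left mult_ac)

lemma bform_bscale: "bform l (bscale c Y) (bscale d Z) = c * d * bform l Y Z"
  by (simp add: bform_def bscale_def sum_distrib_left mult_ac)

lemma bprod_rbv_zero_iff:
  assumes "valid l i j" "valid l k m"
  shows "(\<forall>p q. bprod l (rbv i j) (rbv k m) p q = (0::'a::field)) \<longleftrightarrow> k \<noteq> - i \<and> k \<noteq> - j \<and> m \<noteq> - i \<and> m \<noteq> - j"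
proof -
  have idx: "i \<in> idx 1 l" "j \<in> idx 1 l" using assms by (auto simp: valid_def)
  note n = valid_ne[OF assms(1)] valid_ne[OF assms(2)]
  note e = bprod_wedge[of l "unit_vec i" "unit_vec j" "unit_vec k" "unit_vec m", unfolded Bil_unit_unit[OF idx(1)] Bil_unit_unit[OF idx(2)]]
  have "bprod l (rbv i j) (rbv k m) i m \<noteq> (0::'a)" if "k = - j" unfolding e using that n by (simp add: unit_vec_def)
  moreover have "bprod l (rbv i j) (rbv k m) i k \<noteq> (0::'a)" if "m = - j" unfolding e using that n by (simp add: unit_vec_def)
  moreover have "bprod l (rbv i j) (rbv k m) j m \<noteq> (0::'a)" if "k = - i" unfolding e using that n by (simp add: unit_vec_def)
  moreover have "bprod l (rbv i j) (rbv k m) j k \<noteq> (0::'a)" if "m = - i" unfolding e using that n by (simp add: unit_vec_def)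
  moreover have "bprod l (rbv i j) (rbv k m) p q = (0::'a)" if "k \<noteq> - i \<and> k \<noteq> - j \<and> m \<noteq> - i \<and> m \<noteq> - j" for p q
    unfolding e using that by simp
  ultimately show ?thesis by blast
qed

lemma bform_rbv_zero_iff:
  assumes "valid l i j" "valid l k m" and two: "(2 :: 'a::field) \<noteq> 0"
  shows "bform l (rbv i j) (rbv k m) = (0::'a) \<longleftrightarrow> \<not> (k = - i \<and> m = - j \<or> k = - j \<and> m = - i)"
proof -
  have idx: "i \<in> idx 1 l" "j \<in> idx 1 l" using assms by (auto simp: valid_def)
  note n = valid_ne[OF assms(1)] valid_ne[OF assms(2)]
  show ?thesis unfolding bform_wedge Bil_unit_unit[OF idx(1)] Bil_unit_unit[OF idx(2)] using n two by auto
qed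

text \<open>A factor of a nonzero decomposable bivector lies in its plane: the triple product of
  \<open>v\<close> with this bivector is zero.\<close>

lemma wedge_support:
  fixes v :: "'a::field nvec"
  assumes e: "wedge v p = bscale c (rbv i j)" and c: "c \<noteq> 0" "i \<noteq> j" and v: "v x \<noteq> 0"
  shows "x = i \<or> x = j"
proof (rule ccontr)
  assume x: "\<not> (x = i \<or> x = j)"
  have "wedge v p x i = 0" "wedge v p x j = 0" "wedge v p i j = c" 
    unfolding e using x c by (auto simp: bscale_def wedge_def unit_vec_def)
  then have "v x * p i = p x * v i" "v x * p j = p x * v j" and ij: "v i * p j - p i * v j = c" by (simp_all add: wedge_def)
  have "v x * (v i * p j - p i * v j) = v i * (v x * p j) - (v x * p i) * v j" by (simp add: algebra_simps)
  also have "\<dots> = 0" unfolding \<open>v x * p i = p x * v i\<close> \<open>v x * p j = p x * v j\<close> by (simp add: algebra_simps)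
  finally have "v x * (v i * p j - p i * v j) = 0" .
  then show False using v ij c by simp
qed

lemma common_factor_rbv_iff:
  fixes c d :: "'a::field"
  assumes v: "i \<noteq> j" "k \<noteq> m" and c: "c \<noteq> 0" "d \<noteq> 0"
  shows "common_factor (bscale c (rbv i j)) (bscale d (rbv k m)) \<longleftrightarrow> i = k \<or> i = m \<or> j = k \<or> j = m"
proof
  assume "common_factor (bscale c (rbv i j)) (bscale d (rbv k m))"
  then obtain a b e where w: "bscale c (rbv i j) = wedge a b" "bscale d (rbv k m) = wedge a e" by (auto simp: common_factor_def)
  have "\<exists>x. a x \<noteq> 0"
  proof (rule ccontr)
    assume "\<not> (\<exists>x. a x \<noteq> 0)"
    then have "bscale c (rbv i j) i j = 0" unfolding w by (simp add: wedge_def)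
    then show False using c v by (simp add: bscale_def wedge_def unit_vec_def)
  qed
  then obtain x where x: "a x \<noteq> 0" by blast
  show "i = k \<or> i = m \<or> j = k \<or> j = m"
    using wedge_support[OF w(1)[symmetric] c(1) v(1) x] wedge_support[OF w(2)[symmetric] c(2) v(2) x] by blast
next
  have *: "common_factor (bscale c (rbv i j)) (bscale d (rbv i m))" for c d :: 'a and i j m
    unfolding common_factor_def bscale_wedge(2) by blast
  assume "i = k \<or> i = m \<or> j = k \<or> j = m"
  then show "common_factor (bscale c (rbv i j)) (bscale d (rbv k m))"
    using *[of c i j d m] *[of c i j "- d" k] *[of "- c" j i d m] *[of "- c" j i "- d" k]
    by (auto simp: rbv_swap[of j i] rbv_swap[of m k] rbv_swap[of m i] bscale_bscale)
qed

lemma kd_sum_cases: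
  assumes "valid l i j"
  obtains "k = i \<or> k = j" "k \<noteq> - i" "k \<noteq> - j" "kd k i + kd k j = 1"
    | "k = - i \<or> k = - j" "k \<noteq> i" "k \<noteq> j" "kd k i + kd k j = - 1"
    | "k \<noteq> i" "k \<noteq> j" "k \<noteq> - i" "k \<noteq> - j" "kd k i + kd k j = 0"
proof -
  note n = valid_ne[OF assms]
  consider "k = i" | "k = j" | "k = - i" | "k = - j" | "k \<noteq> i" "k \<noteq> j" "k \<noteq> - i" "k \<noteq> - j" by blast
  then show ?thesis
  proof cases
    case 1 then show ?thesis using that(1) n by (simp add: kd_def)
  next
    case 2 then show ?thesis using that(1) n by (simp add: kd_def)
  next
    case 3 then show ?thesis using that(2) n by (simp add: kd_def)
  next
    case 4 then show ?thesis using that(2) n by (simp add: kd_def)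
  next
    case 5 then show ?thesis using that(3) by (simp add: kd_def)
  qed
qed

text \<open>Sharing an index raises the inner product of two roots, having opposite indices lowers it.\<close>

lemma inner_ge_iff:
  assumes v: "valid l i j" "valid l k m"
  defines "n \<equiv> inner_prod l (rt i j) (rt k m)"
  shows "n \<ge> 2 \<longleftrightarrow> rt i j = rt k m"
    and "n \<ge> 1 \<longleftrightarrow> (i = k \<or> i = m \<or> j = k \<or> j = m) \<and> (k \<noteq> - i \<and> k \<noteq> - j \<and> m \<noteq> - i \<and> m \<noteq> - j)"
    and "n \<ge> 0 \<longleftrightarrow> (i = k \<or> i = m \<or> j = k \<or> j = m) \<or> (k \<noteq> - i \<and> k \<noteq> - j \<and> m \<noteq> - i \<and> m \<noteq> - j)"
    and "n \<ge> - 1 \<longleftrightarrow> \<not> (k = - i \<and> m = - j \<or> k = - j \<and> m = - i)"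
proof -
  have n: "n = (kd k i + kd k j) + (kd m i + kd m j)" unfolding n_def inner_rt_rt[OF v(2)] by simp
  note ne = valid_ne[OF v(2)]
  show "n \<ge> 2 \<longleftrightarrow> rt i j = rt k m"
    unfolding rt_eq_iff[OF v] n
    by (rule kd_sum_cases[OF v(1), of k]; rule kd_sum_cases[OF v(1), of m]) (use ne in auto)
  show "n \<ge> 1 \<longleftrightarrow> (i = k \<or> i = m \<or> j = k \<or> j = m) \<and> (k \<noteq> - i \<and> k \<noteq> - j \<and> m \<noteq> - i \<and> m \<noteq> - j)"
    unfolding n by (rule kd_sum_cases[OF v(1), of k]; rule kd_sum_cases[OF v(1), of m]) (use ne in auto)
  show "n \<ge> 0 \<longleftrightarrow> (i = k \<or> i = m \<or> j = k \<or> j = m) \<or> (k \<noteq> - i \<and> k \<noteq> - j \<and> m \<noteq> - i \<and> m \<noteq> - j)"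
    unfolding n by (rule kd_sum_cases[OF v(1), of k]; rule kd_sum_cases[OF v(1), of m]) (use ne in auto)
  show "n \<ge> - 1 \<longleftrightarrow> \<not> (k = - i \<and> m = - j \<or> k = - j \<and> m = - i)"
    unfolding n by (rule kd_sum_cases[OF v(1), of k]; rule kd_sum_cases[OF v(1), of m]) (use ne in auto)
qed

text \<open>The isometry preserves proportionality, a common factor of the two bivectors, the vanishing of
  their product and the vanishing of their inner product; these detect the inner product of two roots.\<close>

lemma inner_mono:
  fixes h :: "'a::field nvec \<Rightarrow> 'a nvec"
  assumes two: "(2::'a) \<noteq> 0" and h: "h \<in> Eops 1 l"
    and v: "valid l i j" "valid l k m" "valid l i' j'" "valid l k' m'"
    and nz: "c \<noteq> 0" "d \<noteq> 0" "c' \<noteq> 0" "d' \<noteq> 0"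
    and Y: "tens h (bscale c (rbv i j)) = bscale c' (rbv i' j')"
    and Z: "tens h (bscale d (rbv k m)) = bscale d' (rbv k' m')"
  shows "inner_prod l (rt i j) (rt k m) \<le> inner_prod l (rt i' j') (rt k' m')"
proof -
  define a b e f where "a = lin c (unit_vec i) 0 (unit_vec i)" and "b = (unit_vec j :: 'a nvec)"
    and "e = lin d (unit_vec k) 0 (unit_vec k)" and "f = (unit_vec m :: 'a nvec)"
  have ab: "bscale c (rbv i j) = wedge a b" "bscale d (rbv k m) = wedge e f"
    by (simp_all add: a_def b_def e_def f_def bscale_wedge(1))
  have ab': "bscale c' (rbv i' j') = wedge (h a) (h b)" "bscale d' (rbv k' m') = wedge (h e) (h f)"
    using Y Z unfolding ab tens_wedge_Eops[OF h] by simp_all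
  note ne = valid_ne[OF v(1)] valid_ne[OF v(2)] valid_ne[OF v(3)] valid_ne[OF v(4)]
  note I = inner_ge_iff[OF v(1,2)] and I' = inner_ge_iff[OF v(3,4)]
  have n1: "i \<noteq> j" "k \<noteq> m" "i' \<noteq> j'" "k' \<noteq> m'" using ne by auto
  have bp: "(\<forall>p q. bprod l (wedge a b) (wedge e f) p q = 0) \<longleftrightarrow> k \<noteq> - i \<and> k \<noteq> - j \<and> m \<noteq> - i \<and> m \<noteq> - j"
    unfolding bprod_rbv_zero_iff[OF v(1,2), where 'a = 'a, symmetric] ab[symmetric] bprod_bscale using nz by simp
  have bp': "(\<forall>p q. bprod l (wedge (h a) (h b)) (wedge (h e) (h f)) p q = 0) \<longleftrightarrow> k' \<noteq> - i' \<and> k' \<noteq> - j' \<and> m' \<noteq> - i' \<and> m' \<noteq> - j'"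
    unfolding bprod_rbv_zero_iff[OF v(3,4), where 'a = 'a, symmetric] ab'[symmetric] bprod_bscale using nz by simp
  have opp: "k' \<noteq> - i' \<and> k' \<noteq> - j' \<and> m' \<noteq> - i' \<and> m' \<noteq> - j'" if "k \<noteq> - i \<and> k \<noteq> - j \<and> m \<noteq> - i \<and> m \<noteq> - j"
    using that bprod_Eops_zero[OF h, of a b e f] unfolding bp[symmetric] bp'[symmetric] by blast
  have cf: "i' = k' \<or> i' = m' \<or> j' = k' \<or> j' = m'" if "i = k \<or> i = m \<or> j = k \<or> j = m"
  proof -
    have "common_factor (bscale c (rbv i j)) (bscale d (rbv k m))"
      using common_factor_rbv_iff[OF n1(1,2) nz(1,2)] that by blast
    then obtain x y z where "bscale c (rbv i j) = wedge x y" "bscale d (rbv k m) = wedge x z" by (auto simp: common_factor_def)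
    then have "bscale c' (rbv i' j') = wedge (h x) (h y)" "bscale d' (rbv k' m') = wedge (h x) (h z)"
      using Y Z by (simp_all add: tens_wedge_Eops[OF h])
    then have "common_factor (bscale c' (rbv i' j')) (bscale d' (rbv k' m'))" unfolding common_factor_def by blast
    then show ?thesis using common_factor_rbv_iff[OF n1(3,4) nz(3,4)] by blast
  qed
  have form: "\<not> (k' = - i' \<and> m' = - j' \<or> k' = - j' \<and> m' = - i')" if "\<not> (k = - i \<and> m = - j \<or> k = - j \<and> m = - i)"
  proof -
    have "bform l (wedge (h a) (h b)) (wedge (h e) (h f)) = bform l (wedge a b) (wedge e f)"
      unfolding bform_wedge using Bil_Eops[OF h] by simp
    then have "c' * d' * bform l (rbv i' j') (rbv k' m') = c * d * bform l (rbv i j) (rbv k m)"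
      unfolding ab[symmetric] ab'[symmetric] bform_bscale .
    moreover have "bform l (rbv i j) (rbv k m) = (0::'a)" using bform_rbv_zero_iff[OF v(1,2) two] that by blast
    ultimately have "bform l (rbv i' j') (rbv k' m') = (0::'a)" using nz by simp
    then show ?thesis using bform_rbv_zero_iff[OF v(3,4) two] by blast
  qed
  have propn: "rt i' j' = rt k' m'" if eq: "rt i j = rt k m"
  proof -
    have "\<exists>t. rbv k m = bscale t (rbv i j :: int \<Rightarrow> int \<Rightarrow> 'a)"
      using eq rbv_swap[of j i, where 'a = 'a] bscale_bscale(2)[of "rbv i j :: int \<Rightarrow> int \<Rightarrow> 'a"]
      unfolding rt_eq_iff[OF v(1,2)] by metis
    then obtain t where t: "rbv k m = bscale t (rbv i j :: int \<Rightarrow> int \<Rightarrow> 'a)" by blast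
    have "wedge e f = bscale (d * t / c) (wedge a b)" using nz t by (simp add: ab[symmetric] bscale_bscale)
    also have "\<dots> = wedge (lin (d * t / c) a 0 a) b" by (rule bscale_wedge)
    finally have "tens h (wedge e f) = wedge (h (lin (d * t / c) a 0 a)) (h b)" using tens_wedge_Eops[OF h] by simp
    then have "wedge (h e) (h f) = bscale (d * t / c) (wedge (h a) (h b))"
      unfolding tens_wedge_Eops[OF h] Eops_lin[OF h] bscale_wedge(1) .
    then have "bscale d' (rbv k' m') k' m' = bscale (d * t / c) (bscale c' (rbv i' j')) k' m'" unfolding ab' by simp
    then have "(rbv i' j' :: int \<Rightarrow> int \<Rightarrow> 'a) k' m' \<noteq> 0" using nz n1 by (auto simp: bscale_def wedge_def unit_vec_def)
    then have "k' = i' \<and> m' = j' \<or> k' = j' \<and> m' = i'" by (auto simp: wedge_def unit_vec_def split: if_splits)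
    then show ?thesis by (auto simp: rt_sym)
  qed
  have b: "\<bar>inner_prod l (rt i j) (rt k m)\<bar> \<le> 2" "\<bar>inner_prod l (rt i' j') (rt k' m')\<bar> \<le> 2"
    using inner_bounds rt_roots v by blast+
  have step: "inner_prod l (rt i' j') (rt k' m') \<ge> x" if ge: "inner_prod l (rt i j) (rt k m) \<ge> x" and xs: "x \<in> {-1, 0, 1, 2}" for x
  proof -
    consider "x = - 1" | "x = 0" | "x = 1" | "x = 2" using xs by blast
    then show ?thesis
    proof cases
      case 1 show ?thesis unfolding 1 using ge[unfolded 1] form unfolding I I' by blast
    next
      case 2 show ?thesis unfolding 2 using ge[unfolded 2] opp cf unfolding I I' by blast
    next
      case 3 show ?thesis unfolding 3 using ge[unfolded 3] opp cf unfolding I I' by blast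
    next
      case 4 show ?thesis unfolding 4 using ge[unfolded 4] propn unfolding I I' by blast
    qed
  qed
  have "inner_prod l (rt i j) (rt k m) \<in> {-1, 0, 1, 2} \<or> inner_prod l (rt i j) (rt k m) = - 2" using b(1) by auto
  then show ?thesis
  proof
    assume "inner_prod l (rt i j) (rt k m) \<in> {-1, 0, 1, 2}"
    then show ?thesis by (rule step[OF order_refl])
  next
    assume "inner_prod l (rt i j) (rt k m) = - 2"
    then show ?thesis using b(2) by linarith
  qed
qed

section \<open>Invariance of the angle under the group\<close>

context chevalley_D begin

lemma Psi_scaled_root_vec:
  assumes "valid l i j"
  shows "Psi l (c *\<^sub>v root_vec (rt i j) :: 'k vec) = bscale (c * of_int (sg i j)) (rbv i j)"
  by (intro ext) (simp add: Psi_smult Psi_rv[OF assms] bscale_def mult_ac)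

text \<open>Only decomposable bivectors are followed, since root elements are of this kind;
  composition of isometries is then immediate.\<close>

lemma group_Eops:
  assumes "(g :: 'k vec \<Rightarrow> 'k vec) \<in> group_G l N"
  shows "\<exists>h\<in>Eops 1 l. \<forall>y\<in>lie_space l. \<forall>a b. Psi l y = wedge a b \<longrightarrow> Psi l (g y) = wedge (h a) (h b)"
  using assms
proof (induction rule: elem_group.induct)
  case one
  show ?case by (intro bexI[of _ "\<lambda>v. v"]) (auto intro: Eops_id)
next
  case (mult g \<alpha> c)
  then obtain h where h: "h \<in> Eops 1 l" "\<And>y a b. y \<in> lie_space l \<Longrightarrow> Psi l y = wedge a b \<Longrightarrow> Psi l (g y) = wedge (h a) (h b)" by blast
  obtain i j where v: "valid l i j" "\<alpha> = rt i j" using mult(2) by (rule root_cases)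
  have ij: "i \<in> idx 1 l" "j \<in> idx 1 l" "\<bar>i\<bar> \<noteq> \<bar>j\<bar>" using v by (auto simp: valid_def)
  have "Psi l (xr \<alpha> c (g y)) = wedge (opv i j (of_int (sg i j) * c) (h a)) (opv i j (of_int (sg i j) * c) (h b))"
    if "y \<in> lie_space l" "Psi l y = wedge a b" for y a b
    unfolding v(2) Psi_xr[OF v(1)] h(2)[OF that] by (rule tens_wedge_Eops[OF Eops_opv[OF ij]])
  then show ?case using Eops_step[OF h(1) ij]
    by (intro bexI[of _ "\<lambda>v. opv i j (of_int (sg i j) * c) (h v)"]) auto
qed

lemma Eops_group:
  assumes "(h :: 'k nvec \<Rightarrow> 'k nvec) \<in> Eops 1 l"
  shows "\<exists>g\<in>group_G l N. \<forall>y\<in>lie_space l. \<forall>a b. Psi l y = wedge a b \<longrightarrow> Psi l (g y) = wedge (h a) (h b)"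
  using assms
proof (induction rule: Eops.induct)
  case Eops_id
  show ?case by (intro bexI[of _ "\<lambda>v. v"]) (auto intro: elem_group.one)
next
  case (Eops_step h i j c)
  then obtain g where g: "g \<in> group_G l N" "\<And>y a b. y \<in> lie_space l \<Longrightarrow> Psi l y = wedge a b \<Longrightarrow> Psi l (g y) = wedge (h a) (h b)" by blast
  have v: "valid l i j" using Eops_step by (simp add: valid_def)
  have "Psi l (xr (rt i j) (of_int (sg i j) * c) (g y)) = wedge (opv i j c (h a)) (opv i j c (h b))"
    if "y \<in> lie_space l" "Psi l y = wedge a b" for y a b
    unfolding Psi_xr[OF v] g(2)[OF that] sg_sq_valid[OF v] by (rule tens_wedge_Eops[OF Eops_opv[OF Eops_step(2-4)]])
  then show ?case using elem_group.mult[OF g(1) rt_roots[OF v]]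
    by (intro bexI[of _ "\<lambda>y. xr (rt i j) (of_int (sg i j) * c) (g y)"]) auto
qed

lemma group_inner_mono:
  fixes c d c' d' :: 'k
  assumes g: "g \<in> group_G l N" and r: "\<alpha> \<in> roots l" "\<beta> \<in> roots l" "\<alpha>' \<in> roots l" "\<beta>' \<in> roots l"
    and nz: "c \<noteq> 0" "d \<noteq> 0" "c' \<noteq> 0" "d' \<noteq> 0"
    and e: "g (c *\<^sub>v root_vec \<alpha>) = c' *\<^sub>v root_vec \<alpha>'" "g (d *\<^sub>v root_vec \<beta>) = d' *\<^sub>v root_vec \<beta>'"
  shows "inner_prod l \<alpha> \<beta> \<le> inner_prod l \<alpha>' \<beta>'"
proof -
  obtain i j k m i' j' k' m' where v: "valid l i j" "valid l k m" "valid l i' j'" "valid l k' m'"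
    and ab: "\<alpha> = rt i j" "\<beta> = rt k m" "\<alpha>' = rt i' j'" "\<beta>' = rt k' m'"
    using r by (metis root_cases)
  obtain h :: "'k nvec \<Rightarrow> 'k nvec" where h: "h \<in> Eops 1 l" "\<And>y a b. y \<in> lie_space l \<Longrightarrow> Psi l y = wedge a b \<Longrightarrow> Psi l (g y) = wedge (h a) (h b)"
    using group_Eops[OF g] by blast
  have sp: "c *\<^sub>v root_vec \<alpha> \<in> lie_space l" "d *\<^sub>v root_vec \<beta> \<in> lie_space l"
    using r by (auto intro: smult_space rv_space)
  have sgnz: "of_int (sg p q) \<noteq> (0::'k)" if "valid l p q" for p q
    using sg_sq_valid[OF that, of "1::'k"] by auto
  have T: "Psi l (g y) = tens h (Psi l y)" if "y \<in> lie_space l" "Psi l y = bscale x (rbv p q)" for y x p q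
    using h(2)[OF that(1), of "lin x (unit_vec p) 0 (unit_vec p)" "unit_vec q"] that(2)
    by (simp add: bscale_wedge(1) tens_wedge_Eops[OF h(1)])
  show ?thesis unfolding ab
  proof (rule inner_mono[OF two h(1) v])
    show "tens h (bscale (c * of_int (sg i j)) (rbv i j)) = bscale (c' * of_int (sg i' j')) (rbv i' j')"
      using T[OF sp(1)] e(1) unfolding ab by (simp add: Psi_scaled_root_vec v)
    show "tens h (bscale (d * of_int (sg k m)) (rbv k m)) = bscale (d' * of_int (sg k' m')) (rbv k' m')"
      using T[OF sp(2)] e(2) unfolding ab by (simp add: Psi_scaled_root_vec v)
  qed (use nz sgnz v in auto)
qed

text \<open>Two witnesses differ by an element of the group that carries one pair of root vectors to
  multiples of the other. Monotonicity of the inner product in both directions gives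
  equality.\<close>

lemma has_angle_unique:
  fixes y z :: "'k vec"
  assumes y: "y \<in> lie_space l" "z \<in> lie_space l" and a: "has_angle l N y z \<phi>" "has_angle l N y z \<phi>'"
  shows "\<phi> = \<phi>'"
proof -
  have le: "inner_prod l \<alpha> \<beta> \<le> inner_prod l \<alpha>' \<beta>'" 
    if g: "g \<in> group_G l N" "g' \<in> group_G l N" and r: "\<alpha> \<in> roots l" "\<beta> \<in> roots l" "\<alpha>' \<in> roots l" "\<beta>' \<in> roots l"
      and nz: "c \<noteq> 0" "d \<noteq> 0" "c' \<noteq> 0" "d' \<noteq> 0"
      and e: "g y = c *\<^sub>v root_vec \<alpha>" "g z = d *\<^sub>v root_vec \<beta>" "g' y = c' *\<^sub>v root_vec \<alpha>'" "g' z = d' *\<^sub>v root_vec \<beta>'"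
    for g g' \<alpha> \<beta> \<alpha>' \<beta>' and c d c' d' :: 'k
  proof -
    obtain gi where gi: "gi \<in> group_G l N" "\<forall>y\<in>lie_space l. gi (g y) = y \<and> g (gi y) = y"
      using group_inverse[OF g(1)] by blast
    have "gi (c *\<^sub>v root_vec \<alpha>) = y" "gi (d *\<^sub>v root_vec \<beta>) = z" using gi(2) y e by metis+
    then show ?thesis
      using group_inner_mono[OF elem_group_comp[OF g(2) gi(1)] r nz] e by simp
  qed
  obtain g \<alpha> \<beta> c d where 1: "g \<in> group_G l N" "\<alpha> \<in> roots l" "\<beta> \<in> roots l" "c \<noteq> 0" "d \<noteq> 0"
     "g y = c *\<^sub>v root_vec \<alpha>" "g z = d *\<^sub>v root_vec \<beta>" "root_angle l \<alpha> \<beta> = \<phi>"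
    using a(1) unfolding has_angle_def by blast
  obtain g' \<alpha>' \<beta>' c' d' where 2: "g' \<in> group_G l N" "\<alpha>' \<in> roots l" "\<beta>' \<in> roots l" "c' \<noteq> 0" "d' \<noteq> 0"
     "g' y = c' *\<^sub>v root_vec \<alpha>'" "g' z = d' *\<^sub>v root_vec \<beta>'" "root_angle l \<alpha>' \<beta>' = \<phi>'"
    using a(2) unfolding has_angle_def by blast
  have "inner_prod l \<alpha> \<beta> = inner_prod l \<alpha>' \<beta>'"
    using le[OF 1(1) 2(1) 1(2,3) 2(2,3) 1(4,5) 2(4,5) 1(6,7) 2(6,7)]
      le[OF 2(1) 1(1) 2(2,3) 1(2,3) 2(4,5) 1(4,5) 2(6,7) 1(6,7)] by simp
  then show ?thesis using 1 2 root_angle_eq by metis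
qed

end

section \<open>Lifts and orbits\<close>

text \<open>The angle between e_delta and the lift of the normal form. The zero vector lifts to
  e_delta itself, so the value 0 keeps it out of all four classes.\<close>

fun orbit_angle :: "'k orbit_type \<Rightarrow> real" where
  "orbit_angle Zero = 0"
| "orbit_angle Singular = pi / 3"
| "orbit_angle (Brilliant_a a) = pi / 2"
| "orbit_angle Brilliant_b = pi / 2"
| "orbit_angle (Luminous a) = 2 * pi / 3"
| "orbit_angle (Dark k a) = pi"

lemma types_with_angle:
  "{t \<in> orbit_types S R. orbit_angle t = pi / 3} = {Singular}"
  "{t \<in> orbit_types S R. orbit_angle t = pi / 2} = Brilliant_a ` S \<union> {Brilliant_b}"
  "{t \<in> orbit_types S R. orbit_angle t = 2 * pi / 3} = Luminous ` S"
  "{t \<in> orbit_types S R. orbit_angle t = pi} = {Dark k a | k a. k \<in> units_of_field \<and> a \<in> R k}"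
  by (auto simp: orbit_types_def)

text \<open>The image of \<open>unit_vec m\<close> under a unipotent isometry that moves only the coordinates
  \<open>\<plusminus>m, \<plusminus>n\<close>; the coefficient of \<open>unit_vec (- m)\<close> makes it isotropic.\<close>

definition tvec :: "int \<Rightarrow> int \<Rightarrow> 'a::comm_ring_1 \<Rightarrow> 'a \<Rightarrow> 'a nvec" where
  "tvec m n x y = (\<lambda>p. unit_vec m p + x * unit_vec (- n) p + y * unit_vec n p - x * y * unit_vec (- m) p)"

lemma tvec_reach:
  assumes v: "valid l m n"
  shows "\<exists>h\<in>Eops 1 l. h (unit_vec m) = tvec m n x y \<and> (\<forall>v. v m = 0 \<and> v n = 0 \<and> v (- n) = 0 \<longrightarrow> h v = v)"
proof -
  have mn: "m \<in> idx 1 l" "n \<in> idx 1 l" "\<bar>m\<bar> \<noteq> \<bar>n\<bar>" using v by (auto simp: valid_def)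
  have "(\<lambda>v. opv n (- m) y (opv (- n) (- m) x v)) \<in> Eops 1 l"
    using mn by (intro Eops_step Eops_opv) auto
  moreover have "opv n (- m) y (opv (- n) (- m) x (unit_vec m)) = tvec m n x y"
    using valid_ne[OF v] by (auto simp: opv_def tvec_def unit_vec_def fun_eq_iff)
  moreover have "opv n (- m) y (opv (- n) (- m) x v) = v" if "v m = 0 \<and> v n = 0 \<and> v (- n) = 0" for v
    using valid_ne[OF v] that by (auto simp: opv_def fun_eq_iff)
  ultimately show ?thesis by (intro bexI[of _ "\<lambda>v. opv n (- m) y (opv (- n) (- m) x v)"]) auto
qed

text \<open>One of the entries at m, - n, - m is used to clear the rest: the last if y is nonzero,
  the one at - n if only x is. All operators fix vectors without components at - m, n, - n, so the
  plane of e_delta will not move.\<close>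

lemma tvec_reduce:
  fixes x y :: "'a::field"
  assumes v: "valid l m n" and xy: "x = 0 \<Longrightarrow> y = 0"
  shows "\<exists>h\<in>Eops 1 l. \<exists>c. c \<noteq> 0 \<and> h (tvec m n x y) = (\<lambda>p. c * unit_vec (if x = 0 then m else if y = 0 then - n else - m) p)
     \<and> (\<forall>v. v (- m) = 0 \<and> v n = 0 \<and> v (- n) = 0 \<longrightarrow> h v = v)"
proof -
  have mn: "m \<in> idx 1 l" "n \<in> idx 1 l" "\<bar>m\<bar> \<noteq> \<bar>n\<bar>" using v by (auto simp: valid_def)
  note ne = valid_ne[OF v]
  consider "x = 0" "y = 0" | "x \<noteq> 0" "y = 0" | "x \<noteq> 0" "y \<noteq> 0" using xy by blast
  then show ?thesis
  proof cases
    case 1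
    then show ?thesis
      by (intro bexI[of _ "\<lambda>v. v"] exI[of _ 1]) (auto simp: tvec_def Eops_id)
  next
    case 2
    have "opv m n (- 1 / x) (tvec m n x y) = (\<lambda>p. x * unit_vec (- n) p)"
      using ne 2 by (auto simp: opv_def tvec_def unit_vec_def fun_eq_iff)
    moreover have "opv m n (- 1 / x) v = v" if "v (- m) = 0 \<and> v n = 0 \<and> v (- n) = 0" for v
      using ne that by (auto simp: opv_def fun_eq_iff)
    ultimately show ?thesis using 2 mn
      by (intro bexI[of _ "opv m n (- 1 / x)"] exI[of _ x]) (auto intro: Eops_opv)
  next
    case 3
    have "(\<lambda>v. opv n m (1 / x) (opv (- n) m (1 / y) v)) \<in> Eops 1 l"
      using mn by (intro Eops_step Eops_opv) auto
    moreover have "opv n m (1 / x) (opv (- n) m (1 / y) (tvec m n x y)) = (\<lambda>p. (- x * y) * unit_vec (- m) p)"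
      using ne 3 by (auto simp: opv_def tvec_def unit_vec_def fun_eq_iff)
    moreover have "opv n m (1 / x) (opv (- n) m (1 / y) v) = v" if "v (- m) = 0 \<and> v n = 0 \<and> v (- n) = 0" for v
      using ne that by (auto simp: opv_def fun_eq_iff)
    ultimately show ?thesis using 3
      by (intro bexI[of _ "\<lambda>v. opv n m (1 / x) (opv (- n) m (1 / y) v)"] exI[of _ "- x * y"]) auto
  qed
qed

lemma Bil_split:
  assumes "l > 4"
  shows "Bil l v w = v 1 * w (- 1) + v (- 1) * w 1 + v 2 * w (- 2) + v (- 2) * w 2 + (\<Sum>p\<in>idx 3 l. v p * w (- p))"
proof -
  have e: "idx 1 l = {1, - 1, 2, - 2} \<union> idx 3 l" "{1, - 1, 2, - 2} \<inter> idx 3 l = {}" using assms by (auto simp: idx_def)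
  show ?thesis unfolding Bil_def e(1) by (subst sum.union_disjoint) (use e(2) in \<open>auto simp: add.assoc\<close>)
qed

lemma wedge_pluecker: "wedge a b r s * wedge a b p q = wedge a b r p * wedge a b s q - wedge a b r q * wedge a b s p"
  by (simp add: wedge_def algebra_simps)

lemma wedge_row: "wedge a b r = lin (a r) b (- b r) a"
  by (auto simp: wedge_def lin_def fun_eq_iff)

text \<open>By the Pluecker relation the bivector is determined by its rows \<open>1\<close> and \<open>2\<close>; the entries of
  these rows outside \<open>idx 3 l\<close> follow from the isotropy of the rows.\<close>

lemma isotropic_wedge_eqI:
  fixes a b a' b' :: "'a::field nvec"
  assumes l: "l > 4" and two: "(2 :: 'a) \<noteq> 0"
    and iso: "Bil l a a = 0" "Bil l a b = 0" "Bil l b b = 0" "Bil l a' a' = 0" "Bil l a' b' = 0" "Bil l b' b' = 0"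
    and one: "wedge a b 1 2 = 1" "wedge a' b' 1 2 = 1"
    and sum0: "wedge a b 1 (- 1) + wedge a b 2 (- 2) = 0" "wedge a' b' 1 (- 1) + wedge a' b' 2 (- 2) = 0"
    and eq: "\<And>j. j \<in> idx 3 l \<Longrightarrow> wedge a b 1 j = wedge a' b' 1 j" "\<And>j. j \<in> idx 3 l \<Longrightarrow> wedge a b 2 j = wedge a' b' 2 j"
    and pq: "p \<in> idx 1 l" "q \<in> idx 1 l"
  shows "wedge a b p q = wedge a' b' p q"
proof -
  have B0: "Bil l (wedge a b r) (wedge a b s) = 0" "Bil l (wedge a' b' r) (wedge a' b' s) = 0" for r s
    unfolding wedge_row Bil_lin using iso by (simp_all add: Bil_sym[of l b a] Bil_sym[of l b' a'])
  have d: "wedge u v r r = 0" "wedge u v 2 1 = - wedge u v 1 2" for u v :: "'a nvec" and r by (simp_all add: wedge_def)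
  have S: "(\<Sum>p\<in>idx 3 l. wedge a b r p * wedge a b s (- p)) = (\<Sum>p\<in>idx 3 l. wedge a' b' r p * wedge a' b' s (- p))"
    if "r \<in> {1, 2}" "s \<in> {1, 2}" for r s
    using that eq by (intro sum.cong) auto
  have double: "2 * x = 2 * y" if "x + x + s = 0" "y + y + s = 0" for x y s :: 'a
  proof -
    have "x + x + s = y + y + s" using that by (simp only:)
    then have "x + x = y + y" by (rule add_right_imp_eq)
    then show ?thesis by (simp only: mult_2)
  qed
  define T where "T r s = (\<Sum>p\<in>idx 3 l. wedge a b r p * wedge a b s (- p))" for r s
  note B = B0(1)[unfolded Bil_split[OF l] T_def[symmetric]]
  have T': "(\<Sum>p\<in>idx 3 l. wedge a' b' r p * wedge a' b' s (- p)) = T r s" if "r \<in> {1, 2}" "s \<in> {1, 2}" for r s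
    using S[OF that] by (simp add: T_def)
  note B' = B0(2)[unfolded Bil_split[OF l]]
  have 11: "2 * wedge a b 1 (- 2) = 2 * wedge a' b' 1 (- 2)"
    by (rule double[of _ "T 1 1"]) (use B[of 1 1] B'[of 1 1] T'[of 1 1] in \<open>simp_all add: d one\<close>)
  have 22: "2 * wedge a b 2 (- 1) = 2 * wedge a' b' 2 (- 1)"
    by (rule double[of _ "- T 2 2"]) (use B[of 2 2] B'[of 2 2] T'[of 2 2] in \<open>auto simp: d one algebra_simps\<close>)
  \<comment> \<open>The Cartan condition merges the two unknown entries in the relation between the
    rows 1 and 2 into one, which can then be solved for.\<close>
  have m: "wedge a b 2 (- 2) = - wedge a b 1 (- 1)" "wedge a' b' 2 (- 2) = - wedge a' b' 1 (- 1)"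
    using sum0 by (simp_all add: eq_neg_iff_add_eq_0 add.commute)
  have 12: "2 * wedge a b 1 (- 1) = 2 * wedge a' b' 1 (- 1)"
    by (rule double[of _ "- T 1 2"]) (use B[of 1 2] B'[of 1 2] T'[of 1 2] in \<open>auto simp: d one m algebra_simps\<close>)
  have c: "wedge a b 1 (- 2) = wedge a' b' 1 (- 2)" "wedge a b 2 (- 1) = wedge a' b' 2 (- 1)" "wedge a b 1 (- 1) = wedge a' b' 1 (- 1)"
    using 11 22 12 two unfolding mult_cancel_left by blast+
  have rows: "wedge a b 1 j = wedge a' b' 1 j \<and> wedge a b 2 j = wedge a' b' 2 j" if "j \<in> idx 1 l" for j
  proof -
    have "j = 1 \<or> j = 2 \<or> j = - 1 \<or> j = - 2 \<or> j \<in> idx 3 l" using that by (auto simp: idx_def)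
    then show ?thesis by (elim disjE) (simp_all only: eq c m d one simp_thms)
  qed
  show ?thesis
    using wedge_pluecker[of a b 1 2 p q] wedge_pluecker[of a' b' 1 2 p q] rows[OF pq(1)] rows[OF pq(2)] unfolding one by simp
qed

context chevalley_D begin

lemma valid_special: "valid l 2 (- 3)" "valid l 2 3" "valid l 1 (- 4)" "valid l 1 4" "valid l 1 2" "valid l 1 3" "valid l 2 4"
  using l by (auto simp: valid_def idx_def)

text \<open>The factor \<open>sg\<close> is -1 for weights of opposite sign in this order and (-1)^q
  for 0 < p < q; hence -1 for \<open>rt 2 3\<close> and 1 for \<open>rt 1 4\<close>, which sets
  e_tau apart.\<close>

lemma Psi_special:
  "Psi l (root_vec (root_lambda l) :: 'k vec) p q = - rbv 2 (- 3) p q"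
  "Psi l (root_vec (root_rho l) :: 'k vec) p q = - rbv 2 3 p q"
  "Psi l (root_vec (root_sigma l) :: 'k vec) p q = - rbv 1 (- 4) p q"
  "Psi l (root_vec (root_tau l) :: 'k vec) p q = rbv 1 4 p q"
  "Psi l (root_vec (root_delta l) :: 'k vec) p q = rbv 1 2 p q"
  unfolding root_lambda_rt[OF l] root_rho_rt[OF l] root_sigma_rt[OF l] root_tau_rt[OF l] root_delta_rt[OF l]
    Psi_rv[OF valid_special(1)] Psi_rv[OF valid_special(2)] Psi_rv[OF valid_special(3)] Psi_rv[OF valid_special(4)] Psi_rv[OF valid_special(5)]
  by (simp_all add: sg_opp sg_pos)

lemma special_roots1: "root_lambda l \<in> roots1 l" "root_rho l \<in> roots1 l" "root_sigma l \<in> roots1 l" "root_tau l \<in> roots1 l"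
  unfolding root_lambda_rt[OF l] root_rho_rt[OF l] root_sigma_rt[OF l] root_tau_rt[OF l] roots1_iff[OF l]
  using idx_num[OF l] by blast+

lemma normal_form_V1: "(normal_form l t :: 'k vec) \<in> space_V1 l"
proof -
  have "(0 :: 'k vec) \<in> space_V1 l" by (simp add: space_V1_iff)
  then show ?thesis
    by (cases t) (auto intro!: V1_add V1_smult V1_rv special_roots1)
qed

lemma normal_form_rows: "Psi l (normal_form l t :: 'k vec) 1 = pair_u t" "Psi l (normal_form l t :: 'k vec) 2 = pair_w t"
proof -
  have z: "Psi l (0 :: 'k vec) p q = 0" for p q by (simp add: Psi_def Hc_def)
  show "Psi l (normal_form l t :: 'k vec) 1 = pair_u t" "Psi l (normal_form l t :: 'k vec) 2 = pair_w t"
    by (cases t; intro ext; simp add: z Psi_add Psi_smult Psi_special pvec_def wedge_def unit_vec_def)+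
qed

lemma delta_root: "root_delta l \<in> roots l"
  unfolding root_delta_rt[OF l] by (rule rt_roots[OF valid_special(5)])

lemma orbit0_self: "x \<in> orbit0 l N x"
  unfolding orbit0_def by (intro CollectI exI[of _ "\<lambda>v. v"]) (auto intro: elem_group.one)

lemma orbit0_eq:
  fixes x :: "'k vec"
  assumes x: "x \<in> space_V1 l" and x': "x' \<in> orbit0 l N x"
  shows "orbit0 l N x' = orbit0 l N x"
proof -
  obtain g where g: "g \<in> group_G0 l N" "x' = g x" using x' by (auto simp: orbit0_def)
  obtain g' where g': "g' \<in> group_G0 l N" "g' x' = x" using group_inverse[OF g(1) roots0_roots] V1_lie_space[OF x] g(2) by blast
  show ?thesis unfolding orbit0_def
  proof (intro equalityI subsetI; clarify)
    fix k :: "'k vec \<Rightarrow> 'k vec" assume k: "k \<in> group_G0 l N"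
    show "\<exists>m. k x' = m x \<and> m \<in> group_G0 l N" using elem_group_comp[OF k g(1)] g(2) by (intro exI[of _ "\<lambda>v. k (g v)"]) simp
    show "\<exists>m. k x = m x' \<and> m \<in> group_G0 l N" using elem_group_comp[OF k g'(1)] g'(2) by (intro exI[of _ "\<lambda>v. k (g' v)"]) simp
  qed
qed

lemma orbit0_reach:
  fixes x :: "'k vec"
  assumes x: "x \<in> space_V1 l" "x' \<in> space_V1 l"
  shows "x' \<in> orbit0 l N x \<longleftrightarrow> reach l (Psi l x 1) (Psi l x 2) (Psi l x' 1) (Psi l x' 2)"
proof
  assume "x' \<in> orbit0 l N x"
  then show "reach l (Psi l x 1) (Psi l x 2) (Psi l x' 1) (Psi l x' 2)" using G0_reach[OF _ x(1)] by (auto simp: orbit0_def)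
next
  assume "reach l (Psi l x 1) (Psi l x 2) (Psi l x' 1) (Psi l x' 2)"
  then obtain g where g: "g \<in> group_G0 l N" "g x \<in> space_V1 l" "Psi l (g x) 1 = Psi l x' 1" "Psi l (g x) 2 = Psi l x' 2"
    using reach_G0[OF x(1)] by blast
  then have "g x = x'" by (intro V1_eqI x)
  then show "x' \<in> orbit0 l N x" using g(1) by (auto simp: orbit0_def)
qed

section \<open>The equations of the lift in terms of rows\<close>

definition is_lift :: "'k vec \<Rightarrow> 'k vec \<Rightarrow> bool" where
  "is_lift x y \<longleftrightarrow> root_element l N y \<and>
     (\<forall>\<alpha>\<in>roots1 l. y (Root \<alpha>) = x (Root \<alpha>)) \<and>
     y (Root (root_delta l)) = 1 \<and>
     (\<forall>i\<in>{1..l}. simple_root l i \<notin> roots0 l \<longrightarrow> y (Cartan i) = 0)"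

definition rows_lift :: "'k vec \<Rightarrow> 'k vec \<Rightarrow> bool" where
  "rows_lift x y \<longleftrightarrow> (\<forall>j\<in>idx 3 l. Psi l y 1 j = Psi l x 1 j \<and> Psi l y 2 j = Psi l x 2 j)
     \<and> Psi l y 1 2 = 1 \<and> Psi l y 1 (- 1) + Psi l y 2 (- 2) = 0"

text \<open>In the extended diagram \<delta> is attached to the node l - 1 alone, so the Cartan
  condition on the lift is a single equation.\<close>

lemma simple_roots0: "i \<in> {1..l} \<Longrightarrow> simple_root l i \<notin> roots0 l \<longleftrightarrow> i = l - 1"
proof
  assume i: "i \<in> {1..l}" and n: "simple_root l i \<notin> roots0 l"
  show "i = l - 1"
  proof (rule ccontr)
    assume "i \<noteq> l - 1"
    then consider "i = 1" | "i = l" "i \<noteq> 1" | "i \<noteq> 1" "i \<le> l - 2" using i by force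
    then have "simple_root l i \<in> roots0 l"
    proof cases
      case 1
      have "int l - 1 \<in> idx 3 l" "int l \<in> idx 3 l" "\<bar>int l - 1\<bar> \<noteq> \<bar>int l\<bar>" using l by (auto simp: idx_def)
      then show ?thesis using 1 simple_root_rt(1)[OF i l] roots0_gens(3) by simp
    next
      case 2
      then show ?thesis using simple_root_rt(1)[OF i l] roots0_gens(1) by simp
    next
      case 3
      have "int (l + 1 - i) \<in> idx 3 l" "- int (l + 2 - i) \<in> idx 3 l" "\<bar>int (l + 1 - i)\<bar> \<noteq> \<bar>- int (l + 2 - i)\<bar>" 
        using 3 i l by (auto simp: idx_def)
      then show ?thesis using simple_root_rt(1)[OF i l, unfolded if_not_P[OF 3(1)]] roots0_gens(3) by metis
    qed
    then show False using n by simp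
  qed
next
  assume "i = l - 1"
  then have "simple_root l i = rt 2 (- 3)" using root_lambda_rt[OF l] by (simp add: root_lambda_def)
  moreover have "inner_prod l (rt 2 (- 3)) (root_delta l) = 1" unfolding inner_delta[OF l] by (simp add: hgt_def kd_def)
  ultimately show "simple_root l i \<notin> roots0 l" by (simp add: roots0_def)
qed

text \<open>The first two coordinates of the Cartan part are c_l and c_(l-1) - c_l, where c_k is its
  coefficient at node k, so their sum isolates c_(l-1).\<close>

lemma Cartan_condition: "Psi l y 1 (- 1) + Psi l y 2 (- 2) = (y :: 'k vec) (Cartan (l - 1))"
proof -
  have i: "1 \<in> idx 1 l" "2 \<in> idx 1 l" using l by (auto simp: idx_def)
  have e: "l + 1 - 2 = l - 1" "l + 2 - 2 = l" "2 \<le> l - 2" using l by auto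
  have "Hc l y 1 = y (Cartan l)" "Hc l y 2 = y (Cartan (l - 1)) - y (Cartan l)"
    using simple_comb[OF l, of "\<lambda>k. y (Cartan k)" 1] simple_comb[OF l, of "\<lambda>k. y (Cartan k)" 2, unfolded e]
    by (simp_all add: Hc_def ev_def e)
  then show ?thesis using Psi_opp[OF i(1), of y] Psi_opp[OF i(2), of y] by simp
qed

lemma is_lift_rows: "is_lift x y \<longleftrightarrow> root_element l N y \<and> rows_lift x y"
proof -
  have c: "(\<forall>i\<in>{1..l}. simple_root l i \<notin> roots0 l \<longrightarrow> y (Cartan i) = 0) \<longleftrightarrow> Psi l y 1 (- 1) + Psi l y 2 (- 2) = 0"
  proof -
    have "l - 1 \<in> {1..l}" using l by auto
    then show ?thesis unfolding Cartan_condition using simple_roots0 by blast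
  qed
  have v: "valid l 1 j" "valid l 2 j" if "j \<in> idx 3 l" for j using that l by (auto simp: valid_def idx_def)
  have canc: "y (Root (rt i j)) = x (Root (rt i j)) \<longleftrightarrow> Psi l y i j = Psi l x i j" if "valid l i j" for i j
    unfolding Psi_valid[OF that] using sg_sq_valid[OF that] by metis
  have r: "(\<forall>\<alpha>\<in>roots1 l. y (Root \<alpha>) = x (Root \<alpha>)) \<longleftrightarrow> (\<forall>j\<in>idx 3 l. Psi l y 1 j = Psi l x 1 j \<and> Psi l y 2 j = Psi l x 2 j)"
  proof -
    have "(\<forall>\<alpha>\<in>roots1 l. P \<alpha>) \<longleftrightarrow> (\<forall>j\<in>idx 3 l. P (rt 1 j) \<and> P (rt 2 j))" for P
    proof (intro iffI ballI)
      fix j assume "\<forall>\<alpha>\<in>roots1 l. P \<alpha>" "j \<in> idx 3 l"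
      moreover from this have "rt 1 j \<in> roots1 l" "rt 2 j \<in> roots1 l" unfolding roots1_iff[OF l] by blast+
      ultimately show "P (rt 1 j) \<and> P (rt 2 j)" by simp
    next
      fix \<alpha> assume a: "\<forall>j\<in>idx 3 l. P (rt 1 j) \<and> P (rt 2 j)" "\<alpha> \<in> roots1 l"
      then obtain j where "j \<in> idx 3 l" "\<alpha> = rt 1 j \<or> \<alpha> = rt 2 j" unfolding roots1_iff[OF l] by blast
      then show "P \<alpha>" using a(1) by auto
    qed
    then have "(\<forall>\<alpha>\<in>roots1 l. y (Root \<alpha>) = x (Root \<alpha>)) \<longleftrightarrow>
      (\<forall>j\<in>idx 3 l. y (Root (rt 1 j)) = x (Root (rt 1 j)) \<and> y (Root (rt 2 j)) = x (Root (rt 2 j)))" .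
    also have "\<dots> \<longleftrightarrow> (\<forall>j\<in>idx 3 l. Psi l y 1 j = Psi l x 1 j \<and> Psi l y 2 j = Psi l x 2 j)"
      by (intro ball_cong refl) (simp only: canc[OF v(1)] canc[OF v(2)])
    finally show ?thesis .
  qed
  have d: "y (Root (root_delta l)) = 1 \<longleftrightarrow> Psi l y 1 2 = 1"
    unfolding root_delta_rt[OF l] Psi_valid[OF valid_special(5)] by (simp add: sg_pos)
  show ?thesis unfolding is_lift_def rows_lift_def c r d by blast
qed

text \<open>A root vector is a product of two orthogonal isotropic weight vectors up to sign, and
  the group acts by isometries of the natural module.\<close>

lemma root_element_bivector:
  assumes "root_element l N (y :: 'k vec)"
  shows "y \<in> lie_space l \<and> (\<exists>a b. Psi l y = wedge a b \<and> Bil l a a = 0 \<and> Bil l a b = 0 \<and> Bil l b b = 0)"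
proof -
  obtain g \<alpha> where g: "g \<in> group_G l N" "\<alpha> \<in> roots l" "y = g (root_vec \<alpha>)" using assms by (auto simp: root_element_def)
  obtain i j where v: "valid l i j" "\<alpha> = rt i j" using g(2) by (rule root_cases)
  have ij: "i \<in> idx 1 l" "j \<in> idx 1 l" using v by (auto simp: valid_def)
  obtain h :: "'k nvec \<Rightarrow> 'k nvec" where h: "h \<in> Eops 1 l" "\<And>y a b. y \<in> lie_space l \<Longrightarrow> Psi l y = wedge a b \<Longrightarrow> Psi l (g y) = wedge (h a) (h b)"
    using group_Eops[OF g(1)] by blast
  define a where "a = lin (of_int (sg i j)) (unit_vec i) 0 (unit_vec i :: 'k nvec)"
  have "Psi l (root_vec \<alpha> :: 'k vec) = wedge a (unit_vec j)"
    unfolding a_def bscale_wedge(1)[symmetric] by (intro ext) (simp add: v Psi_rv bscale_def)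
  then have P: "Psi l y = wedge (h a) (h (unit_vec j))" unfolding g(3) by (rule h(2)[OF rv_space[OF g(2)]])
  have u: "Bil l (unit_vec i) (unit_vec i) = (0::'k)" "Bil l (unit_vec i) (unit_vec j) = (0::'k)" "Bil l (unit_vec j) (unit_vec j) = (0::'k)"
    using valid_ne[OF v(1)] by (simp_all add: Bil_unit_unit[OF ij(1)] Bil_unit_unit[OF ij(2)])
  have "Bil l a a = 0" "Bil l a (unit_vec j) = 0"
    using Bil_lin[of l "of_int (sg i j)" "unit_vec i" 0 "unit_vec i" 0 "unit_vec j"] u
    unfolding a_def Bil_lin by (simp_all add: lin_def Bil_linear[of l _ _ 0, simplified] Bil_def[of l "\<lambda>_. 0"] u)
  then show ?thesis using P u group_space[OF g(1) order_refl rv_space[OF g(2)]] Bil_Eops[OF h(1)] unfolding g(3)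
    by (intro conjI exI[of _ "h a"] exI[of _ "h (unit_vec j)"]) auto
qed

lemma lift_unique:
  assumes "is_lift x y" "is_lift x y'"
  shows "y = y'"
proof -
  have re: "root_element l N y" "root_element l N y'" and rl: "rows_lift x y" "rows_lift x y'" using assms by (auto simp: is_lift_rows)
  obtain a b where ab: "Psi l y = wedge a b" "Bil l a a = 0" "Bil l a b = 0" "Bil l b b = 0" using root_element_bivector[OF re(1)] by blast
  obtain a' b' where ab': "Psi l y' = wedge a' b'" "Bil l a' a' = 0" "Bil l a' b' = 0" "Bil l b' b' = 0" using root_element_bivector[OF re(2)] by blast
  show ?thesis
  proof (rule Psi_inj)
    show "y \<in> lie_space l" "y' \<in> lie_space l" using re root_element_bivector by blast+
    fix p q assume pq: "p \<in> idx 1 l" "q \<in> idx 1 l"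
    show "Psi l y p q = Psi l y' p q" unfolding ab(1) ab'(1)
      by (rule isotropic_wedge_eqI[OF l two ab(2-4) ab'(2-4) _ _ _ _ _ _ pq])
        (use rl in \<open>auto simp: rows_lift_def ab(1) ab'(1)\<close>)
  qed
qed

lemma root_lift_eq: "is_lift x y \<Longrightarrow> root_lift l N x = y"
  unfolding root_lift_def is_lift_def[symmetric] using lift_unique by (intro the_equality) auto

text \<open>Equivariance of the equations: the entry (1, 2) is a determinant for SL_2, the Cartan
  condition is the trace of the 2 by 2 block of rows 1, 2 and columns -1, -2, and the operators
  inside W leave both alone.\<close>

lemma rows_lift_xr:
  assumes a: "\<alpha> \<in> roots0 l" and r: "rows_lift x y"
  shows "rows_lift (xr \<alpha> c x) (xr \<alpha> c y)"
proof -
  have i12: "(1::int) \<notin> idx 3 l" "(2::int) \<notin> idx 3 l" "(- 1::int) \<notin> idx 3 l" "(- 2::int) \<notin> idx 3 l" "(1::int) \<in> idx 1 l" "(2::int) \<in> idx 1 l"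
    using l by (auto simp: idx_def)
  have v: "valid l 1 (- 2)" "valid l 2 (- 1)" using valid_12[OF l] by (simp_all add: valid_sym)
  have d: "Psi l y 1 1 = 0" "Psi l y 2 2 = 0" using i12 by (simp_all add: Psi_diag)
  from a consider i j where "i \<in> idx 3 l" "j \<in> idx 3 l" "\<bar>i\<bar> \<noteq> \<bar>j\<bar>" "\<alpha> = rt i j" | "\<alpha> = rt 1 (- 2)" | "\<alpha> = rt 2 (- 1)"
    unfolding roots0_iff[OF l] by blast
  then show ?thesis
  proof cases
    case 1
    have v: "valid l i j" by (rule valid_idx[OF _ 1(1-3)]) simp
    have ne: "1 \<noteq> i" "1 \<noteq> j" "2 \<noteq> i" "2 \<noteq> j" "- 1 \<noteq> i" "- 1 \<noteq> j" "- 2 \<noteq> i" "- 2 \<noteq> j" using 1 i12 by auto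
    have t: "tens (opv i j d) Y m q = opv i j d (Y m) q" if "m = 1 \<or> m = 2" for d :: 'k and Y m q
      using that ne by (auto simp: tens_def opv_def)
    have ij: "- i \<in> idx 3 l" "- j \<in> idx 3 l" using 1 by auto
    show ?thesis using r ne 1(1,2) ij unfolding rows_lift_def 1(4) Psi_xr[OF v] by (simp add: t) (auto simp: opv_def)
  next
    case 2
    have "q \<noteq> 1 \<and> q \<noteq> 2 \<and> q \<noteq> - 1 \<and> q \<noteq> - 2" if "q \<in> idx 3 l" for q using that i12 by auto
    then show ?thesis using r d unfolding rows_lift_def 2 Psi_xr[OF v(1)] by (auto simp: tens_def opv_def algebra_simps)
  next
    case 3
    have "q \<noteq> 1 \<and> q \<noteq> 2 \<and> q \<noteq> - 1 \<and> q \<noteq> - 2" if "q \<in> idx 3 l" for q using that i12 by auto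
    then show ?thesis using r d unfolding rows_lift_def 3 Psi_xr[OF v(2)] by (auto simp: tens_def opv_def algebra_simps)
  qed
qed

lemma is_lift_G0:
  assumes "g \<in> group_G0 l N" "is_lift x y" 
  shows "is_lift (g x) (g y)"
proof -
  have "rows_lift (g x) (g y)" using assms(1)
    by (induction rule: elem_group.induct) (use assms(2) in \<open>auto simp: is_lift_rows intro: rows_lift_xr\<close>)
  moreover have "root_element l N (g y)"
  proof -
    obtain g' \<alpha> where g': "g' \<in> group_G l N" "\<alpha> \<in> roots l" "y = g' (root_vec \<alpha>)"
      using assms(2) unfolding is_lift_def root_element_def by blast
    have "(\<lambda>v. g (g' v)) \<in> group_G l N" by (rule elem_group_comp[OF elem_group_mono[OF assms(1) roots0_roots] g'(1)])
    then show ?thesis unfolding root_element_def using g' by (intro bexI[of _ "\<lambda>v. g (g' v)"] bexI[of _ \<alpha>]) auto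
  qed
  ultimately show ?thesis by (simp add: is_lift_rows)
qed

text \<open>A root orthogonal to \<delta> is not its negative and gives no root when added to it, so
  it brackets to zero with e_delta.\<close>

lemma G0_delta:
  assumes "(g :: 'k vec \<Rightarrow> 'k vec) \<in> group_G0 l N" 
  shows "g (root_vec (root_delta l)) = root_vec (root_delta l)"
  using assms
proof (induction rule: elem_group.induct)
  case (mult g \<alpha> c)
  have a: "\<alpha> \<in> roots l" "inner_prod l \<alpha> (root_delta l) = 0" using mult(2) by (auto simp: roots0_def)
  have n: "\<alpha> + root_delta l \<notin> roots l" using root_add_iff[OF a(1) delta_root] a(2) by simp
  have "root_delta l \<noteq> - \<alpha>"
  proof
    assume "root_delta l = - \<alpha>"
    then show False using a inner_self[OF a(1)] by (simp add: inner_uminus)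
  qed
  then have b: "bracket l N (root_vec \<alpha>) (root_vec (root_delta l)) = (0 :: 'k vec)"
    by (rule bracket_no_sum[OF a(1) delta_root n])
  show ?case unfolding mult(3) elem_root_alt b bracket_zero_right by (simp add: smult_vec_def plus_fun_def zero_fun_def)
qed simp

lemma has_angle_G0:
  fixes y :: "'k vec"
  assumes g: "g \<in> group_G0 l N" and y: "y \<in> lie_space l" and a: "has_angle l N y (root_vec (root_delta l)) \<phi>"
  shows "has_angle l N (g y) (root_vec (root_delta l)) \<phi>"
proof -
  obtain g' where g': "g' \<in> group_G0 l N" "\<forall>y\<in>lie_space l. g' (g y) = y \<and> g (g' y) = y"
    using group_inverse[OF g roots0_roots] by blast
  obtain k \<alpha> \<beta> c d where 1: "k \<in> group_G l N" "\<alpha> \<in> roots l" "\<beta> \<in> roots l" "c \<noteq> 0" "d \<noteq> 0"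
     "k y = c *\<^sub>v root_vec \<alpha>" "k (root_vec (root_delta l)) = d *\<^sub>v root_vec \<beta>" "root_angle l \<alpha> \<beta> = \<phi>"
    using a unfolding has_angle_def by blast
  have "(\<lambda>v. k (g' v)) \<in> group_G l N" by (rule elem_group_comp[OF 1(1) elem_group_mono[OF g'(1) roots0_roots]])
  moreover have "k (g' (g y)) = c *\<^sub>v root_vec \<alpha>" "k (g' (root_vec (root_delta l))) = d *\<^sub>v root_vec \<beta>"
    using 1 g'(2) y G0_delta[OF g'(1)] by simp_all
  ultimately show ?thesis unfolding has_angle_def using 1 
    by (intro bexI[of _ "\<lambda>v. k (g' v)"] bexI[of _ \<alpha>] bexI[of _ \<beta>] exI[of _ c] exI[of _ d]) auto
qed

text \<open>The lift is a wedge b, where a and b are the images of f_1 and f_2 under isometries in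
  the disjoint coordinate sets 1, 3 and 2, 4 up to sign. Row 2 of this bivector within W is minus a,
  whence the signs of x1 and x2.\<close>

lemma lift_of_pair:
  fixes x1 x2 d1 d2 :: 'k
  assumes z: "x1 = 0 \<Longrightarrow> x2 = 0" "d1 = 0 \<Longrightarrow> d2 = 0"
    and x: "Psi l x 1 = pvec 4 d1 d2" "Psi l x 2 = pvec 3 (- x1) (- x2)"
  shows "\<exists>y. is_lift x y \<and> has_angle l N y (root_vec (root_delta l))
     (root_angle l (rt (if x1 = 0 then 1 else if x2 = 0 then - 3 else - 1) (if d1 = 0 then 2 else if d2 = 0 then - 4 else - 2)) (root_delta l))"
proof -
  define a where "a = tvec 1 3 x1 x2"
  define b where "b = tvec 2 4 d1 d2"
  obtain hA where hA: "hA \<in> Eops 1 l" "hA (unit_vec 1) = a" "\<And>v. v 1 = 0 \<and> v 3 = 0 \<and> v (- 3) = 0 \<Longrightarrow> hA v = v"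
    using tvec_reach[OF valid_special(6), of x1 x2] unfolding a_def by blast
  obtain hB where hB: "hB \<in> Eops 1 l" "hB (unit_vec 2) = b" "\<And>v. v 2 = 0 \<and> v 4 = 0 \<and> v (- 4) = 0 \<Longrightarrow> hB v = v"
    using tvec_reach[OF valid_special(7), of d1 d2] unfolding b_def by blast
  \<comment> \<open>The weights to which a and b are reduced by isometries that fix f_1 and f_2; the
    pair formed by the lift and e_delta becomes a pair of root vectors up to scalars, and the angle
    can be read off.\<close>
  define kA :: int where "kA = (if x1 = 0 then 1 else if x2 = 0 then - 3 else - 1)"
  define kB :: int where "kB = (if d1 = 0 then 2 else if d2 = 0 then - 4 else - 2)"
  obtain rA cA where rA: "rA \<in> Eops 1 l" "cA \<noteq> 0" "rA a = (\<lambda>p. cA * unit_vec kA p)" "\<And>v. v (- 1) = 0 \<and> v 3 = 0 \<and> v (- 3) = 0 \<Longrightarrow> rA v = v"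
    using tvec_reduce[OF valid_special(6) z(1)] unfolding a_def kA_def by blast
  obtain rB cB where rB: "rB \<in> Eops 1 l" "cB \<noteq> 0" "rB b = (\<lambda>p. cB * unit_vec kB p)" "\<And>v. v (- 2) = 0 \<and> v 4 = 0 \<and> v (- 4) = 0 \<Longrightarrow> rB v = v"
    using tvec_reduce[OF valid_special(7) z(2)] unfolding b_def kB_def by blast
  define \<delta> :: "'k vec" where "\<delta> = root_vec (root_delta l)"
  have sd: "\<delta> \<in> lie_space l" unfolding \<delta>_def by (rule rv_space[OF delta_root])
  have Pd: "Psi l \<delta> = wedge (unit_vec 1) (unit_vec 2)" unfolding \<delta>_def by (intro ext) (rule Psi_special)
  obtain g :: "'k vec \<Rightarrow> 'k vec" where g: "g \<in> group_G l N" "\<And>y a b. y \<in> lie_space l \<Longrightarrow> Psi l y = wedge a b \<Longrightarrow> Psi l (g y) = wedge (hB (hA a)) (hB (hA b))"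
    using Eops_group[OF Eops_comp[OF hB(1) hA(1)]] by blast
  obtain k :: "'k vec \<Rightarrow> 'k vec" where k: "k \<in> group_G l N" "\<And>y a b. y \<in> lie_space l \<Longrightarrow> Psi l y = wedge a b \<Longrightarrow> Psi l (k y) = wedge (rB (rA a)) (rB (rA b))"
    using Eops_group[OF Eops_comp[OF rB(1) rA(1)]] by blast
  define y where "y = g \<delta>"
  have sy: "y \<in> lie_space l" unfolding y_def by (rule group_space[OF g(1) order_refl sd])
  have "hA (unit_vec 2) = unit_vec 2" by (rule hA(3)) (simp add: unit_vec_def)
  moreover have "hB a = a" by (rule hB(3)) (simp add: a_def tvec_def unit_vec_def)
  ultimately have Py: "Psi l y = wedge a b" unfolding y_def g(2)[OF sd Pd] by (simp add: hA(2) hB(2))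
  have "root_element l N y" unfolding root_element_def y_def \<delta>_def using g(1) delta_root by blast
  moreover have "rows_lift x y"
  proof -
    have q: "q \<noteq> 1 \<and> q \<noteq> 2 \<and> q \<noteq> - 1 \<and> q \<noteq> - 2" if "q \<in> idx 3 l" for q using that by (auto simp: idx_def)
    show ?thesis unfolding rows_lift_def Py x
      using q by (auto simp: wedge_def a_def b_def tvec_def pvec_def unit_vec_def)
  qed
  ultimately have lift: "is_lift x y" by (simp add: is_lift_rows)
  have vk: "valid l kA kB" using l by (auto simp: kA_def kB_def valid_def idx_def)
  have "rA b = b" by (rule rA(4)) (simp add: b_def tvec_def unit_vec_def)
  moreover have "rB (\<lambda>p. cA * unit_vec kA p) = (\<lambda>p. cA * unit_vec kA p)" by (rule rB(4)) (simp add: kA_def unit_vec_def)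
  ultimately have Pk: "Psi l (k y) = wedge (\<lambda>p. cA * unit_vec kA p) (\<lambda>p. cB * unit_vec kB p)"
    unfolding k(2)[OF sy Py] by (simp add: rA(3) rB(3))
  define c where "c = cA * cB * of_int (sg kA kB)"
  have cs: "c * of_int (sg kA kB) = cA * cB" using sg_sq_valid[OF vk, of "cA * cB"] by (simp add: c_def mult_ac)
  have "k y = c *\<^sub>v root_vec (rt kA kB)"
  proof (rule Psi_inj)
    show "k y \<in> lie_space l" by (rule group_space[OF k(1) order_refl sy])
    show "c *\<^sub>v root_vec (rt kA kB) \<in> lie_space l" by (intro smult_space rv_space rt_roots vk)
    fix p q
    show "Psi l (k y) p q = Psi l (c *\<^sub>v root_vec (rt kA kB)) p q"
      unfolding Pk Psi_scaled_root_vec[OF vk] cs by (simp add: bscale_def wedge_def algebra_simps)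
  qed
  moreover have "k \<delta> = 1 *\<^sub>v root_vec (root_delta l)"
  proof -
    have u: "rA (unit_vec 1) = unit_vec 1" "rA (unit_vec 2) = unit_vec 2" by (rule rA(4), simp add: unit_vec_def)+
    have u': "rB (unit_vec 1) = unit_vec 1" "rB (unit_vec 2) = unit_vec 2" by (rule rB(4), simp add: unit_vec_def)+
    have "k \<delta> = \<delta>"
      by (rule Psi_inj) (use sd group_space[OF k(1) order_refl sd] in \<open>auto simp: k(2)[OF sd Pd] u u' Pd\<close>)
    then show ?thesis by (simp add: \<delta>_def smult_vec_def)
  qed
  moreover have "c \<noteq> 0" using cs rA(2) rB(2) by auto
  ultimately have "has_angle l N y \<delta> (root_angle l (rt kA kB) (root_delta l))"
    unfolding has_angle_def using k(1) rt_roots[OF vk] delta_root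
    by (intro bexI[of _ k] bexI[of _ "rt kA kB"] bexI[of _ "root_delta l"] exI[of _ c] exI[of _ 1]) auto
  then show ?thesis using lift unfolding kA_def kB_def \<delta>_def by blast
qed

lemma angle_values:
  assumes "\<alpha> \<in> roots l"
  shows "inner_prod l \<alpha> (root_delta l) = 2 \<Longrightarrow> root_angle l \<alpha> (root_delta l) = 0"
    "inner_prod l \<alpha> (root_delta l) = 1 \<Longrightarrow> root_angle l \<alpha> (root_delta l) = pi / 3"
    "inner_prod l \<alpha> (root_delta l) = 0 \<Longrightarrow> root_angle l \<alpha> (root_delta l) = pi / 2"
    "inner_prod l \<alpha> (root_delta l) = - 1 \<Longrightarrow> root_angle l \<alpha> (root_delta l) = 2 * pi / 3"
    "inner_prod l \<alpha> (root_delta l) = - 2 \<Longrightarrow> root_angle l \<alpha> (root_delta l) = pi"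
proof -
  have "arccos (1 / 2) = pi / 3" using arccos_cos[of "pi / 3"] by (simp add: cos_60)
  moreover have "arccos (- 1 / 2) = 2 * pi / 3" using arccos_cos[of "2 * pi / 3"] by (simp add: cos_120)
  ultimately show "inner_prod l \<alpha> (root_delta l) = 2 \<Longrightarrow> root_angle l \<alpha> (root_delta l) = 0"
    "inner_prod l \<alpha> (root_delta l) = 1 \<Longrightarrow> root_angle l \<alpha> (root_delta l) = pi / 3"
    "inner_prod l \<alpha> (root_delta l) = 0 \<Longrightarrow> root_angle l \<alpha> (root_delta l) = pi / 2"
    "inner_prod l \<alpha> (root_delta l) = - 1 \<Longrightarrow> root_angle l \<alpha> (root_delta l) = 2 * pi / 3"
    "inner_prod l \<alpha> (root_delta l) = - 2 \<Longrightarrow> root_angle l \<alpha> (root_delta l) = pi"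
    unfolding root_angle_eq[OF assms delta_root] by simp_all
qed

lemma normal_form_lift:
  fixes t :: "'k orbit_type"
  assumes t: "case t of Brilliant_a a \<Rightarrow> a \<noteq> 0 | Luminous a \<Rightarrow> a \<noteq> 0 | Dark k a \<Rightarrow> k \<noteq> 0 \<and> a \<noteq> 0 | _ \<Rightarrow> True"
  shows "\<exists>y. is_lift (normal_form l t) y \<and> has_angle l N y (root_vec (root_delta l)) (orbit_angle t)"
proof -
  have hg: "hgt 1 = 1" "hgt 2 = 1" "hgt (- 1) = - 1" "hgt (- 2) = - 1" "hgt (- 3) = 0" "hgt (- 4) = 0"
    by (simp_all add: hgt_def kd_def)
  have v: "valid l i j" if "i \<in> {1, - 1, - 3}" "j \<in> {2, - 2, - 4}" for i j
    using that l by (auto simp: valid_def idx_def)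
  have ang: "root_angle l (rt i j) (root_delta l) = x" if "valid l i j" "hgt i + hgt j = n"
     "(n, x) \<in> {(2, 0), (1, pi / 3), (0, pi / 2), (- 1, 2 * pi / 3), (- 2, pi)}" for i j n x
    using angle_values[OF rt_roots[OF that(1)]] inner_delta[OF l, of i j] that(2,3) by auto
  note R = normal_form_rows[of t]
  show ?thesis
  proof (cases t)
    case T: Zero
    have "\<exists>y. is_lift (normal_form l t) y \<and> has_angle l N y (root_vec (root_delta l)) (root_angle l (rt 1 2) (root_delta l))"
      using lift_of_pair[of 0 0 0 0 "normal_form l t"] R t unfolding T by simp
    moreover have "root_angle l (rt 1 2) (root_delta l) = orbit_angle t"
      unfolding T orbit_angle.simps by (rule ang[OF v refl]) (simp_all add: hg)
    ultimately show ?thesis by (simp only:)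
  next
    case T: Singular
    have "\<exists>y. is_lift (normal_form l t) y \<and> has_angle l N y (root_vec (root_delta l)) (root_angle l (rt (- 3) 2) (root_delta l))"
      using lift_of_pair[of 1 0 0 0 "normal_form l t"] R t unfolding T by simp
    moreover have "root_angle l (rt (- 3) 2) (root_delta l) = orbit_angle t"
      unfolding T orbit_angle.simps by (rule ang[OF v refl]) (simp_all add: hg)
    ultimately show ?thesis by (simp only:)
  next
    case T: (Brilliant_a a)
    have "\<exists>y. is_lift (normal_form l t) y \<and> has_angle l N y (root_vec (root_delta l)) (root_angle l (rt (- 1) 2) (root_delta l))"
      using lift_of_pair[of 1 a 0 0 "normal_form l t"] R t unfolding T by simp
    moreover have "root_angle l (rt (- 1) 2) (root_delta l) = orbit_angle t"
      unfolding T orbit_angle.simps by (rule ang[OF v refl]) (simp_all add: hg)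
    ultimately show ?thesis by (simp only:)
  next
    case T: Brilliant_b
    have "\<exists>y. is_lift (normal_form l t) y \<and> has_angle l N y (root_vec (root_delta l)) (root_angle l (rt (- 3) (- 4)) (root_delta l))"
      using lift_of_pair[of 1 0 "- 1" 0 "normal_form l t"] R t unfolding T by simp
    moreover have "root_angle l (rt (- 3) (- 4)) (root_delta l) = orbit_angle t"
      unfolding T orbit_angle.simps by (rule ang[OF v refl]) (simp_all add: hg)
    ultimately show ?thesis by (simp only:)
  next
    case T: (Luminous a)
    have "\<exists>y. is_lift (normal_form l t) y \<and> has_angle l N y (root_vec (root_delta l)) (root_angle l (rt (- 1) (- 4)) (root_delta l))"
      using lift_of_pair[of 1 a "- 1" 0 "normal_form l t"] R t unfolding T by simp
    moreover have "root_angle l (rt (- 1) (- 4)) (root_delta l) = orbit_angle t"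
      unfolding T orbit_angle.simps by (rule ang[OF v refl]) (simp_all add: hg)
    ultimately show ?thesis by (simp only:)
  next
    case T: (Dark k a)
    have "\<exists>y. is_lift (normal_form l t) y \<and> has_angle l N y (root_vec (root_delta l)) (root_angle l (rt (- 1) (- 2)) (root_delta l))"
      using lift_of_pair[of 1 a "- 1" "k / a" "normal_form l t"] R t unfolding T by simp
    moreover have "root_angle l (rt (- 1) (- 2)) (root_delta l) = orbit_angle t"
      unfolding T orbit_angle.simps by (rule ang[OF v refl]) (simp_all add: hg)
    ultimately show ?thesis by (simp only:)
  qed
qed

section \<open>Bijection between types and orbits, and the classes by angle\<close>

context
  fixes S :: "'k set" and R :: "'k \<Rightarrow> 'k set"
  assumes S: "representatives units_of_field square_rel S"
    and R: "\<And>k. k \<in> units_of_field \<Longrightarrow> representatives units_of_field (norm_rel k) (R k)"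
begin

lemma orbit_types_nonzero:
  assumes "t \<in> orbit_types S R"
  shows "case t of Brilliant_a a \<Rightarrow> a \<noteq> 0 | Luminous a \<Rightarrow> a \<noteq> 0 | Dark k a \<Rightarrow> k \<noteq> 0 \<and> a \<noteq> 0 | _ \<Rightarrow> True"
proof -
  have "a \<noteq> 0" if "a \<in> R k" "k \<noteq> 0" for a k
    using R[of k] that by (auto simp: representatives_def units_of_field_def)
  then show ?thesis using assms S by (auto simp: orbit_types_def representatives_def units_of_field_def)
qed

lemma orbit_classification:
  assumes x: "x \<in> space_V1 l"
  shows "\<exists>t\<in>orbit_types S R. x \<in> orbit0 l N (normal_form l t)"
proof -
  obtain t where t: "t \<in> orbit_types S R" "reach l (Psi l x 1) (Psi l x 2) (pair_u t) (pair_w t)"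
    using pair_classification[OF l two V1_rows_supp[OF x] V1_rows_supp[OF x] S R] by blast
  then have "normal_form l t \<in> orbit0 l N x" using orbit0_reach[OF x normal_form_V1[of t]] by (simp add: normal_form_rows)
  then have "orbit0 l N (normal_form l t) = orbit0 l N x" by (rule orbit0_eq[OF x])
  then show ?thesis using t(1) orbit0_self by blast
qed

lemma orbits_bij: "bij_betw (\<lambda>t. orbit0 l N (normal_form l t)) (orbit_types S R) (orbit0 l N ` (space_V1 l :: 'k vec set))"
  unfolding bij_betw_def
proof (intro conjI inj_onI equalityI subsetI)
  fix t t' assume t: "t \<in> orbit_types S R" "t' \<in> orbit_types S R" 
    and e: "orbit0 l N (normal_form l t) = orbit0 l N (normal_form l t')"
  have "normal_form l t' \<in> orbit0 l N (normal_form l t)" "normal_form l t \<in> orbit0 l N (normal_form l t')"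
    using e orbit0_self by blast+
  then have "reach l (pair_u t) (pair_w t) (pair_u t') (pair_w t')" "reach l (pair_u t') (pair_w t') (pair_u t) (pair_w t)"
    by (simp_all add: orbit0_reach[OF normal_form_V1 normal_form_V1] normal_form_rows)
  then show "t = t'" using pair_type_unique[OF l two S _ t] R by blast
next
  fix o' assume "o' \<in> (\<lambda>t. orbit0 l N (normal_form l t)) ` orbit_types S R"
  then show "o' \<in> orbit0 l N ` space_V1 l" using normal_form_V1 by blast
next
  fix o' assume "o' \<in> orbit0 l N ` (space_V1 l :: 'k vec set)"
  then obtain x where x: "x \<in> space_V1 l" "o' = orbit0 l N x" by blast
  obtain t where t: "t \<in> orbit_types S R" "x \<in> orbit0 l N (normal_form l t)" using orbit_classification[OF x(1)] by blast
  then have "o' = orbit0 l N (normal_form l t)" using orbit0_eq[OF normal_form_V1] x(2) by blast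
  then show "o' \<in> (\<lambda>t. orbit0 l N (normal_form l t)) ` orbit_types S R" using t(1) by blast
qed

text \<open>\<open>G_0\<close> carries lifts to lifts and fixes e_delta, so the angle computed for
  the normal form holds along its orbit; uniqueness of the angle gives the converse.\<close>

lemma orbit_angle_iff:
  assumes t: "t \<in> orbit_types S R" and x: "x \<in> orbit0 l N (normal_form l t)"
  shows "has_angle l N (root_lift l N x) (root_vec (root_delta l)) \<phi> \<longleftrightarrow> \<phi> = orbit_angle t"
proof -
  obtain y where y: "is_lift (normal_form l t) y" "has_angle l N y (root_vec (root_delta l)) (orbit_angle t)"
    using normal_form_lift[OF orbit_types_nonzero[OF t]] by blast
  obtain g where g: "g \<in> group_G0 l N" "x = g (normal_form l t)" using x by (auto simp: orbit0_def)
  have sy: "y \<in> lie_space l" using y(1) root_element_bivector by (auto simp: is_lift_def)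
  have gy: "g y \<in> lie_space l" by (rule group_space[OF g(1) roots0_roots sy])
  have e: "root_lift l N x = g y" unfolding g(2) by (rule root_lift_eq[OF is_lift_G0[OF g(1) y(1)]])
  have "has_angle l N (g y) (root_vec (root_delta l)) (orbit_angle t)" by (rule has_angle_G0[OF g(1) sy y(2)])
  then show ?thesis unfolding e using has_angle_unique[OF gy rv_space[OF delta_root]] by blast
qed

lemma V1_with_angle:
  "{x \<in> space_V1 l :: 'k vec set. has_angle l N (root_lift l N x) (root_vec (root_delta l)) \<phi>}
    = (\<Union>t\<in>{t \<in> orbit_types S R. orbit_angle t = \<phi>}. orbit0 l N (normal_form l t))"
proof (intro equalityI subsetI)
  fix x :: "'k vec" assume x: "x \<in> {x \<in> space_V1 l. has_angle l N (root_lift l N x) (root_vec (root_delta l)) \<phi>}"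
  then obtain t where t: "t \<in> orbit_types S R" "x \<in> orbit0 l N (normal_form l t)" using orbit_classification by blast
  have "\<phi> = orbit_angle t" using orbit_angle_iff[OF t] x by simp
  then show "x \<in> (\<Union>t\<in>{t \<in> orbit_types S R. orbit_angle t = \<phi>}. orbit0 l N (normal_form l t))"
    using t by blast
next
  fix x :: "'k vec" assume "x \<in> (\<Union>t\<in>{t \<in> orbit_types S R. orbit_angle t = \<phi>}. orbit0 l N (normal_form l t))"
  then obtain t where t: "t \<in> orbit_types S R" "orbit_angle t = \<phi>" "x \<in> orbit0 l N (normal_form l t)" by blast
  moreover have "x \<in> space_V1 l" using t(3) G0_reach[OF _ normal_form_V1] by (auto simp: orbit0_def)
  ultimately show "x \<in> {x \<in> space_V1 l. has_angle l N (root_lift l N x) (root_vec (root_delta l)) \<phi>}"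
    using orbit_angle_iff[OF t(1,3)] t(2) by simp
qed

end

end

theorem mainTheorem4:
  fixes l :: nat
    and N :: "root \<Rightarrow> root \<Rightarrow> int"
    and S :: "'k::field set"
    and R :: "'k \<Rightarrow> 'k set"
  assumes l: "l > 4"
    and char: "CHAR('k) \<noteq> 2"
    and chevalley: "chevalley_constants l N"
    and positive: "positive_constants l N"
    and S: "representatives units_of_field square_rel S"
    and R: "\<And>k. k \<in> units_of_field \<Longrightarrow> representatives units_of_field (norm_rel k) (R k)"
  shows "bij_betw (\<lambda>t. orbit0 l N (normal_form l t)) (orbit_types S R)
           (orbit0 l N ` (space_V1 l :: 'k vec set))
    \<and> {x \<in> space_V1 l. singular l N x} = orbit0 l N (normal_form l Singular :: 'k vec)
    \<and> {x \<in> space_V1 l. brilliant l N x} =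
        (\<Union>a\<in>S. orbit0 l N (normal_form l (Brilliant_a a))) \<union> orbit0 l N (normal_form l Brilliant_b)
    \<and> {x \<in> space_V1 l. luminous l N x} =
        (\<Union>a\<in>S. orbit0 l N (normal_form l (Luminous a)))
    \<and> {x \<in> space_V1 l. dark l N x} =
        (\<Union>k\<in>units_of_field. \<Union>a\<in>R k. orbit0 l N (normal_form l (Dark k a)))"
proof -
  interpret chevalley_D l N "TYPE('k)"
    by unfold_locales (use l chevalley positive two_neq_zero[OF char] in auto)
  have V: "{x \<in> space_V1 l :: 'k vec set. has_angle l N (root_lift l N x) (root_vec (root_delta l)) \<phi>}
      = (\<Union>t\<in>{t \<in> orbit_types S R. orbit_angle t = \<phi>}. orbit0 l N (normal_form l t))" for \<phi>
    by (rule V1_with_angle[OF S R])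
  note T = types_with_angle
  have "{x \<in> space_V1 l. singular l N x} = orbit0 l N (normal_form l Singular :: 'k vec)"
    unfolding singular_def V T by auto
  moreover have "{x \<in> space_V1 l. brilliant l N x} =
        (\<Union>a\<in>S. orbit0 l N (normal_form l (Brilliant_a a))) \<union> orbit0 l N (normal_form l Brilliant_b)"
    unfolding brilliant_def V T by auto
  moreover have "{x \<in> space_V1 l. luminous l N x} = (\<Union>a\<in>S. orbit0 l N (normal_form l (Luminous a)))"
    unfolding luminous_def V T by auto
  moreover have "{x \<in> space_V1 l. dark l N x} =
        (\<Union>k\<in>units_of_field. \<Union>a\<in>R k. orbit0 l N (normal_form l (Dark k a)))"
    unfolding dark_def V T by blast
  moreover have "bij_betw (\<lambda>t. orbit0 l N (normal_form l t)) (orbit_types S R) (orbit0 l N ` (space_V1 l :: 'k vec set))"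
    by (rule orbits_bij[OF S R])
  ultimately show ?thesis by blast
qed

end
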